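(* Let $m,n\in\mathbb{N}_0$ with $2\mid(m+n)$, and assume $m\ge1$ when $n\ge2$. Then $$\begin{aligned} \Phi_2^{\mathrm{Rev}}(-m,-n;1,\Lambda) ={}&\frac{B_{m+n+2}}{(n+1)(m+n+2)}+(\log 2\pi)\frac{B_{m+n+1}}{m+n+1}\\ &-\sum_{\substack{1\le k\le n\\ k\ \mathrm{odd}}}\binom{n}{k}\frac{k+1}{B_{k+1}}\,\zeta'(-k)\,\frac{B_{m+n-k+1}}{m+n-k+1}\\ &+\sum_{\substack{1\le k\le n\\ k\ \mathrm{even}}}\binom{n}{k}\frac{B_{m+n-k+1}}{m+n-k+1}\,(-a_k+k!\,b_k)\\ &-\frac{(-1)^m\,m!\,n!}{(m+n+1)!}\,M(-m-n-1). \end{aligned}$$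
   Context: $\mathbb{N}=\{1,2,3,\dots\}$, $\mathbb{N}_0=\mathbb{N}\cup\{0\}$. $\zeta$ is the Riemann zeta function, $\Gamma$ the gamma function, and $M(s)=-\zeta'(s)/\zeta(s)$. $\Lambda$ is the von Mangoldt function: $\Lambda(n)=\log p$ if $n=p^j$ with $p$ prime and $j\in\mathbb{N}$, and $\Lambda(n)=0$ otherwise. $\Phi_2(s_1,s_2;1,\Lambda)$ denotes the meromorphic continuation to $\mathbb{C}^2$ (known to exist) of the double series $\sum_{m_1=1}^\infty\sum_{m_2=1}^\infty\frac{\Lambda(m_2)}{m_1^{s_1}(m_1+m_2)^{s_2}}$, which converges absolutely for $\Re s_2>1$, $\Re(s_1+s_2)>2$. Its reverse value at $(u_1,u_2)$ is the iterated limit $$\Phi_2^{\mathrm{Rev}}(u_1,u_2;1,\Lambda)=\lim_{s_2\to u_2}\ \lim_{s_1\to u_1}\Phi_2(s_1,s_2;1,\Lambda).$$ Bernoulli numbers are given by $\frac{te^t}{e^t-1}=\sum_{n\ge0}B_n\frac{t^n}{n!}$ (so $B_1=\tfrac12$). For even $k\in\mathbb{N}$, $a_k=\frac{1}{2\pi i}\int_{|\xi+k|=1/2}\frac{M(\xi)}{\xi+k}\,d\xi$ is the constant term of the Laurent series of $M(s)$ at $s=-k$; for $k\in\mathbb{N}_0$, $b_k=\frac{1}{2\pi i}\int_{|\xi+k|=1/2}\frac{\Gamma(\xi)}{\xi+k}\,d\xi$ is the constant term of the Laurent series of $\Gamma(s)$ at $s=-k$. *)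

theory Defs
  imports "HOL-Complex_Analysis.Complex_Analysis" "HOL-Number_Theory.Prime_Powers"
begin

text \<open>The value at the pole \<open>1\<close> is left unspecified.\<close>

definition riemann_zeta :: "complex \<Rightarrow> complex" where
  "riemann_zeta = (SOME f. f holomorphic_on - {1} \<and>
     (\<forall>s. Re s > 1 \<longrightarrow> f s = (\<Sum>\<^sub>\<infinity>n\<in>{1::nat..}. 1 / of_nat n powr s)))"

definition M :: "complex \<Rightarrow> complex" where
  "M s = - deriv riemann_zeta s / riemann_zeta s"

definition bernoulli :: "nat \<Rightarrow> real" where
  "bernoulli n = fact n * fps_nth (fps_X * fps_exp 1 / (fps_exp 1 - 1)) n"

text \<open>The division above is exact: denominator and numerator both have subdegree \<open>1\<close>.\<close>

lemma bernoulli_fps: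
  "Abs_fps (\<lambda>n. bernoulli n / fact n) * (fps_exp 1 - 1) = fps_X * fps_exp 1"
proof -
  have nz: "(fps_exp 1 - 1 :: real fps) $ Suc 0 \<noteq> 0" by simp
  have ne: "(fps_exp 1 - 1 :: real fps) \<noteq> 0"
    using nz by (metis fps_zero_nth)
  have "subdegree (fps_exp 1 - 1 :: real fps) \<le> 1"
    using nz by (intro subdegree_leI) simp
  moreover have "subdegree (fps_X * fps_exp 1 :: real fps) = 1" by simp
  ultimately have "(fps_exp 1 - 1 :: real fps) dvd fps_X * fps_exp 1"
    by (subst fps_dvd_iff) (use ne in auto)
  moreover have "Abs_fps (\<lambda>n. bernoulli n / fact n) = fps_X * fps_exp 1 / (fps_exp 1 - 1)"
    by (simp add: bernoulli_def fps_eq_iff)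
  ultimately show ?thesis by simp
qed

definition a_coeff :: "nat \<Rightarrow> complex" where
  "a_coeff k = 1 / (2 * of_real pi * \<i>) *
     contour_integral (circlepath (- of_nat k) (1/2)) (\<lambda>\<xi>. M \<xi> / (\<xi> + of_nat k))"

definition b_coeff :: "nat \<Rightarrow> complex" where
  "b_coeff k = 1 / (2 * of_real pi * \<i>) *
     contour_integral (circlepath (- of_nat k) (1/2)) (\<lambda>\<xi>. Gamma \<xi> / (\<xi> + of_nat k))"

text \<open>Functions of two complex variables.\<close>

definition holomorphic2_on ::
    "(complex \<times> complex \<Rightarrow> complex) \<Rightarrow> (complex \<times> complex) set \<Rightarrow> bool" where
  "holomorphic2_on f U \<longleftrightarrow>
     (\<forall>p\<in>U. \<exists>a b. (f has_derivative (\<lambda>(x, y). a * x + b * y)) (at p))"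

text \<open>
  Meromorphic on \<open>\<complex>\<^sup>2\<close>: locally a quotient of holomorphic functions whose denominator does not
  vanish identically. The values of \<open>F\<close> at the zeros of the denominator are not constrained.
\<close>

definition meromorphic2 :: "(complex \<times> complex \<Rightarrow> complex) \<Rightarrow> bool" where
  "meromorphic2 F \<longleftrightarrow>
     (\<forall>p. \<exists>U g h. open U \<and> connected U \<and> p \<in> U \<and> holomorphic2_on g U \<and> holomorphic2_on h U \<and>
        (\<exists>q\<in>U. h q \<noteq> 0) \<and> (\<forall>q\<in>U. h q \<noteq> 0 \<longrightarrow> F q = g q / h q))"

text \<open>
  A meromorphic continuation is determined up to its values on a nowhere dense analytic set
  (polar set, or zeros of redundant local denominators). The choice of these values does not
  affect the reverse values below at points \<open>(-m, -n)\<close>: for \<open>s\<^sub>2\<close> near \<open>-n\<close> and different from it,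
  that set has no points \<open>(s\<^sub>1, s\<^sub>2)\<close> with \<open>s\<^sub>1\<close> in a punctured neighbourhood of \<open>-m\<close>.
\<close>

definition Phi2 :: "complex \<times> complex \<Rightarrow> complex" where
  "Phi2 = (SOME F. meromorphic2 F \<and>
     (\<forall>s1 s2. Re s2 > 1 \<longrightarrow> Re (s1 + s2) > 2 \<longrightarrow>
        F (s1, s2) = (\<Sum>\<^sub>\<infinity>(m1, m2)\<in>{1::nat..} \<times> {1::nat..}.
          mangoldt m2 / (of_nat m1 powr s1 * of_nat (m1 + m2) powr s2))))"

text \<open>
  \<open>lim\<close> over \<open>s\<^sub>2 \<rightarrow> u\<^sub>2\<close> of \<open>lim\<close> over \<open>s\<^sub>1 \<rightarrow> u\<^sub>1\<close> of \<open>F\<close> exists and equals \<open>L\<close>, where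
  \<open>G s\<^sub>2\<close> is the inner limit.
\<close>

definition has_reverse_value ::
    "(complex \<times> complex \<Rightarrow> complex) \<Rightarrow> complex \<Rightarrow> complex \<Rightarrow> complex \<Rightarrow> bool" where
  "has_reverse_value F u1 u2 L \<longleftrightarrow>
     (\<exists>G. (\<forall>\<^sub>F s2 in at u2. ((\<lambda>s1. F (s1, s2)) \<longlongrightarrow> G s2) (at u1)) \<and> (G \<longlongrightarrow> L) (at u2))"

end

theory Submission
  imports Defs "HOL-Real_Asymp.Real_Asymp"
begin

text \<open>
  Summing over \<open>m\<^sub>1\<close> first, the double series is \<open>1/\<Gamma>(s\<^sub>2)\<close> times the Mellin transform at \<open>s\<^sub>2\<close> of
  \<open>\<lambda>(t) Li\<^sub>s(e\<^sup>-\<^sup>t)\<close> with \<open>s = s\<^sub>1\<close> and \<open>\<lambda>(t) = \<Sum> \<Lambda>(n) e\<^sup>-\<^sup>n\<^sup>t\<close>. The expansion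
  \<open>Li\<^sub>s(e\<^sup>-\<^sup>t) = \<Gamma>(1 - s) t\<^sup>s\<^sup>-\<^sup>1 + \<Sum>\<^sub>k\<^sub><\<^sub>K (-t)\<^sup>k/k! \<zeta>(s - k) + O(t\<^sup>K)\<close> turns it into
  \<open>\<Gamma>(1 - s\<^sub>1) \<Gamma>(s\<^sub>1 + s\<^sub>2 - 1)/\<Gamma>(s\<^sub>2) M(s\<^sub>1 + s\<^sub>2 - 1)\<close> plus the terms
  \<open>(-1)\<^sup>k/k! (s\<^sub>2)\<^sub>k \<zeta>(s\<^sub>1 - k) M(s\<^sub>2 + k)\<close> for \<open>k < K\<close> plus \<open>1/\<Gamma>(s\<^sub>2)\<close> times a function holomorphic
  for \<open>Re s\<^sub>2 > 1 - K\<close>. As \<open>K\<close> grows this gives the continuation to \<open>\<complex>\<^sup>2\<close>. At \<open>s\<^sub>1 = -m\<close> everything is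
  regular for \<open>s\<^sub>2\<close> close to but different from \<open>-n\<close>, and in the limit \<open>s\<^sub>2 \<rightarrow> -n\<close> the remainder
  disappears because of the factor \<open>1/\<Gamma>(s\<^sub>2)\<close>; \<open>k = n + 1\<close> contributes through the pole of \<open>M\<close> at \<open>1\<close>.
  For even \<open>n - k > 0\<close> the pole of \<open>M\<close> is harmless, since then \<open>\<zeta>(-m - k) = 0\<close> and the term vanishes
  identically in \<open>s\<^sub>2\<close>; on the other side of the identity the Bernoulli number is \<open>0\<close>.
\<close>

section \<open>Holomorphic and meromorphic functions of two variables\<close>

text \<open>\<open>Phi2\<close> and \<open>riemann_zeta\<close> are chosen by \<open>SOME\<close>,
  so each needs an existence proof before anything is known about it, and \<open>Phi2\<close> also
  needs a uniqueness statement that tolerates arbitrary values on the polar set. Equality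
  "eventually in s2, eventually in s1" is the form that an iterated limit can see. The expansion of
  the polylogarithm is derived only for 0 < Re s < 1, away from the poles of Gamma(1 - s) and zeta(s
  - k), whereas the remainder must be holomorphic in s across those points. The way out is to split
  1/(e^x - 1): removing e^-x/x instead of 1/x leads to an incomplete gamma integral, whose
  complementary part over [0, 1] supplies exactly the poles of zeta(s - k). The same kernel
  continues zeta, and its Taylor coefficients at 0 give zeta(-l), so no functional equation enters:
  log(2 pi) is obtained from Wallis' product, and the nonvanishing of zeta at odd negative integers
  from the alternating signs of the even Bernoulli numbers.\<close>

lemma holomorphic2_on_subset: "holomorphic2_on f U \<Longrightarrow> V \<subseteq> U \<Longrightarrow> holomorphic2_on f V"
  by (auto simp: holomorphic2_on_def)

lemma holomorphic2_on_imp_continuous_on: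
  assumes "holomorphic2_on f U"
  shows "continuous_on U f"
  using assms unfolding holomorphic2_on_def
  by (meson continuous_at_imp_continuous_on has_derivative_continuous)

lemma holomorphic2_on_fst_slice:
  assumes "holomorphic2_on f U"
  shows "(\<lambda>x. f (x, y)) holomorphic_on {x. (x, y) \<in> U}"
  unfolding holomorphic_on_def
proof
  fix x assume "x \<in> {x. (x, y) \<in> U}"
  then obtain a b where d: "(f has_derivative (\<lambda>(x, y). a * x + b * y)) (at (x, y))"
    using assms unfolding holomorphic2_on_def by blast
  have "((\<lambda>x. (x, y)) has_derivative (\<lambda>x. (x, 0))) (at x)"
    by (auto intro!: derivative_eq_intros)
  from has_derivative_compose[OF this d]
  have "((\<lambda>x. f (x, y)) has_field_derivative a) (at x)"
    by (simp add: has_field_derivative_def)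
  then show "(\<lambda>x. f (x, y)) field_differentiable at x within {x. (x, y) \<in> U}"
    using field_differentiable_at_within field_differentiable_def by blast
qed

lemma holomorphic2_on_snd_slice:
  assumes "holomorphic2_on f U"
  shows "(\<lambda>y. f (x, y)) holomorphic_on {y. (x, y) \<in> U}"
  unfolding holomorphic_on_def
proof
  fix y assume "y \<in> {y. (x, y) \<in> U}"
  then obtain a b where d: "(f has_derivative (\<lambda>(x, y). a * x + b * y)) (at (x, y))"
    using assms unfolding holomorphic2_on_def by blast
  have "((\<lambda>y. (x, y)) has_derivative (\<lambda>y. (0, y))) (at y)"
    by (auto intro!: derivative_eq_intros)
  from has_derivative_compose[OF this d]
  have "((\<lambda>y. f (x, y)) has_field_derivative b) (at y)"
    by (simp add: has_field_derivative_def)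
  then show "(\<lambda>y. f (x, y)) field_differentiable at y within {y. (x, y) \<in> U}"
    using field_differentiable_at_within field_differentiable_def by blast
qed

lemma holomorphic2_on_const [simp]: "holomorphic2_on (\<lambda>p. c) U"
  unfolding holomorphic2_on_def
  by (auto intro!: exI[of _ 0] derivative_eq_intros)

lemma holomorphic2_on_linear: "holomorphic2_on (\<lambda>p. a * fst p + b * snd p + c) U"
  unfolding holomorphic2_on_def
  by (intro ballI exI[of _ a] exI[of _ b]) (auto intro!: derivative_eq_intros simp: case_prod_beta)

lemma holomorphic2_on_add:
  assumes "holomorphic2_on f U" "holomorphic2_on g U"
  shows "holomorphic2_on (\<lambda>p. f p + g p) U"
  unfolding holomorphic2_on_def
proof
  fix p assume p: "p \<in> U"
  obtain a b where "(f has_derivative (\<lambda>(x, y). a * x + b * y)) (at p)"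
    using assms p unfolding holomorphic2_on_def by blast
  moreover obtain a' b' where "(g has_derivative (\<lambda>(x, y). a' * x + b' * y)) (at p)"
    using assms p unfolding holomorphic2_on_def by blast
  ultimately have "((\<lambda>p. f p + g p) has_derivative (\<lambda>(x, y). (a + a') * x + (b + b') * y)) (at p)"
    by (auto intro!: derivative_eq_intros simp: case_prod_beta algebra_simps)
  then show "\<exists>a b. ((\<lambda>p. f p + g p) has_derivative (\<lambda>(x, y). a * x + b * y)) (at p)"
    by blast
qed

lemma holomorphic2_on_mult:
  assumes "holomorphic2_on f U" "holomorphic2_on g U"
  shows "holomorphic2_on (\<lambda>p. f p * g p) U"
  unfolding holomorphic2_on_def
proof
  fix p assume p: "p \<in> U"
  obtain a b where "(f has_derivative (\<lambda>(x, y). a * x + b * y)) (at p)"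
    using assms p unfolding holomorphic2_on_def by blast
  moreover obtain a' b' where "(g has_derivative (\<lambda>(x, y). a' * x + b' * y)) (at p)"
    using assms p unfolding holomorphic2_on_def by blast
  ultimately have "((\<lambda>p. f p * g p) has_derivative
      (\<lambda>(x, y). (f p * a' + g p * a) * x + (f p * b' + g p * b) * y)) (at p)"
    by (auto intro!: derivative_eq_intros simp: case_prod_beta algebra_simps)
  then show "\<exists>a b. ((\<lambda>p. f p * g p) has_derivative (\<lambda>(x, y). a * x + b * y)) (at p)"
    by blast
qed

lemma holomorphic2_on_diff:
  assumes "holomorphic2_on f U" "holomorphic2_on g U"
  shows "holomorphic2_on (\<lambda>p. f p - g p) U"
  using holomorphic2_on_add[OF assms(1) holomorphic2_on_mult[OF holomorphic2_on_const[of "-1"] assms(2)]]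
  by simp

lemma holomorphic2_on_compose:
  assumes "\<phi> holomorphic_on V" "open V" "holomorphic2_on l U" "\<And>p. p \<in> U \<Longrightarrow> l p \<in> V"
  shows "holomorphic2_on (\<lambda>p. \<phi> (l p)) U"
  unfolding holomorphic2_on_def
proof
  fix p assume p: "p \<in> U"
  obtain a b where d: "(l has_derivative (\<lambda>(x, y). a * x + b * y)) (at p)"
    using assms p unfolding holomorphic2_on_def by blast
  have "(\<phi> has_derivative (*) (deriv \<phi> (l p))) (at (l p))"
    using holomorphic_derivI[OF assms(1,2) assms(4)[OF p]] by (simp add: has_field_derivative_def)
  from has_derivative_compose[OF d this]
  have "((\<lambda>p. \<phi> (l p)) has_derivative
      (\<lambda>(x, y). (deriv \<phi> (l p) * a) * x + (deriv \<phi> (l p) * b) * y)) (at p)"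
    by (simp add: case_prod_unfold algebra_simps)
  then show "\<exists>a b. ((\<lambda>p. \<phi> (l p)) has_derivative (\<lambda>(x, y). a * x + b * y)) (at p)"
    by blast
qed

lemma holomorphic2_on_compose_linear:
  assumes "\<phi> holomorphic_on V" "open V" "\<And>p. p \<in> U \<Longrightarrow> a * fst p + b * snd p + c \<in> V"
  shows "holomorphic2_on (\<lambda>p. \<phi> (a * fst p + b * snd p + c)) U"
  by (rule holomorphic2_on_compose[OF assms(1,2) holomorphic2_on_linear assms(3)])

section \<open>The identity theorem in two variables\<close>

lemma open_prod_contains_balls:
  assumes "open (U :: (complex \<times> complex) set)" "(a, b) \<in> U"
  obtains r where "r > 0" "ball a r \<times> ball b r \<subseteq> U"
proof -
  obtain A B where AB: "open A" "open B" "(a, b) \<in> A \<times> B" "A \<times> B \<subseteq> U"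
    using open_prod_elim[OF assms] .
  then obtain r1 r2 where "r1 > 0" "ball a r1 \<subseteq> A" "r2 > 0" "ball b r2 \<subseteq> B"
    by (meson mem_Sigma_iff open_contains_ball)
  then have "ball a (min r1 r2) \<times> ball b (min r1 r2) \<subseteq> U"
    using AB(4) by fastforce
  then show ?thesis using that[of "min r1 r2"] \<open>r1 > 0\<close> \<open>r2 > 0\<close> by simp
qed

lemma holomorphic_eq_0_on_ball:
  assumes "f holomorphic_on ball a r" "open A" "x \<in> A" "x \<in> ball a r"
    "\<And>y. y \<in> A \<Longrightarrow> f y = 0" "z \<in> ball a r"
  shows "f z = (0::complex)"
proof (rule analytic_continuation[of f "ball a r" "A \<inter> ball a r" x])
  show "x islimpt A \<inter> ball a r"
    using assms by (intro interior_limit_point) (auto simp: interior_open open_Int)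
qed (use assms in auto)

text \<open>The one-variable identity theorem twice: along horizontal lines at heights close to
  \<open>y\<close> it spreads the zeros over the first disc, and along each vertical line over the
  second.\<close>

lemma holomorphic2_eq_0_on_bidisc:
  assumes "holomorphic2_on f (ball a r \<times> ball b r)" "open V" "(x, y) \<in> V"
    "x \<in> ball a r" "y \<in> ball b r" "\<And>q. q \<in> V \<Longrightarrow> f q = 0"
    "u \<in> ball a r" "v \<in> ball b r"
  shows "f (u, v) = 0"
proof -
  obtain e where e: "e > 0" "ball x e \<times> ball y e \<subseteq> V"
    using open_prod_contains_balls[OF assms(2,3)] .
  have *: "f (u', v') = 0" if "u' \<in> ball a r" "v' \<in> ball y e \<inter> ball b r" for u' v'
  proof (rule holomorphic_eq_0_on_ball[of "\<lambda>x. f (x, v')" a r "ball x e" x])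
    show "(\<lambda>x. f (x, v')) holomorphic_on ball a r"
      using holomorphic2_on_fst_slice[OF assms(1), of v'] that by (auto elim: holomorphic_on_subset)
    show "f (w, v') = 0" if "w \<in> ball x e" for w
      using e that \<open>v' \<in> _\<close> by (intro assms(6)) auto
  qed (use e assms that in auto)
  show ?thesis
  proof (rule holomorphic_eq_0_on_ball[of "\<lambda>y. f (u, y)" b r "ball y e \<inter> ball b r" y])
    show "(\<lambda>y. f (u, y)) holomorphic_on ball b r"
      using holomorphic2_on_snd_slice[OF assms(1), of u] assms(7) by (auto elim: holomorphic_on_subset)
  qed (use * e assms in auto)
qed

text \<open>Zeros in two variables are not isolated, so vanishing on an open set takes the place of
  an accumulation point. The interior \<open>J\<close> of the zero set is relatively closed in
  \<open>U\<close>, because a bidisc about a limit point of \<open>J\<close> meets \<open>J\<close>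
  and hence lies in it.\<close>

lemma holomorphic2_eq_0_on_connected:
  assumes f: "holomorphic2_on f U" and "open U" "connected U"
    and V: "open V" "V \<inter> U \<noteq> {}" "\<And>q. q \<in> V \<inter> U \<Longrightarrow> f q = 0" and "p \<in> U"
  shows "f p = 0"
proof -
  define J where "J = interior {q \<in> U. f q = 0}"
  have J: "open J" "J \<subseteq> U" "\<And>q. q \<in> J \<Longrightarrow> f q = 0"
    unfolding J_def using interior_subset by force+
  have "V \<inter> U \<subseteq> J"
    unfolding J_def using V \<open>open U\<close> by (intro interior_maximal) auto
  have J_closed: "z \<in> J" if z: "z \<in> U" "z \<in> closure J" for z
  proof -
    obtain a b where ab: "z = (a, b)" by force
    obtain r where r: "r > 0" "ball a r \<times> ball b r \<subseteq> U"
      using open_prod_contains_balls[OF \<open>open U\<close>] z ab by blast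
    have op: "open (ball a r \<times> ball b r)" by (intro open_Times) auto
    have "z \<in> ball a r \<times> ball b r" using r ab by simp
    then have "J \<inter> (ball a r \<times> ball b r) \<noteq> {}"
      using z(2) op open_Int_closure_eq_empty[OF op, of J] by blast
    then obtain x y where xy: "(x, y) \<in> J" "x \<in> ball a r" "y \<in> ball b r" by blast
    have "ball a r \<times> ball b r \<subseteq> {q \<in> U. f q = 0}"
      using holomorphic2_eq_0_on_bidisc[OF holomorphic2_on_subset[OF f r(2)] J(1) xy J(3)] r(2) by blast
    then have "ball a r \<times> ball b r \<subseteq> J"
      unfolding J_def using op by (rule interior_maximal)
    then show ?thesis using r ab by auto
  qed
  have "J = U"
  proof (rule ccontr)
    assume "J \<noteq> U"
    have "open (U - closure J)" using \<open>open U\<close> by (simp add: open_Diff)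
    moreover have "U \<subseteq> J \<union> (U - closure J)" using J_closed by blast
    moreover have "J \<inter> (U - closure J) \<inter> U = {}" using closure_subset by blast
    moreover have "J \<inter> U \<noteq> {}" using \<open>V \<inter> U \<subseteq> J\<close> V(2) by blast
    moreover have "(U - closure J) \<inter> U \<noteq> {}" using \<open>J \<noteq> U\<close> J_closed J(2) by blast
    ultimately show False using \<open>connected U\<close> J(1) unfolding connected_def by blast
  qed
  then show ?thesis using J(3) \<open>p \<in> U\<close> by blast
qed

text \<open>Contrapositive of the identity theorem. An open \<open>W\<close>, rather than a single
  point, lets several denominators be avoided one after the other.\<close>

lemma holomorphic2_nonzero_dense:
  assumes "holomorphic2_on h U" "open U" "connected U" "q \<in> U" "h q \<noteq> 0"
    "open V" "V \<subseteq> U" "V \<noteq> {}"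
  obtains W where "open W" "W \<noteq> {}" "W \<subseteq> V" "\<And>w. w \<in> W \<Longrightarrow> h w \<noteq> 0"
proof -
  have "\<exists>v\<in>V. h v \<noteq> 0"
    using holomorphic2_eq_0_on_connected[OF assms(1-3,6) _ _ assms(4)] assms(5,7,8) by blast
  moreover have "continuous_on V h"
    using assms holomorphic2_on_imp_continuous_on holomorphic2_on_subset by blast
  then have "open (V \<inter> h -` (- {0}))"
    using assms by (intro continuous_open_preimage) auto
  ultimately show ?thesis using that[of "V \<inter> h -` (- {0})"] by auto
qed

lemma holomorphic2_prod_nonzero:
  assumes "holomorphic2_on h U" "holomorphic2_on k U" "open U" "connected U"
    "q \<in> U" "h q \<noteq> 0" "q' \<in> U" "k q' \<noteq> 0"
  shows "\<exists>q\<in>U. h q * k q \<noteq> 0"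
proof -
  obtain W where W: "open W" "W \<noteq> {}" "W \<subseteq> U" "\<And>w. w \<in> W \<Longrightarrow> h w \<noteq> 0"
    using holomorphic2_nonzero_dense[OF assms(1,3,4,5,6,3)] assms(5) by blast
  obtain W' where "open W'" "W' \<noteq> {}" "W' \<subseteq> W" "\<And>w. w \<in> W' \<Longrightarrow> k w \<noteq> 0"
    using holomorphic2_nonzero_dense[OF assms(2,3,4,7,8) W(1,3,2)] by blast
  then show ?thesis using W by fastforce
qed

text \<open>Bridge from meromorphy to iterated limits. Some \<open>h (x0, y0)\<close> near
  \<open>(a, b)\<close> is nonzero; the zeros of \<open>h (x0, y)\<close> in \<open>y\<close> are
  isolated, so they avoid a punctured neighbourhood of \<open>b\<close>. For such \<open>y\<close>
  the function \<open>h (x, y)\<close> of \<open>x\<close> is not identically zero, and its zeros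
  are isolated in turn. The order of the quantifiers is that of the reverse value.\<close>

lemma holomorphic2_eventually_nonzero:
  assumes h: "holomorphic2_on h U" "open U" "connected U" "q \<in> U" "h q \<noteq> 0" and p: "(a, b) \<in> U"
  shows "\<forall>\<^sub>F y in at b. \<forall>\<^sub>F x in at a. (x, y) \<in> U \<and> h (x, y) \<noteq> 0"
proof -
  obtain r where r: "r > 0" "ball a r \<times> ball b r \<subseteq> U"
    using open_prod_contains_balls[OF h(2) p] .
  obtain W where W: "W \<noteq> {}" "W \<subseteq> ball a r \<times> ball b r" "\<And>w. w \<in> W \<Longrightarrow> h w \<noteq> 0"
    using holomorphic2_nonzero_dense[OF h, of "ball a r \<times> ball b r"] r
    by (metis Times_empty centre_in_ball empty_iff open_Times open_ball)
  then obtain x0 y0 where xy0: "x0 \<in> ball a r" "y0 \<in> ball b r" "h (x0, y0) \<noteq> 0"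
    by (metis equals0I mem_Sigma_iff subset_iff surj_pair)
  have "(\<lambda>y. h (x0, y)) holomorphic_on ball b r"
    using holomorphic2_on_snd_slice[OF h(1), of x0] by (rule holomorphic_on_subset) (use xy0 r in blast)
  then have "\<forall>\<^sub>F y in at b. h (x0, y) \<noteq> 0 \<and> y \<in> ball b r"
    using non_zero_neighbour_alt[of "\<lambda>y. h (x0, y)" "ball b r" b y0] xy0 r by simp
  then show ?thesis
  proof eventually_elim
    case (elim y)
    have "(\<lambda>x. h (x, y)) holomorphic_on ball a r"
      using holomorphic2_on_fst_slice[OF h(1), of y] by (rule holomorphic_on_subset) (use elim r in blast)
    then have "\<forall>\<^sub>F x in at a. h (x, y) \<noteq> 0 \<and> x \<in> ball a r"
      using non_zero_neighbour_alt[of "\<lambda>x. h (x, y)" "ball a r" a x0] xy0 elim r by simp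
    then show ?case
      by eventually_elim (use elim r in auto)
  qed
qed

text \<open>Equality may fail where a denominator vanishes, so the connectedness argument runs on
  the closure of the interior \<open>I\<close> of the coincidence set: this closure is also open,
  hence everything.\<close>

lemma meromorphic2_eventually_eq:
  assumes F: "meromorphic2 F" and G: "meromorphic2 G"
    and V: "open V" "V \<noteq> {}" "\<And>q. q \<in> V \<Longrightarrow> F q = G q"
  shows "\<forall>\<^sub>F y in at b. \<forall>\<^sub>F x in at a. F (x, y) = G (x, y)"
proof -
  define I where "I = interior {q. F q = G q}"
  have VI: "V \<subseteq> I" unfolding I_def using V by (intro interior_maximal) auto
  have I: "open I" "\<And>q. q \<in> I \<Longrightarrow> F q = G q"
    unfolding I_def using interior_subset by force+
  \<comment> \<open>Near a closure point both functions are quotients, and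
    \<open>g1 * h2 - g2 * h1\<close> vanishes on a piece of \<open>I\<close>, hence on the whole
    ball. The product \<open>h1 * h2\<close> is the witness for \<open>h\<close>.\<close>
  have local: "\<exists>U h. open U \<and> connected U \<and> p \<in> U \<and> holomorphic2_on h U \<and> (\<exists>q\<in>U. h q \<noteq> 0) \<and>
      (\<forall>q\<in>U. h q \<noteq> 0 \<longrightarrow> F q = G q)" if p: "p \<in> closure I" for p
  proof -
    obtain U1 g1 h1 where 1: "open U1" "connected U1" "p \<in> U1" "holomorphic2_on g1 U1" "holomorphic2_on h1 U1"
        "\<exists>q\<in>U1. h1 q \<noteq> 0" "\<forall>q\<in>U1. h1 q \<noteq> 0 \<longrightarrow> F q = g1 q / h1 q"
      using F unfolding meromorphic2_def by (metis (no_types, lifting))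
    obtain U2 g2 h2 where 2: "open U2" "connected U2" "p \<in> U2" "holomorphic2_on g2 U2" "holomorphic2_on h2 U2"
        "\<exists>q\<in>U2. h2 q \<noteq> 0" "\<forall>q\<in>U2. h2 q \<noteq> 0 \<longrightarrow> G q = g2 q / h2 q"
      using G unfolding meromorphic2_def by (metis (no_types, lifting))
    obtain r where r: "r > 0" "ball p r \<subseteq> U1 \<inter> U2"
      using 1 2 by (meson IntI open_Int open_contains_ball)
    let ?B = "ball p r"
    have hol: "holomorphic2_on g1 ?B" "holomorphic2_on h1 ?B" "holomorphic2_on g2 ?B" "holomorphic2_on h2 ?B"
      using 1 2 r by (auto intro: holomorphic2_on_subset)
    have dense: "\<exists>W. open W \<and> W \<noteq> {} \<and> W \<subseteq> V' \<and> (\<forall>w\<in>W. h1 w * h2 w \<noteq> 0)"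
      if V': "open V'" "V' \<noteq> {}" "V' \<subseteq> ?B" for V'
    proof -
      obtain q1 q2 where q: "q1 \<in> U1" "h1 q1 \<noteq> 0" "q2 \<in> U2" "h2 q2 \<noteq> 0" using 1 2 by blast
      obtain W where W: "open W" "W \<noteq> {}" "W \<subseteq> V'" "\<And>w. w \<in> W \<Longrightarrow> h1 w \<noteq> 0"
        using holomorphic2_nonzero_dense[OF 1(5,1,2) q(1,2) V'(1) _ V'(2)] V'(3) r by blast
      obtain W' where "open W'" "W' \<noteq> {}" "W' \<subseteq> W" "\<And>w. w \<in> W' \<Longrightarrow> h2 w \<noteq> 0"
        using holomorphic2_nonzero_dense[OF 2(5,1,2) q(3,4) W(1) _ W(2)] V'(3) W(3) r by blast
      then show ?thesis using W by (metis mult_eq_0_iff subset_iff)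
    qed
    have "I \<inter> ?B \<noteq> {}"
      using p open_Int_closure_eq_empty[of ?B I] r(1) by (metis Int_commute centre_in_ball disjoint_iff open_ball)
    then obtain W where W: "open W" "W \<noteq> {}" "W \<subseteq> I \<inter> ?B" "\<forall>w\<in>W. h1 w * h2 w \<noteq> 0"
      using dense[of "I \<inter> ?B"] I(1) by auto
    have W0: "g1 w * h2 w - g2 w * h1 w = 0" if "w \<in> W" for w
    proof -
      have "h1 w \<noteq> 0" "h2 w \<noteq> 0" using that W(4) by auto
      have "F w = G w" using that W(3) by (intro I(2)) blast
      have "F w = g1 w / h1 w" "G w = g2 w / h2 w"
        using 1 2 that W r \<open>h1 w \<noteq> 0\<close> \<open>h2 w \<noteq> 0\<close> by blast+
      with \<open>F w = G w\<close> \<open>h1 w \<noteq> 0\<close> \<open>h2 w \<noteq> 0\<close> show ?thesis by (simp add: frac_eq_eq)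
    qed
    have eq0: "g1 w * h2 w - g2 w * h1 w = 0" if "w \<in> ?B" for w
    proof (rule holomorphic2_eq_0_on_connected[of "\<lambda>w. g1 w * h2 w - g2 w * h1 w" ?B W])
      show "holomorphic2_on (\<lambda>w. g1 w * h2 w - g2 w * h1 w) (ball p r)"
        using hol by (intro holomorphic2_on_diff holomorphic2_on_mult)
    qed (use W W0 that in auto)
    have "F q = G q" if q: "q \<in> ?B" "h1 q * h2 q \<noteq> 0" for q
    proof -
      have "F q = g1 q / h1 q" "G q = g2 q / h2 q" using q 1(7) 2(7) r by auto
      moreover have "g1 q * h2 q - g2 q * h1 q = 0" using q(1) by (rule eq0)
      ultimately show ?thesis using q by (simp add: frac_eq_eq)
    qed
    moreover have "\<exists>q\<in>?B. h1 q * h2 q \<noteq> 0"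
      using dense[of ?B] r(1) by fastforce
    ultimately show ?thesis
      using r hol by (intro exI[of _ ?B] exI[of _ "\<lambda>w. h1 w * h2 w"] conjI holomorphic2_on_mult) auto
  qed
  have "open (closure I)"
  proof (rule Topological_Spaces.openI)
    fix p assume "p \<in> closure I"
    from local[OF this] obtain U h where U: "open U" "connected U" "p \<in> U" "holomorphic2_on h U" "\<exists>q\<in>U. h q \<noteq> 0"
        "\<forall>q\<in>U. h q \<noteq> 0 \<longrightarrow> F q = G q" by blast
    \<comment> \<open>The points of \<open>U\<close> with \<open>h\<close> nonzero lie in
      \<open>I\<close> and are dense in \<open>U\<close>.\<close>
    have "U \<subseteq> closure I"
    proof
      fix z assume z: "z \<in> U"
      show "z \<in> closure I"
        unfolding closure_iff_nhds_not_empty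
      proof safe
        fix A B assume AB: "B \<subseteq> A" "open B" "z \<in> B" "I \<inter> A = {}"
        obtain W where W: "open W" "W \<noteq> {}" "W \<subseteq> B \<inter> U" "\<And>w. w \<in> W \<Longrightarrow> h w \<noteq> 0"
          using holomorphic2_nonzero_dense[OF U(4,1,2), of _ "B \<inter> U"] U AB z
          by (metis IntI Int_lower2 empty_iff open_Int)
        then have "W \<subseteq> I" unfolding I_def using U(6) by (intro interior_maximal) auto
        then show False using W AB by blast
      qed
    qed
    then show "\<exists>T. open T \<and> p \<in> T \<and> T \<subseteq> closure I" using U by blast
  qed
  then have "closure I = UNIV"
    using VI V(2) closure_subset[of I] clopen[of "closure I"] by auto
  with local[of "(a, b)"] obtain U h where U: "open U" "connected U" "(a, b) \<in> U" "holomorphic2_on h U"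
      "\<exists>q\<in>U. h q \<noteq> 0" "\<forall>q\<in>U. h q \<noteq> 0 \<longrightarrow> F q = G q" by auto
  have "\<forall>\<^sub>F y in at b. \<forall>\<^sub>F x in at a. (x, y) \<in> U \<and> h (x, y) \<noteq> 0"
    using holomorphic2_eventually_nonzero[OF U(4,1,2) _ _ U(3)] U(5) by blast
  then show ?thesis
  proof eventually_elim
    case (elim y)
    then show ?case by eventually_elim (use U(6) in blast)
  qed
qed

section \<open>Holomorphic parameter integrals\<close>

text \<open>Cauchy's estimate on circles of radius \<open>r\<close> about the points of
  \<open>ball a r\<close>; the radius \<open>3 * r\<close> leaves room for them.\<close>

lemma deriv_bound_on_ball:
  assumes "f holomorphic_on ball a (3 * r)" "\<And>z. z \<in> ball a (3 * r) \<Longrightarrow> norm (f z) \<le> B"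
    "r > 0" "x \<in> ball a r"
  shows "norm (deriv f x) \<le> B / r"
proof -
  have sub: "cball x r \<subseteq> ball a (3 * r)"
  proof
    fix y assume "y \<in> cball x r"
    then show "y \<in> ball a (3 * r)" using assms(3,4) dist_triangle[of a y x] by auto
  qed
  have "norm ((deriv ^^ 1) f x) \<le> fact 1 * B / r ^ 1"
  proof (rule Cauchy_inequality)
    show "f holomorphic_on ball x r"
      using assms(1) by (rule holomorphic_on_subset) (use sub ball_subset_cball in blast)
    show "continuous_on (cball x r) f"
      using holomorphic_on_imp_continuous_on[OF assms(1)] sub by (rule continuous_on_subset)
    show "norm (f y) \<le> B" if "norm (x - y) = r" for y
      using that sub by (intro assms(2)) (auto simp: dist_norm)
  qed fact
  then show ?thesis by simp
qed

lemma lipschitz_on_ball: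
  assumes "f holomorphic_on ball a (3 * r)" "\<And>z. z \<in> ball a (3 * r) \<Longrightarrow> norm (f z) \<le> B"
    "r > 0" "x \<in> ball a r" "y \<in> ball a r"
  shows "norm (f x - f y) \<le> B / r * norm (x - y)"
proof (rule field_differentiable_bound)
  fix z assume z: "z \<in> ball a r"
  then have "z \<in> ball a (3 * r)" using assms(3) by simp
  then have "(f has_field_derivative deriv f z) (at z)"
    using holomorphic_derivI[OF assms(1)] by simp
  then show "(f has_field_derivative deriv f z) (at z within ball a r)"
    by (rule has_field_derivative_at_within)
  show "norm (deriv f z) \<le> B / r"
    by (rule deriv_bound_on_ball[OF assms(1,2,3) z])
qed (use assms in auto)

text \<open>The partial derivatives supplied by \<open>holomorphic2_on\<close> depend on the
  parameter by mere choice, so their measurability has to come from difference quotients along a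
  sequence.\<close>

lemma measurable_derivative:
  fixes f :: "complex \<Rightarrow> 'x \<Rightarrow> complex"
  assumes "open U" "p \<in> U" "\<And>z. z \<in> U \<Longrightarrow> f z \<in> borel_measurable N"
    and "\<And>x. x \<in> space N \<Longrightarrow> ((\<lambda>z. f z x) has_field_derivative a x) (at p)"
  shows "a \<in> borel_measurable N"
proof -
  obtain e where e: "e > 0" "ball p e \<subseteq> U" using assms(1,2) open_contains_ball by blast
  \<comment> \<open>The offset 2 keeps every \<open>z i\<close> strictly inside the ball.\<close>
  define z where "z i = p + of_real (e / of_nat (i + 2))" for i
  have "(\<lambda>i. p + of_real (e * inverse (of_nat (Suc (Suc i))))) \<longlonglongrightarrow> p + of_real (e * 0)"
    by (intro tendsto_intros LIMSEQ_Suc[OF LIMSEQ_inverse_real_of_nat])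
  then have lim: "z \<longlonglongrightarrow> p"
    by (simp add: z_def[abs_def] divide_inverse)
  have zne: "z i \<noteq> p" for i
  proof -
    have "complex_of_real (e / of_nat (i + 2)) \<noteq> 0"
      using e by (subst of_real_eq_0_iff) simp
    then show ?thesis unfolding z_def by (metis add_cancel_right_right)
  qed
  have zU: "z i \<in> U" for i
  proof (rule subsetD[OF e(2)])
    have "norm (z i - p) = norm (complex_of_real (e / of_nat (i + 2)))"
      unfolding z_def by (simp only: add_diff_cancel_left')
    also have "\<dots> < e" using e by (subst norm_of_real) (simp add: field_simps add_pos_nonneg)
    finally show "z i \<in> ball p e" by (simp add: dist_norm norm_minus_commute)
  qed
  show ?thesis
  proof (rule borel_measurable_LIMSEQ_metric)
    fix x assume "x \<in> space N"
    then have "((\<lambda>y. (f y x - f p x) / (y - p)) \<longlongrightarrow> a x) (at p)"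
      using assms(4) by (simp add: has_field_derivative_iff)
    then show "(\<lambda>i. (f (z i) x - f p x) / (z i - p)) \<longlonglongrightarrow> a x"
      using lim zne unfolding tendsto_at_iff_sequentially by (auto simp: o_def)
  next
    fix i
    show "(\<lambda>x. (f (z i) x - f p x) / (z i - p)) \<in> borel_measurable N"
      using assms(2,3) zU by measurable
  qed
qed

text \<open>Dominated convergence for the quotient that defines the Frechet derivative. Cauchy's
  estimates bound the increment and the linear part each by
  \<open>2 * g x / r * norm (q - p)\<close>, so \<open>4 * g x / r\<close> dominates. The measure is
  arbitrary, to serve Mellin integrals and absolutely convergent series alike.\<close>

lemma has_derivative_integral_bidisc:
  fixes f :: "complex \<times> complex \<Rightarrow> 'x \<Rightarrow> complex"
  assumes hol: "\<And>x. x \<in> space N \<Longrightarrow> holomorphic2_on (\<lambda>p. f p x) (ball p1 (3 * r) \<times> ball p2 (3 * r))"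
    and meas: "\<And>q. q \<in> ball p1 (3 * r) \<times> ball p2 (3 * r) \<Longrightarrow> f q \<in> borel_measurable N"
    and g: "integrable N g" "\<And>q x. q \<in> ball p1 (3 * r) \<times> ball p2 (3 * r) \<Longrightarrow> x \<in> space N \<Longrightarrow> norm (f q x) \<le> g x"
    and r: "r > 0"
    and ab: "\<And>x. x \<in> space N \<Longrightarrow> ((\<lambda>p. f p x) has_derivative (\<lambda>(u, v). a x * u + b x * v)) (at (p1, p2))"
  shows "((\<lambda>p. \<integral>x. f p x \<partial>N) has_derivative
            (\<lambda>(u, v). (\<integral>x. a x \<partial>N) * u + (\<integral>x. b x \<partial>N) * v)) (at (p1, p2))"
proof -
  define p where "p = (p1, p2)"
  let ?B = "ball p1 (3 * r) \<times> ball p2 (3 * r)"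
  have pB: "p \<in> ?B" using r by (simp add: p_def)
  have h1: "(\<lambda>z. f (z, y) x) holomorphic_on ball p1 (3 * r)" if "y \<in> ball p2 (3 * r)" "x \<in> space N" for x y
    using holomorphic2_on_fst_slice[OF hol[OF that(2)], of y] by (rule holomorphic_on_subset) (use that in blast)
  have h2: "(\<lambda>z. f (y, z) x) holomorphic_on ball p2 (3 * r)" if "y \<in> ball p1 (3 * r)" "x \<in> space N" for x y
    using holomorphic2_on_snd_slice[OF hol[OF that(2)], of y] by (rule holomorphic_on_subset) (use that in blast)
  have da: "((\<lambda>z. f (z, p2) x) has_field_derivative a x) (at p1)" if "x \<in> space N" for x
  proof -
    have "((\<lambda>x. (x, p2)) has_derivative (\<lambda>x. (x, 0))) (at p1)"
      by (auto intro!: derivative_eq_intros)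
    from has_derivative_compose[OF this ab[OF that]] show ?thesis
      by (simp add: has_field_derivative_def)
  qed
  have db: "((\<lambda>z. f (p1, z) x) has_field_derivative b x) (at p2)" if "x \<in> space N" for x
  proof -
    have "((\<lambda>y. (p1, y)) has_derivative (\<lambda>y. (0, y))) (at p2)"
      by (auto intro!: derivative_eq_intros)
    from has_derivative_compose[OF this ab[OF that]] show ?thesis
      by (simp add: has_field_derivative_def)
  qed
  have am [measurable]: "a \<in> borel_measurable N"
    by (rule measurable_derivative[of "ball p1 (3 * r)" p1 "\<lambda>z. f (z, p2)"]) (use meas da r in auto)
  have bm [measurable]: "b \<in> borel_measurable N"
    by (rule measurable_derivative[of "ball p2 (3 * r)" p2 "\<lambda>z. f (p1, z)"]) (use meas db r in auto)
  have an: "norm (a x) \<le> g x / r" if x: "x \<in> space N" for x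
    using deriv_bound_on_ball[OF h1[of p2 x], of "g x" p1] DERIV_imp_deriv[OF da[OF x]] r x g(2) by auto
  have bn: "norm (b x) \<le> g x / r" if x: "x \<in> space N" for x
    using deriv_bound_on_ball[OF h2[of p1 x], of "g x" p2] DERIV_imp_deriv[OF db[OF x]] r x g(2) by auto
  have gr: "integrable N (\<lambda>x. g x / r)" using g(1) by simp
  have ai: "integrable N a" "integrable N b"
    using an bn by (auto intro!: Bochner_Integration.integrable_bound[OF gr] AE_I2
      simp del: abs_divide norm_divide simp: order_trans[OF _ abs_ge_self])
  have fi: "integrable N (f q)" if "q \<in> ?B" for q
    using g meas that by (intro Bochner_Integration.integrable_bound[OF g(1)])
      (auto intro!: AE_I2 order_trans[OF _ abs_ge_self])
  \<comment> \<open>One coordinate at a time, through the corner \<open>(p1, q2)\<close>.\<close>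
  have lip: "norm (f q x - f p x) \<le> 2 * g x / r * norm (q - p)"
    if q: "q \<in> ball p1 r \<times> ball p2 r" and x: "x \<in> space N" for q x
  proof -
    obtain q1 q2 where q12: "q = (q1, q2)" by force
    have q3: "q1 \<in> ball p1 (3 * r)" "q2 \<in> ball p2 (3 * r)" using q q12 r by auto
    have "norm (f (q1, q2) x - f (p1, q2) x) \<le> g x / r * norm (q1 - p1)"
      using q q3 q12 r x by (intro lipschitz_on_ball[where f="\<lambda>z. f (z, q2) x", OF h1]) (auto intro!: g(2))
    moreover have "norm (f (p1, q2) x - f (p1, p2) x) \<le> g x / r * norm (q2 - p2)"
      using q q3 q12 r x by (intro lipschitz_on_ball[where f="\<lambda>z. f (p1, z) x", OF h2]) (auto intro!: g(2))
    moreover have "norm (q1 - p1) \<le> norm (q - p)" "norm (q2 - p2) \<le> norm (q - p)"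
      using norm_fst_le[of "q1 - p1" "q2 - p2"] norm_snd_le[of "q2 - p2" "q1 - p1"] by (simp_all add: p_def q12)
    moreover have "g x \<ge> 0" using g(2)[OF pB x] norm_ge_zero order_trans by blast
    then have "g x / r * norm (q1 - p1) \<le> g x / r * norm (q - p)" "g x / r * norm (q2 - p2) \<le> g x / r * norm (q - p)"
      using calculation(3,4) r by (intro mult_left_mono; simp)+
    ultimately have "norm (f q x - f (p1, q2) x) + norm (f (p1, q2) x - f p x) \<le> 2 * (g x / r * norm (q - p))"
      unfolding q12 p_def by linarith
    then show ?thesis
      using norm_triangle_ineq[of "f q x - f (p1, q2) x" "f (p1, q2) x - f p x"] by simp
  qed
  define L where "L = (\<lambda>x (d::complex\<times>complex). a x * fst d + b x * snd d)"
  define I where "I q = (\<integral>x. f q x \<partial>N)" for q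
  define IL where "IL = (\<lambda>d::complex\<times>complex. (\<integral>x. a x \<partial>N) * fst d + (\<integral>x. b x \<partial>N) * snd d)"
  have Ln: "norm (L x d) \<le> 2 * g x / r * norm d" if x: "x \<in> space N" for x d
  proof -
    have "norm (L x d) \<le> norm (a x) * norm (fst d) + norm (b x) * norm (snd d)"
      unfolding L_def by (intro order_trans[OF norm_triangle_ineq]) (simp add: norm_mult)
    also have "\<dots> \<le> g x / r * norm d + g x / r * norm d"
      using an[OF x] bn[OF x] norm_fst_le[of "fst d" "snd d"] norm_snd_le[of "snd d" "fst d"]
      by (intro add_mono mult_mono) (auto intro: order_trans[OF norm_ge_zero])
    finally show ?thesis by (simp add: mult_ac)
  qed
  have "((\<lambda>q. norm (I q - I p - IL (q - p)) / norm (q - p)) \<longlongrightarrow> 0) (at p)"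
    unfolding tendsto_at_iff_sequentially
  proof (intro allI impI)
    fix X :: "nat \<Rightarrow> complex \<times> complex"
    assume X: "\<forall>i. X i \<in> UNIV - {p}" "X \<longlonglongrightarrow> p"
    have "open (ball p1 r \<times> ball p2 r)" "p \<in> ball p1 r \<times> ball p2 r"
      using r by (auto simp: p_def intro: open_Times)
    then have "\<forall>\<^sub>F i in sequentially. X i \<in> ball p1 r \<times> ball p2 r"
      using X(2) topological_tendstoD by blast
    then obtain n where n: "\<And>i. i \<ge> n \<Longrightarrow> X i \<in> ball p1 r \<times> ball p2 r"
      unfolding eventually_sequentially by blast
    define Y where "Y i = X (i + n)" for i
    have Y: "Y i \<noteq> p" "Y i \<in> ball p1 r \<times> ball p2 r" for i using X(1) n by (auto simp: Y_def)
    have YB: "Y i \<in> ?B" for i using Y(2)[of i] r by auto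
    have Ylim: "Y \<longlonglongrightarrow> p" unfolding Y_def by (rule LIMSEQ_ignore_initial_segment[OF X(2)])
    define s where "s i x = (f (Y i) x - f p x - L x (Y i - p)) / of_real (norm (Y i - p))" for i x
    have sI: "(\<integral>x. s i x \<partial>N) = (I (Y i) - I p - IL (Y i - p)) / of_real (norm (Y i - p))" for i
      unfolding s_def I_def IL_def L_def using fi[OF YB[of i]] fi[OF pB] ai by simp
    have "(\<lambda>i. \<integral>x. s i x \<partial>N) \<longlonglongrightarrow> (\<integral>x. 0 \<partial>N)"
    proof (rule integral_dominated_convergence[where w="\<lambda>x. 4 * g x / r"])
      show "(\<lambda>x. s i x) \<in> borel_measurable N" for i
        unfolding s_def L_def using meas[OF YB[of i]] meas[OF pB] by measurable
      show "AE x in N. norm (s i x) \<le> 4 * g x / r" for i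
      proof (rule AE_I2)
        fix x assume x: "x \<in> space N"
        have "norm (f (Y i) x - f p x - L x (Y i - p)) \<le> 2 * g x / r * norm (Y i - p) + 2 * g x / r * norm (Y i - p)"
          by (intro order_trans[OF norm_triangle_ineq4] add_mono lip Ln Y(2) x)
        then show "norm (s i x) \<le> 4 * g x / r"
          using Y(1)[of i] unfolding s_def by (simp add: norm_divide divide_le_eq)
      qed
      show "AE x in N. (\<lambda>i. s i x) \<longlonglongrightarrow> 0"
      proof (rule AE_I2)
        fix x assume x: "x \<in> space N"
        have "((\<lambda>q. norm (f q x - f p x - L x (q - p)) / norm (q - p)) \<longlongrightarrow> 0) (at p)"
          using ab[OF x] unfolding has_derivative_iff_norm p_def[symmetric] L_def by (simp add: case_prod_unfold)
        then have "((\<lambda>q. norm (f q x - f p x - L x (q - p)) / norm (q - p)) \<circ> Y) \<longlonglongrightarrow> 0"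
          unfolding tendsto_at_iff_sequentially using Y(1) Ylim by blast
        moreover have "norm (s i x) = norm (f (Y i) x - f p x - L x (Y i - p)) / norm (Y i - p)" for i
          by (simp add: s_def norm_divide)
        ultimately have "(\<lambda>i. norm (s i x)) \<longlonglongrightarrow> 0"
          by (simp only: o_def)
        then show "(\<lambda>i. s i x) \<longlonglongrightarrow> 0"
          by (rule tendsto_norm_zero_cancel)
      qed
    qed (use g(1) in auto)
    from tendsto_norm[OF this]
    have "(\<lambda>i. norm (I (Y i) - I p - IL (Y i - p)) / norm (Y i - p)) \<longlonglongrightarrow> 0"
      unfolding sI by (simp add: norm_divide)
    then show "((\<lambda>q. norm (I q - I p - IL (q - p)) / norm (q - p)) \<circ> X) \<longlonglongrightarrow> 0"
      unfolding Y_def o_def by (rule LIMSEQ_offset)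
  qed
  moreover have "bounded_linear IL"
    unfolding IL_def
    by (intro bounded_linear_add bounded_linear_compose[OF bounded_linear_mult_right] bounded_linear_fst bounded_linear_snd)
  ultimately have "(I has_derivative IL) (at p)"
    unfolding has_derivative_iff_norm by blast
  then show ?thesis unfolding I_def IL_def p_def by (simp add: case_prod_unfold)
qed

lemma holomorphic2_on_integral:
  fixes f :: "complex \<times> complex \<Rightarrow> 'x \<Rightarrow> complex"
  assumes hol: "\<And>x. x \<in> space N \<Longrightarrow> holomorphic2_on (\<lambda>p. f p x) U"
    and meas: "\<And>p. p \<in> U \<Longrightarrow> f p \<in> borel_measurable N"
    and dom: "\<And>p. p \<in> U \<Longrightarrow> \<exists>V g. open V \<and> p \<in> V \<and> V \<subseteq> U \<and> integrable N g \<and>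
      (\<forall>q\<in>V. \<forall>x\<in>space N. norm (f q x) \<le> g x)"
  shows "holomorphic2_on (\<lambda>p. \<integral>x. f p x \<partial>N) U"
  unfolding holomorphic2_on_def
proof
  fix p assume p: "p \<in> U"
  obtain p1 p2 where p12: "p = (p1, p2)" by force
  obtain V g where V: "open V" "p \<in> V" "V \<subseteq> U" "integrable N g"
    "\<And>q x. q \<in> V \<Longrightarrow> x \<in> space N \<Longrightarrow> norm (f q x) \<le> g x" using dom[OF p] by blast
  obtain e where e: "e > 0" "ball p1 e \<times> ball p2 e \<subseteq> V"
    using open_prod_contains_balls V(1,2) p12 by metis
  have "\<forall>x\<in>space N. \<exists>a b. ((\<lambda>p. f p x) has_derivative (\<lambda>(u, v). a * u + b * v)) (at p)"
    using hol p unfolding holomorphic2_on_def by blast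
  then obtain a b where ab: "\<And>x. x \<in> space N \<Longrightarrow>
      ((\<lambda>p. f p x) has_derivative (\<lambda>(u, v). a x * u + b x * v)) (at p)"
    by metis
  have "((\<lambda>p. \<integral>x. f p x \<partial>N) has_derivative
      (\<lambda>(u, v). (\<integral>x. a x \<partial>N) * u + (\<integral>x. b x \<partial>N) * v)) (at (p1, p2))"
  proof (rule has_derivative_integral_bidisc[where r="e/3" and g=g])
    show "holomorphic2_on (\<lambda>p. f p x) (ball p1 (3 * (e / 3)) \<times> ball p2 (3 * (e / 3)))" if "x \<in> space N" for x
      using hol[OF that] by (rule holomorphic2_on_subset) (use e V in auto)
    show "f q \<in> borel_measurable N" if "q \<in> ball p1 (3 * (e / 3)) \<times> ball p2 (3 * (e / 3))" for q
      using that e V by (intro meas) auto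
    show "norm (f q x) \<le> g x" if "q \<in> ball p1 (3 * (e / 3)) \<times> ball p2 (3 * (e / 3))" "x \<in> space N" for q x
      using that e by (intro V(5)) auto
  qed (use e V ab p12 in auto)
  then show "\<exists>a b. ((\<lambda>p. \<integral>x. f p x \<partial>N) has_derivative (\<lambda>(x, y). a * x + b * y)) (at p)"
    unfolding p12 by blast
qed

text \<open>The two-variable statement for a function that ignores its second argument.\<close>

lemma holomorphic_on_integral:
  fixes f :: "complex \<Rightarrow> 'x \<Rightarrow> complex"
  assumes hol: "\<And>x. x \<in> space N \<Longrightarrow> (\<lambda>s. f s x) holomorphic_on U" and "open U"
    and meas: "\<And>s. s \<in> U \<Longrightarrow> f s \<in> borel_measurable N"
    and dom: "\<And>s. s \<in> U \<Longrightarrow> \<exists>V g. open V \<and> s \<in> V \<and> V \<subseteq> U \<and> integrable N g \<and>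
      (\<forall>w\<in>V. \<forall>x\<in>space N. norm (f w x) \<le> g x)"
  shows "(\<lambda>s. \<integral>x. f s x \<partial>N) holomorphic_on U"
proof -
  have "holomorphic2_on (\<lambda>p. \<integral>x. f (fst p) x \<partial>N) (U \<times> UNIV)"
  proof (rule holomorphic2_on_integral)
    show "holomorphic2_on (\<lambda>p. f (fst p) x) (U \<times> UNIV)" if "x \<in> space N" for x
      using holomorphic2_on_compose_linear[OF hol[OF that] \<open>open U\<close>, of "U \<times> UNIV" 1 0 0] by auto
    fix p :: "complex \<times> complex" assume p: "p \<in> U \<times> UNIV"
    then show "f (fst p) \<in> borel_measurable N" using meas by auto
    obtain V g where "open V" "fst p \<in> V" "V \<subseteq> U" "integrable N g"
      "\<forall>w\<in>V. \<forall>x\<in>space N. norm (f w x) \<le> g x" using dom[of "fst p"] p by auto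
    then show "\<exists>V g. open V \<and> p \<in> V \<and> V \<subseteq> U \<times> UNIV \<and> integrable N g \<and>
        (\<forall>q\<in>V. \<forall>x\<in>space N. norm (f (fst q) x) \<le> g x)"
      by (intro exI[of _ "V \<times> UNIV"] exI[of _ g]) (auto intro: open_Times simp: mem_Times_iff)
  qed
  from holomorphic2_on_fst_slice[OF this, of 0] show ?thesis by simp
qed

lemma deriv_integral:
  fixes f :: "complex \<Rightarrow> 'x \<Rightarrow> complex"
  assumes hol: "\<And>x. x \<in> space N \<Longrightarrow> (\<lambda>s. f s x) holomorphic_on V" and "open V" "s \<in> V"
    and meas: "\<And>s. s \<in> V \<Longrightarrow> f s \<in> borel_measurable N"
    and g: "integrable N g" "\<And>s x. s \<in> V \<Longrightarrow> x \<in> space N \<Longrightarrow> norm (f s x) \<le> g x"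
  shows "((\<lambda>s. \<integral>x. f s x \<partial>N) has_field_derivative (\<integral>x. deriv (\<lambda>s. f s x) s \<partial>N)) (at s)"
proof -
  obtain e where e: "e > 0" "ball s e \<subseteq> V" using assms(2,3) open_contains_ball by blast
  have *: "((\<lambda>p. \<integral>x. f (fst p) x \<partial>N) has_derivative
      (\<lambda>(u, v). (\<integral>x. deriv (\<lambda>s. f s x) s \<partial>N) * u + (\<integral>x. 0 \<partial>N) * v)) (at (s, 0))"
  proof (rule has_derivative_integral_bidisc[where r="e/3" and g=g])
    fix x assume x: "x \<in> space N"
    show "holomorphic2_on (\<lambda>p. f (fst p) x) (ball s (3 * (e / 3)) \<times> ball 0 (3 * (e / 3)))"
      using holomorphic2_on_compose_linear[OF hol[OF x] \<open>open V\<close>,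
          of "ball s (3 * (e / 3)) \<times> ball 0 (3 * (e / 3))" 1 0 0] e by force
    have "((\<lambda>s. f s x) has_derivative (*) (deriv (\<lambda>s. f s x) s)) (at (fst (s, 0)))"
      using holomorphic_derivI[OF hol[OF x] \<open>open V\<close> \<open>s \<in> V\<close>] by (simp add: has_field_derivative_def)
    from has_derivative_compose[OF has_derivative_fst[OF has_derivative_ident] this]
    show "((\<lambda>p. f (fst p) x) has_derivative (\<lambda>(u, v). deriv (\<lambda>s. f s x) s * u + 0 * v)) (at (s, 0))"
      by (simp add: case_prod_unfold)
  qed (use e g meas in auto)
  have "((\<lambda>z. (z, 0)) has_derivative (\<lambda>z. (z, 0))) (at s)"
    by (auto intro!: derivative_eq_intros)
  from has_derivative_compose[OF this *]
  have "((\<lambda>s. \<integral>x. f s x \<partial>N) has_derivative (\<lambda>u. (\<integral>x. deriv (\<lambda>s. f s x) s \<partial>N) * u)) (at s)"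
    by simp
  then show ?thesis by (simp add: has_field_derivative_def)
qed

section \<open>Mellin transforms\<close>

text \<open>Restricting the space, instead of multiplying by an indicator, makes positivity
  available as membership in the space.\<close>

definition halfline :: "real measure" where
  "halfline = restrict_space lborel {0<..}"

lemma space_halfline [simp]: "space halfline = {0<..}"
  by (simp add: halfline_def space_restrict_space)

lemma sigma_finite_halfline: "sigma_finite_measure halfline"
  unfolding halfline_def
  by (intro sigma_finite_measure_restrict_space sigma_finite_lborel) auto

lemma measurable_halfline_continuous:
  fixes f :: "real \<Rightarrow> 'a::{second_countable_topology, t2_space}"
  assumes "continuous_on {0<..} f"
  shows "f \<in> borel_measurable halfline"
proof -
  have "f \<in> borel_measurable (restrict_space borel {0<..})"
    by (rule borel_measurable_continuous_on_restrict[OF assms])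
  moreover have "sets (restrict_space borel {0<..}) = sets halfline"
    unfolding halfline_def by (intro sets_restrict_space_cong) simp
  ultimately show ?thesis using measurable_cong_sets by blast
qed

lemma integrable_halfline_iff:
  fixes f :: "real \<Rightarrow> 'a::{banach, second_countable_topology}"
  shows "integrable halfline f \<longleftrightarrow> set_integrable lborel {0<..} f"
  unfolding halfline_def set_integrable_def by (subst integrable_restrict_space) auto

lemma integral_halfline:
  fixes f :: "real \<Rightarrow> 'a::{banach, second_countable_topology}"
  shows "(\<integral>x. f x \<partial>halfline) = (LINT x:{0<..}|lborel. f x)"
  unfolding halfline_def set_lebesgue_integral_def by (subst integral_restrict_space) auto

lemma norm_of_real_powr: "t > 0 \<Longrightarrow> norm (complex_of_real t powr z) = t powr Re z"
  by (simp add: norm_powr_real_powr)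

lemma continuous_on_of_real_powr: "continuous_on {0<..} (\<lambda>t. complex_of_real t powr z)"
  by (intro continuous_intros) (auto simp: complex_nonpos_Reals_iff)

lemma has_bochner_integral_transform:
  "has_bochner_integral N f x \<Longrightarrow> (\<And>t. t \<in> space N \<Longrightarrow> f t = g t) \<Longrightarrow> x = y \<Longrightarrow>
    has_bochner_integral N g y"
  by (simp cong: has_bochner_integral_cong)

lemma has_bochner_integral_Gamma:
  assumes "x > 0" "Re z > 0"
  shows "has_bochner_integral halfline (\<lambda>t. of_real t powr (z - 1) * of_real (exp (- (x * t))))
           (Gamma z * of_real x powr (- z))"
proof -
  define f where "f = (\<lambda>t. complex_of_real t powr (z - 1) / of_real (exp t))"
  have fm: "set_borel_measurable borel {0<..} f"
    unfolding f_def
    by (intro borel_measurable_continuous_on_indicator[unfolded set_borel_measurable_def[symmetric]])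
       (auto simp: complex_nonpos_Reals_iff set_borel_measurable_def
             intro!: borel_measurable_continuous_on_indicator continuous_intros)
  have "set_integrable lebesgue {0<..} f"
    using absolutely_integrable_Gamma_integral'[OF assms(2)] by (simp add: f_def)
  moreover have "integral {0<..} f = Gamma z"
    using Gamma_integral_complex'[OF assms(2)] by (auto simp: f_def)
  ultimately have "has_bochner_integral lborel (\<lambda>t. indicator {0<..} t *\<^sub>R f t) (Gamma z)"
    using fm set_lebesgue_integral_eq_integral(2)[of "{0<..}" f]
    unfolding has_bochner_integral_iff set_integrable_def set_lebesgue_integral_def set_borel_measurable_def
    by (simp add: integrable_completion integral_completion)
  then have "has_bochner_integral lborel (\<lambda>t. indicator {0<..} (0 + x * t) *\<^sub>R f (0 + x * t)) (Gamma z /\<^sub>R \<bar>x\<bar>)"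
    using assms by (subst lborel_has_bochner_integral_real_affine_iff[symmetric]) auto
  then have "has_bochner_integral lborel
      (\<lambda>t. of_real x powr (1 - z) * (indicator {0<..} (x * t) *\<^sub>R f (x * t))) (of_real x powr (1 - z) * (Gamma z /\<^sub>R \<bar>x\<bar>))"
    by (intro has_bochner_integral_mult_right) simp
  also have "(\<lambda>t. of_real x powr (1 - z) * (indicator {0<..} (x * t) *\<^sub>R f (x * t))) =
      (\<lambda>t. indicator {0<..} t *\<^sub>R (of_real t powr (z - 1) * of_real (exp (- (x * t)))))"
  proof
    fix t
    show "of_real x powr (1 - z) * (indicator {0<..} (x * t) *\<^sub>R f (x * t)) =
       indicator {0<..} t *\<^sub>R (of_real t powr (z - 1) * of_real (exp (- (x * t))))"
    proof (cases "t > 0")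
      case True
      have "of_real (x * t) powr (z - 1) = of_real x powr (z - 1) * complex_of_real t powr (z - 1)"
        using True assms by (simp add: powr_times_real)
      then have f: "f (x * t) =
          of_real x powr (z - 1) * (complex_of_real t powr (z - 1) * of_real (exp (- (x * t))))"
        unfolding f_def by (simp only: exp_minus of_real_inverse divide_inverse mult.assoc)
      have "of_real x powr (1 - z) * complex_of_real x powr (z - 1) = 1"
        using assms powr_add[of "complex_of_real x" "1 - z" "z - 1"] by simp
      moreover have "indicator {0<..} (x * t) = (1::real)" "indicator {0<..} t = (1::real)"
        using True assms by auto
      ultimately show ?thesis unfolding f by (simp only: scaleR_one mult_1_left flip: mult.assoc)
    next
      case False
      then show ?thesis using assms by (auto simp: zero_less_mult_iff)
    qed
  qed
  also have "of_real x powr (1 - z) * (Gamma z /\<^sub>R \<bar>x\<bar>) = Gamma z * of_real x powr (- z)"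
    using assms by (simp add: powr_diff powr_minus scaleR_conv_of_real field_simps)
  finally show ?thesis
    unfolding halfline_def has_bochner_integral_iff
    by (simp add: integrable_restrict_space integral_restrict_space)
qed

lemma has_bochner_integral_Gamma_real:
  assumes "x > 0" "\<sigma> > 0"
  shows "has_bochner_integral halfline (\<lambda>t. t powr (\<sigma> - 1) * exp (- (x * t))) (Gamma \<sigma> * x powr (- \<sigma>))"
proof -
  have "has_bochner_integral halfline (\<lambda>t. Re (of_real t powr (of_real \<sigma> - 1) * of_real (exp (- (x * t)))))
      (Re (Gamma (of_real \<sigma>) * of_real x powr (- of_real \<sigma>)))"
    using has_bochner_integral_Gamma[OF assms(1), of "of_real \<sigma>"] assms
    by (intro has_bochner_integral_bounded_linear[OF bounded_linear_Re]) auto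
  moreover have "Re (Gamma (of_real \<sigma>) * of_real x powr (- of_real \<sigma>)) = Gamma \<sigma> * x powr (- \<sigma>)"
  proof -
    have "Gamma (of_real \<sigma>) * complex_of_real x powr (- of_real \<sigma>) = of_real (Gamma \<sigma> * x powr (- \<sigma>))"
      using assms powr_of_real[of x "- \<sigma>"] by (simp add: Gamma_complex_of_real)
    then show ?thesis by simp
  qed
  moreover have "Re (of_real t powr (of_real \<sigma> - 1) * of_real (exp (- (x * t)))) = t powr (\<sigma> - 1) * exp (- (x * t))"
    if "t \<in> space halfline" for t
  proof -
    have "complex_of_real t powr (of_real \<sigma> - 1) = of_real (t powr (\<sigma> - 1))"
      using that powr_of_real[of t "\<sigma> - 1"] by simp
    then show ?thesis by simp
  qed
  ultimately show ?thesis
    by (blast intro: has_bochner_integral_transform)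
qed

text \<open>Fubini for an abstract index measure: \<open>N\<close> is a counting measure for the
  series of zeta, of the polylogarithm, of \<open>lam\<close> and of the double series, and it is
  \<open>halfline\<close> itself in \<open>ray_mellin\<close>. Absolute convergence at the real
  point \<open>Re s\<close> suffices because the inner integral of the norm is again a gamma
  integral.\<close>

lemma
  fixes c :: "'i \<Rightarrow> complex" and x :: "'i \<Rightarrow> real"
  assumes N: "sigma_finite_measure N"
    and [measurable]: "c \<in> borel_measurable N" "x \<in> borel_measurable N"
    and pos: "\<And>i. i \<in> space N \<Longrightarrow> x i > 0"
    and s: "Re s > 0"
    and int: "integrable N (\<lambda>i. norm (c i) * x i powr (- Re s))"
  shows integrable_mellin: "integrable halfline
      (\<lambda>t. of_real t powr (s - 1) * (\<integral>i. c i * of_real (exp (- (x i * t))) \<partial>N))"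
    and integral_mellin: "(\<integral>t. of_real t powr (s - 1) * (\<integral>i. c i * of_real (exp (- (x i * t))) \<partial>N) \<partial>halfline) =
      Gamma s * (\<integral>i. c i * of_real (x i) powr (- s) \<partial>N)"
proof -
  interpret N: sigma_finite_measure N by fact
  interpret H: sigma_finite_measure halfline by (rule sigma_finite_halfline)
  interpret pair_sigma_finite N halfline ..
  define f where "f = (\<lambda>i t. of_real t powr (s - 1) * (c i * complex_of_real (exp (- (x i * t)))))"
  have [measurable]: "(\<lambda>t. complex_of_real t powr (s - 1)) \<in> borel_measurable halfline"
    by (rule measurable_halfline_continuous[OF continuous_on_of_real_powr])
  have [measurable]: "(\<lambda>t::real. t) \<in> borel_measurable halfline"
    by (rule measurable_halfline_continuous) (intro continuous_intros)
  have fm: "case_prod f \<in> borel_measurable (N \<Otimes>\<^sub>M halfline)"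
    unfolding f_def by measurable
  have hb: "has_bochner_integral halfline (f i) (c i * (Gamma s * of_real (x i) powr (- s)))"
    if "i \<in> space N" for i
    using has_bochner_integral_mult_right[OF has_bochner_integral_Gamma[OF pos[OF that] s], of "c i"]
    by (simp add: f_def mult_ac)
  have hn: "has_bochner_integral halfline (\<lambda>t. norm (f i t)) (norm (c i) * (Gamma (Re s) * x i powr (- Re s)))"
    if "i \<in> space N" for i
  proof -
    have "has_bochner_integral halfline (\<lambda>t. norm (c i) * (t powr (Re s - 1) * exp (- (x i * t))))
       (norm (c i) * (Gamma (Re s) * x i powr (- Re s)))"
      by (intro has_bochner_integral_mult_right has_bochner_integral_Gamma_real pos that s)
    moreover have "norm (f i t) = norm (c i) * (t powr (Re s - 1) * exp (- (x i * t)))" if "t \<in> space halfline" for t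
      using that by (simp add: f_def norm_mult norm_of_real_powr)
    ultimately show ?thesis by (auto intro: has_bochner_integral_transform)
  qed
  have "integrable (N \<Otimes>\<^sub>M halfline) (case_prod f)"
  proof (rule Fubini_integrable[OF fm])
    have "integrable N (\<lambda>i. Gamma (Re s) * (norm (c i) * x i powr (- Re s)))"
      by (intro integrable_mult_right int)
    moreover have "(\<integral>t. norm (f i t) \<partial>halfline) = Gamma (Re s) * (norm (c i) * x i powr (- Re s))" if "i \<in> space N" for i
      using has_bochner_integral_integral_eq[OF hn[OF that]] by (simp add: mult_ac)
    ultimately show "integrable N (\<lambda>i. \<integral>t. norm (case (i, t) of (i, t) \<Rightarrow> f i t) \<partial>halfline)"
      by (simp cong: Bochner_Integration.integrable_cong)
    show "AE i in N. integrable halfline (\<lambda>t. case (i, t) of (i, t) \<Rightarrow> f i t)"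
      using hb by (auto intro!: AE_I2 simp: has_bochner_integral_iff)
  qed
  note fi = this
  have inner: "(\<integral>i. f i t \<partial>N) = of_real t powr (s - 1) * (\<integral>i. c i * of_real (exp (- (x i * t))) \<partial>N)" for t
    unfolding f_def by simp
  show "integrable halfline (\<lambda>t. of_real t powr (s - 1) * (\<integral>i. c i * of_real (exp (- (x i * t))) \<partial>N))"
    using integrable_snd[OF fi] by (simp add: inner)
  have "(\<integral>t. (\<integral>i. f i t \<partial>N) \<partial>halfline) = (\<integral>i. (\<integral>t. f i t \<partial>halfline) \<partial>N)"
    by (rule Fubini_integral[OF fi])
  also have "\<dots> = (\<integral>i. Gamma s * (c i * of_real (x i) powr (- s)) \<partial>N)"
    using has_bochner_integral_integral_eq[OF hb]
    by (intro Bochner_Integration.integral_cong refl) (simp add: mult_ac)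
  finally show "(\<integral>t. of_real t powr (s - 1) * (\<integral>i. c i * of_real (exp (- (x i * t))) \<partial>N) \<partial>halfline) =
      Gamma s * (\<integral>i. c i * of_real (x i) powr (- s) \<partial>N)"
    by (simp add: inner)
qed

lemma measurable_halfline_powr [measurable]:
  "(\<lambda>t. complex_of_real t powr z) \<in> borel_measurable halfline"
  by (rule measurable_halfline_continuous[OF continuous_on_of_real_powr])

lemma measurable_halfline_ident [measurable]: "(\<lambda>t. t) \<in> borel_measurable halfline"
  by (rule measurable_halfline_continuous) (intro continuous_intros)

definition mellin :: "(real \<Rightarrow> complex) \<Rightarrow> complex \<Rightarrow> complex" where
  "mellin \<phi> z = (\<integral>x. of_real x powr (z - 1) * \<phi> x \<partial>halfline)"

text \<open>Gives one majorant for a whole vertical strip: the left endpoint controls small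
  \<open>x\<close>, the right one large \<open>x\<close>.\<close>

lemma powr_le_powr_endpoints:
  assumes "x > (0::real)" "a \<le> s" "s \<le> b"
  shows "x powr s \<le> x powr a + x powr b"
proof (cases "x \<le> 1")
  case True
  then have "x powr s \<le> x powr a" using assms by (intro powr_mono') auto
  then show ?thesis by (simp add: add_increasing2)
next
  case False
  then have "x powr s \<le> x powr b" using assms by (intro powr_mono) auto
  then show ?thesis by (simp add: add_increasing)
qed

lemma mellin_integrable:
  assumes [measurable]: "\<phi> \<in> borel_measurable halfline"
    and "integrable halfline (\<lambda>x. x powr (Re z - 1) * norm (\<phi> x))"
  shows "integrable halfline (\<lambda>x. of_real x powr (z - 1) * \<phi> x)"
  using assms(2) by (rule Bochner_Integration.integrable_bound)
    (auto simp: norm_mult norm_of_real_powr intro!: AE_I2)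

lemma mellin_holomorphic:
  assumes [measurable]: "\<phi> \<in> borel_measurable halfline"
    and int: "\<And>\<sigma>. \<sigma> > \<sigma>0 \<Longrightarrow> integrable halfline (\<lambda>x. x powr (\<sigma> - 1) * norm (\<phi> x))"
  shows "mellin \<phi> holomorphic_on {z. Re z > \<sigma>0}"
proof -
  have "(\<lambda>z. \<integral>x. of_real x powr (z - 1) * \<phi> x \<partial>halfline) holomorphic_on {z. Re z > \<sigma>0}"
  proof (rule holomorphic_on_integral)
    show "(\<lambda>z. of_real x powr (z - 1) * \<phi> x) holomorphic_on {z. Re z > \<sigma>0}" if "x \<in> space halfline" for x
      using that by (auto intro!: holomorphic_intros)
    show "open {z. Re z > \<sigma>0}" by (rule open_halfspace_Re_gt)
    fix s assume s: "s \<in> {z. Re z > \<sigma>0}"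
    show "(\<lambda>x. of_real x powr (s - 1) * \<phi> x) \<in> borel_measurable halfline" by measurable
    define a where "a = (Re s + \<sigma>0) / 2"
    define b where "b = Re s + 1"
    have ab: "a > \<sigma>0" "a < Re s" "b > \<sigma>0" "Re s < b" using s by (auto simp: a_def b_def)
    show "\<exists>V g. open V \<and> s \<in> V \<and> V \<subseteq> {z. Re z > \<sigma>0} \<and> integrable halfline g \<and>
      (\<forall>w\<in>V. \<forall>x\<in>space halfline. norm (of_real x powr (w - 1) * \<phi> x) \<le> g x)"
    proof (intro exI conjI ballI)
      show "open ({z. Re z > a} \<inter> {z. Re z < b})"
        by (intro open_Int open_halfspace_Re_gt open_halfspace_Re_lt)
      show "integrable halfline (\<lambda>x. x powr (a - 1) * norm (\<phi> x) + x powr (b - 1) * norm (\<phi> x))"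
        using ab by (intro Bochner_Integration.integrable_add int)
      fix w x assume w: "w \<in> {z. Re z > a} \<inter> {z. Re z < b}" and x: "x \<in> space halfline"
      have "x powr (Re w - 1) \<le> x powr (a - 1) + x powr (b - 1)"
        using w x by (intro powr_le_powr_endpoints) auto
      then have "x powr (Re w - 1) * norm (\<phi> x) \<le> (x powr (a - 1) + x powr (b - 1)) * norm (\<phi> x)"
        by (intro mult_right_mono) auto
      then show "norm (of_real x powr (w - 1) * \<phi> x) \<le> x powr (a - 1) * norm (\<phi> x) + x powr (b - 1) * norm (\<phi> x)"
        using x by (simp add: norm_mult norm_of_real_powr distrib_right)
    qed (use ab in auto)
  qed
  then show ?thesis by (simp add: mellin_def[abs_def])
qed

lemma integrable_exp_decay:
  fixes \<phi> :: "real \<Rightarrow> complex"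
  assumes [measurable]: "\<phi> \<in> borel_measurable halfline"
    and "\<And>x. x > 0 \<Longrightarrow> norm (\<phi> x) \<le> C * exp (- x)" "\<sigma> > 0"
  shows "integrable halfline (\<lambda>x. x powr (\<sigma> - 1) * norm (\<phi> x))"
    and "(\<integral>x. x powr (\<sigma> - 1) * norm (\<phi> x) \<partial>halfline) \<le> C * Gamma \<sigma>"
proof -
  have *: "has_bochner_integral halfline (\<lambda>x. C * (x powr (\<sigma> - 1) * exp (- (1 * x)))) (C * (Gamma \<sigma> * 1 powr (- \<sigma>)))"
    by (intro has_bochner_integral_mult_right has_bochner_integral_Gamma_real assms) simp
  then have i: "integrable halfline (\<lambda>x. C * (x powr (\<sigma> - 1) * exp (- x)))"
    by (simp add: has_bochner_integral_iff)
  have le: "x powr (\<sigma> - 1) * norm (\<phi> x) \<le> C * (x powr (\<sigma> - 1) * exp (- x))" if "x > 0" for x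
    using mult_left_mono[OF assms(2)[OF that], of "x powr (\<sigma> - 1)"] by (simp add: mult_ac)
  show int: "integrable halfline (\<lambda>x. x powr (\<sigma> - 1) * norm (\<phi> x))"
    using i by (rule Bochner_Integration.integrable_bound)
      (auto intro!: AE_I2 order_trans[OF le abs_ge_self] simp del: abs_mult)
  have "(\<integral>x. x powr (\<sigma> - 1) * norm (\<phi> x) \<partial>halfline) \<le> (\<integral>x. C * (x powr (\<sigma> - 1) * exp (- x)) \<partial>halfline)"
    by (intro integral_mono int i le) auto
  also have "\<dots> = C * Gamma \<sigma>"
    using has_bochner_integral_integral_eq[OF *] by simp
  finally show "(\<integral>x. x powr (\<sigma> - 1) * norm (\<phi> x) \<partial>halfline) \<le> C * Gamma \<sigma>" .
qed

lemma norm_mellin_le: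
  assumes [measurable]: "\<phi> \<in> borel_measurable halfline"
    and "\<And>x. x > 0 \<Longrightarrow> norm (\<phi> x) \<le> C * exp (- x)" "Re z > 0"
  shows "norm (mellin \<phi> z) \<le> C * Gamma (Re z)"
proof -
  have "norm (mellin \<phi> z) \<le> (\<integral>x. norm (of_real x powr (z - 1) * \<phi> x) \<partial>halfline)"
    unfolding mellin_def by (rule integral_norm_bound)
  also have "\<dots> = (\<integral>x. x powr (Re z - 1) * norm (\<phi> x) \<partial>halfline)"
    by (intro Bochner_Integration.integral_cong refl) (auto simp: norm_mult norm_of_real_powr)
  also have "\<dots> \<le> C * Gamma (Re z)"
    by (rule integrable_exp_decay(2)[OF assms])
  finally show ?thesis .
qed

text \<open>The kernel \<open>1/(e\<^sup>z - 1)\<close> with its pole at \<open>0\<close> cancelled by \<open>e\<^sup>-\<^sup>z/z\<close>, a term whose Mellin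
  transform is elementary and which does not spoil the exponential decay.\<close>

definition exp_quot :: "complex \<Rightarrow> complex" where
  "exp_quot z = (if z = 0 then 1 else (exp z - 1) / z)"

definition kern :: "complex \<Rightarrow> complex" where
  "kern z = (if z = 0 then deriv (\<lambda>w. 1 / exp_quot w - exp (- w)) 0 else 1 / (exp z - 1) - exp (- z) / z)"

section \<open>The regularised kernel on a horizontal strip\<close>

definition strip :: "complex set" where
  "strip = {z. \<bar>Im z\<bar> < 2 * pi}"

lemma open_strip: "open strip"
proof -
  have "strip = {z. Im z < 2 * pi} \<inter> {z. Im z > - (2 * pi)}" by (auto simp: strip_def)
  then show ?thesis
    by (metis open_Int open_halfspace_Im_gt open_halfspace_Im_lt)
qed

lemma exp_neq_1_on_strip:
  assumes "z \<in> strip" "z \<noteq> 0"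
  shows "exp z \<noteq> 1"
proof
  assume "exp z = 1"
  then obtain n :: int where n: "Re z = 0" "Im z = of_int (2 * n) * pi"
    unfolding exp_eq_1 by auto
  have "n \<noteq> 0" using n assms(2) by (auto simp: complex_eq_iff)
  then have "\<bar>real_of_int n\<bar> \<ge> 1" by linarith
  then have "2 * \<bar>real_of_int n\<bar> * pi \<ge> 2 * 1 * pi" by (intro mult_right_mono mult_left_mono) auto
  then show False using assms(1) n by (simp add: strip_def abs_mult)
qed

text \<open>Removable singularity: away from 0 the kernel is the difference quotient of
  \<open>k\<close> at 0, where \<open>k 0 = 0\<close>. On the strip \<open>exp_quot\<close> has no
  zeros, since the zeros of e^z - 1 closest to 0 are +-2 pi i.\<close>

lemma holomorphic_kern: "kern holomorphic_on strip"
proof -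
  have "(\<lambda>z. if z = 0 then deriv exp 0 else (exp z - exp 0) / (z - 0)) holomorphic_on UNIV"
    by (intro pole_lemma_open holomorphic_intros) auto
  also have "(\<lambda>z. if z = 0 then deriv exp 0 else (exp z - exp 0) / (z - 0)) = exp_quot"
    by (auto simp: exp_quot_def DERIV_imp_deriv[OF DERIV_exp])
  finally have 1: "exp_quot holomorphic_on strip" by (rule holomorphic_on_subset) auto
  have nz: "exp_quot z \<noteq> 0" if "z \<in> strip" for z
    using exp_neq_1_on_strip[OF that] by (auto simp: exp_quot_def)
  define k where "k = (\<lambda>w. 1 / exp_quot w - exp (- w))"
  have "k holomorphic_on strip"
    unfolding k_def using 1 nz by (intro holomorphic_intros) auto
  from pole_lemma_open[OF this open_strip, of 0]
  have "(\<lambda>z. if z = 0 then deriv k 0 else (k z - k 0) / (z - 0)) holomorphic_on strip" .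
  then show ?thesis
  proof (rule holomorphic_transform)
    fix z assume z: "z \<in> strip"
    have "(k z - k 0) / (z - 0) = 1 / (exp z - 1) - exp (- z) / z" if "z \<noteq> 0"
      using that exp_neq_1_on_strip[OF z that] by (simp add: k_def exp_quot_def field_simps)
    then show "(if z = 0 then deriv k 0 else (k z - k 0) / (z - 0)) = kern z"
      by (simp add: kern_def k_def)
  qed
qed

text \<open>The region contains the closed unit discs about the points of [0, \<infinity>), which
  Cauchy's estimate needs in \<open>kern_deriv_bound\<close>. For \<open>Re z \<le> 1\<close>
  compactness gives \<open>B\<close>, and the decay costs a factor \<open>exp 1\<close>; beyond, the
  two summands contribute 2 and 1 to the constant 3.\<close>

lemma kern_bound:
  obtains C where "C \<ge> 0" "\<And>z. Re z \<ge> -1 \<Longrightarrow> \<bar>Im z\<bar> \<le> 1 \<Longrightarrow> norm (kern z) \<le> C * exp (- Re z)"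
proof -
  have sub: "cbox (Complex (-1) (-1)) (Complex 1 1) \<subseteq> strip"
    using pi_gt3 by (auto simp: in_cbox_complex_iff strip_def)
  have "continuous_on (cbox (Complex (-1) (-1)) (Complex 1 1)) kern"
    using holomorphic_on_imp_continuous_on[OF holomorphic_kern] sub by (rule continuous_on_subset)
  then have "compact (kern ` cbox (Complex (-1) (-1)) (Complex 1 1))"
    by (intro compact_continuous_image compact_cbox)
  then obtain B where B: "\<And>z. z \<in> cbox (Complex (-1) (-1)) (Complex 1 1) \<Longrightarrow> norm (kern z) \<le> B"
    using compact_imp_bounded bounded_iff by (metis imageI)
  have B0: "B \<ge> 0" using B[of 0] by (auto simp: in_cbox_complex_iff intro: order_trans[OF norm_ge_zero])
  show ?thesis
  proof (rule that[of "3 + B * exp 1"])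
    show "3 + B * exp 1 \<ge> 0" using B0 by simp
    fix z assume z: "Re z \<ge> -1" "\<bar>Im z\<bar> \<le> 1"
    show "norm (kern z) \<le> (3 + B * exp 1) * exp (- Re z)"
    proof (cases "Re z \<le> 1")
      case True
      then have "norm (kern z) \<le> B" using z by (intro B) (auto simp: in_cbox_complex_iff)
      also have "\<dots> \<le> B * exp (1 - Re z)"
        using B0 True by (simp add: mult_le_cancel_left1)
      also have "\<dots> \<le> (3 + B * exp 1) * exp (- Re z)"
        by (simp add: algebra_simps exp_diff exp_minus divide_inverse)
      finally show ?thesis .
    next
      case False
      have "exp (Re z) \<ge> 2" using exp_ge_add_one_self[of "Re z"] False by linarith
      moreover have "norm (exp z - 1) \<ge> exp (Re z) - 1"
        using norm_triangle_ineq2[of "exp z" 1] by simp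
      ultimately have "norm (exp z - 1) \<ge> exp (Re z) / 2" by linarith
      then have "norm (1 / (exp z - 1)) \<le> 1 / (exp (Re z) / 2)"
        unfolding norm_divide norm_one by (intro frac_le) auto
      also have "\<dots> = 2 * exp (- Re z)" by (simp add: exp_minus field_simps)
      finally have "norm (1 / (exp z - 1)) \<le> 2 * exp (- Re z)" .
      moreover have "norm z \<ge> 1" using False complex_Re_le_cmod[of z] by linarith
      then have "norm (exp (- z) / z) \<le> exp (- Re z)"
        by (simp add: norm_divide divide_le_eq mult_le_cancel_left1)
      ultimately have "norm (1 / (exp z - 1) - exp (- z) / z) \<le> 3 * exp (- Re z)"
        using norm_triangle_ineq4[of "1 / (exp z - 1)" "exp (- z) / z"] by linarith
      moreover have "z \<noteq> 0" using False by auto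
      ultimately have "norm (kern z) \<le> 3 * exp (- Re z)" by (simp add: kern_def)
      also have "\<dots> \<le> (3 + B * exp 1) * exp (- Re z)" using B0 by simp
      finally show ?thesis .
    qed
  qed
qed

text \<open>The clamp freezes the value at 0 on the negative axis, where \<open>kern\<close> itself
  grows; the result is continuous and bounded on the whole line.\<close>

definition kern_deriv :: "nat \<Rightarrow> real \<Rightarrow> complex" where
  "kern_deriv j x = (deriv ^^ j) kern (of_real (max 0 x))"

lemma of_real_in_strip [simp]: "of_real x \<in> strip"
  by (simp add: strip_def)

lemma has_field_derivative_kern:
  "z \<in> strip \<Longrightarrow> ((deriv ^^ j) kern has_field_derivative (deriv ^^ Suc j) kern z) (at z)"
  by (rule has_field_derivative_higher_deriv[OF holomorphic_kern open_strip])

lemma continuous_kern_deriv: "continuous_on UNIV (kern_deriv j)"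
proof -
  have "continuous_on strip ((deriv ^^ j) kern)"
    by (intro holomorphic_on_imp_continuous_on holomorphic_higher_deriv holomorphic_kern open_strip)
  then show ?thesis
    unfolding kern_deriv_def by (rule continuous_on_compose2) (auto intro!: continuous_intros)
qed

lemma measurable_kern_deriv [measurable]: "kern_deriv j \<in> borel_measurable borel"
  using continuous_kern_deriv by (rule borel_measurable_continuous_onI)

lemma has_vector_derivative_kern_deriv:
  assumes "x > 0"
  shows "(kern_deriv j has_vector_derivative kern_deriv (Suc j) x) (at x)"
proof -
  have "((\<lambda>x. (deriv ^^ j) kern (of_real x)) has_vector_derivative (deriv ^^ Suc j) kern (of_real x)) (at x)"
    using has_field_derivative_kern[of "of_real x" j]
    by (intro has_vector_derivative_real_field) auto
  then have "(kern_deriv j has_vector_derivative (deriv ^^ Suc j) kern (of_real x)) (at x)"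
    by (rule has_vector_derivative_transform_within_open[of _ _ _ "{0<..}"])
       (use assms in \<open>auto simp: kern_deriv_def\<close>)
  then show ?thesis using assms by (simp add: kern_deriv_def)
qed

lemma kern_deriv_bound:
  obtains C where "C \<ge> 0" "\<And>x. x \<ge> 0 \<Longrightarrow> norm (kern_deriv j x) \<le> C * exp (- x)"
proof -
  obtain C where C: "C \<ge> 0" "\<And>z. Re z \<ge> -1 \<Longrightarrow> \<bar>Im z\<bar> \<le> 1 \<Longrightarrow> norm (kern z) \<le> C * exp (- Re z)"
    using kern_bound by blast
  show ?thesis
  proof (rule that[of "fact j * (C * exp 1)"])
    fix x :: real assume x: "x \<ge> 0"
    have near: "Re z \<ge> x - 1 \<and> \<bar>Im z\<bar> \<le> 1" if "norm (of_real x - z) \<le> 1" for z :: complex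
      using that abs_Re_le_cmod[of "of_real x - z"] abs_Im_le_cmod[of "of_real x - z"] by simp
    have sub: "cball (of_real x) 1 \<subseteq> strip"
      using near pi_gt3 by (force simp: strip_def dist_norm)
    have "norm ((deriv ^^ j) kern (of_real x)) \<le> fact j * (C * exp (1 - x)) / 1 ^ j"
    proof (rule Cauchy_inequality)
      show "kern holomorphic_on ball (of_real x) 1"
        using holomorphic_kern by (rule holomorphic_on_subset) (use sub ball_subset_cball in blast)
      show "continuous_on (cball (of_real x) 1) kern"
        using holomorphic_on_imp_continuous_on[OF holomorphic_kern] sub by (rule continuous_on_subset)
      fix z :: complex assume "norm (of_real x - z) = 1"
      then have z: "Re z \<ge> x - 1 \<and> \<bar>Im z\<bar> \<le> 1" by (intro near) simp
      have "norm (kern z) \<le> C * exp (- Re z)" using z x by (intro C) auto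
      also have "\<dots> \<le> C * exp (1 - x)" using z C(1) by (intro mult_left_mono) auto
      finally show "norm (kern z) \<le> C * exp (1 - x)" .
    qed simp
    then show "norm (kern_deriv j x) \<le> fact j * (C * exp 1) * exp (- x)"
      using x by (simp add: kern_deriv_def exp_diff exp_minus field_simps max_absorb2)
  qed (use C in auto)
qed

text \<open>The factor \<open>rGamma z\<close> turns integration by parts into the shift of
  \<open>(j, z)\<close> to \<open>(j + 1, z + 1)\<close> with a sign and no other factor. For
  \<open>j = 0\<close>, \<open>t = 0\<close> and \<open>Re z > 1\<close> the value is zeta(z) - 1/(z
  - 1).\<close>

definition kern_mellin :: "nat \<Rightarrow> complex \<Rightarrow> real \<Rightarrow> complex" where
  "kern_mellin j z t = rGamma z * mellin (\<lambda>x. kern_deriv j (x + t)) z"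

lemma kern_deriv_shift_bound:
  obtains C where "C \<ge> 0" "\<And>x t. x > 0 \<Longrightarrow> t \<ge> 0 \<Longrightarrow> norm (kern_deriv j (x + t)) \<le> C * exp (- x)"
proof -
  obtain C where C: "C \<ge> 0" "\<And>x. x \<ge> 0 \<Longrightarrow> norm (kern_deriv j x) \<le> C * exp (- x)"
    using kern_deriv_bound by blast
  have "norm (kern_deriv j (x + t)) \<le> C * exp (- x)" if "x > 0" "t \<ge> 0" for x t
    using C(2)[of "x + t"] that C(1) by (smt (verit) exp_le_cancel_iff mult_left_mono)
  then show ?thesis using that C(1) by blast
qed

lemma integrable_kern_deriv:
  assumes "Re z > 0" "t \<ge> 0"
  shows "integrable halfline (\<lambda>x. of_real x powr (z - 1) * kern_deriv j (x + t))"
proof -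
  obtain C where "\<And>x t. x > 0 \<Longrightarrow> t \<ge> 0 \<Longrightarrow> norm (kern_deriv j (x + t)) \<le> C * exp (- x)"
    using kern_deriv_shift_bound by blast
  then show ?thesis using assms
    by (intro mellin_integrable integrable_exp_decay(1)[of _ C]) auto
qed

lemma kern_mellin_holomorphic:
  assumes "t \<ge> 0"
  shows "(\<lambda>z. kern_mellin j z t) holomorphic_on {z. Re z > 0}"
proof -
  obtain C where "\<And>x t. x > 0 \<Longrightarrow> t \<ge> 0 \<Longrightarrow> norm (kern_deriv j (x + t)) \<le> C * exp (- x)"
    using kern_deriv_shift_bound by blast
  then show ?thesis using assms unfolding kern_mellin_def
    by (intro holomorphic_intros mellin_holomorphic integrable_exp_decay(1)[of _ C]) auto
qed

text \<open>Integration by parts; this is what continues the transform to the left.\<close>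

lemma kern_mellin_Suc:
  assumes z: "Re z > 0" and t: "t \<ge> 0"
  shows "kern_mellin j z t = - kern_mellin (Suc j) (z + 1) t"
proof -
  define F where "F x = of_real x powr z * kern_deriv j (x + t)" for x
  define f where "f x = z * (of_real x powr (z - 1) * kern_deriv j (x + t)) + of_real x powr (z + 1 - 1) * kern_deriv (Suc j) (x + t)" for x
  obtain C where C: "C \<ge> 0" "\<And>x t. x > 0 \<Longrightarrow> t \<ge> 0 \<Longrightarrow> norm (kern_deriv j (x + t)) \<le> C * exp (- x)"
    using kern_deriv_shift_bound by blast
  have i1: "integrable halfline (\<lambda>x. of_real x powr (z - 1) * kern_deriv j (x + t))"
    and i2: "integrable halfline (\<lambda>x. of_real x powr (z + 1 - 1) * kern_deriv (Suc j) (x + t))"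
    using z t by (intro integrable_kern_deriv; simp)+
  have Fn: "norm (F x) \<le> C * (x powr Re z * exp (- x))" if "x > 0" for x
    using mult_left_mono[OF C(2)[OF that t], of "x powr Re z"] that
    by (simp add: F_def norm_mult norm_of_real_powr mult_ac)
  have "((\<lambda>x. C * (x powr Re z * exp (- x))) \<longlongrightarrow> C * 0) (at_right 0)"
    using z by (intro tendsto_mult_left) real_asymp
  then have l0: "(F \<longlongrightarrow> 0) (at_right 0)"
    by (intro Lim_null_comparison[of F]) (auto simp: eventually_at_right_less intro!: Fn eventually_mono[OF eventually_at_right_less])
  have "((\<lambda>x. C * (x powr Re z * exp (- x))) \<longlongrightarrow> C * 0) at_top"
    using z by (intro tendsto_mult_left) real_asymp
  then have l1: "(F \<longlongrightarrow> 0) at_top"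
    by (intro Lim_null_comparison[of F]) (auto intro!: Fn eventually_mono[OF eventually_gt_at_top[of 0]])
  have "(LBINT x=0..\<infinity>. f x) = 0 - 0"
  proof (rule interval_integral_FTC_integrable)
    fix x :: real assume "0 < ereal x" "ereal x < \<infinity>"
    then have x: "x > 0" by simp
    have "((\<lambda>x. of_real x powr z) has_vector_derivative z * of_real x powr (z - 1)) (at x)"
      using x by (intro has_vector_derivative_real_field) (auto intro!: derivative_eq_intros)
    moreover have "((kern_deriv j \<circ> (\<lambda>x. x + t)) has_vector_derivative (1 *\<^sub>R kern_deriv (Suc j) (x + t))) (at x)"
      using x t by (intro vector_diff_chain_at has_vector_derivative_kern_deriv) (auto intro!: derivative_eq_intros)
    ultimately show "(F has_vector_derivative f x) (at x)"
      unfolding F_def f_def o_def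
      by (auto dest: has_vector_derivative_mult simp: algebra_simps)
    have "continuous_on {0<..} f"
      unfolding f_def
      by (intro continuous_intros continuous_on_of_real_powr continuous_on_compose2[OF continuous_kern_deriv]) (auto simp: complex_nonpos_Reals_iff)
    then show "isCont f x" using x by (simp add: continuous_on_eq_continuous_at)
  next
    show "set_integrable lborel (einterval 0 \<infinity>) f"
      using i1 i2 unfolding f_def by (simp add: integrable_halfline_iff[symmetric] zero_ereal_def)
  next
    show "((F \<circ> real_of_ereal) \<longlongrightarrow> 0) (at_right 0)" "((F \<circ> real_of_ereal) \<longlongrightarrow> 0) (at_left \<infinity>)"
      using l0 l1 by (simp_all add: ereal_tendsto_simps1 zero_ereal_def)
  qed simp
  then have "(\<integral>x. f x \<partial>halfline) = 0"
    by (simp add: integral_halfline interval_lebesgue_integral_def zero_ereal_def)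
  then have "z * mellin (\<lambda>x. kern_deriv j (x + t)) z + mellin (\<lambda>x. kern_deriv (Suc j) (x + t)) (z + 1) = 0"
    unfolding f_def mellin_def using i1 i2 by simp
  then have "rGamma (z + 1) * (z * mellin (\<lambda>x. kern_deriv j (x + t)) z) = rGamma (z + 1) * (- mellin (\<lambda>x. kern_deriv (Suc j) (x + t)) (z + 1))"
    by (simp add: add_eq_0_iff)
  then show ?thesis
    unfolding kern_mellin_def rGamma_plus1[of z, symmetric] by (simp add: mult_ac)
qed

lemma kern_mellin_shift: "Re z > 0 \<Longrightarrow> t \<ge> 0 \<Longrightarrow> kern_mellin j z t = (-1) ^ n * kern_mellin (j + n) (z + of_nat n) t"
proof (induction n)
  case (Suc n)
  then have "kern_mellin j z t = (-1) ^ n * kern_mellin (j + n) (z + of_nat n) t" by simp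
  also have "kern_mellin (j + n) (z + of_nat n) t = - kern_mellin (Suc (j + n)) (z + of_nat n + 1) t"
    using Suc by (intro kern_mellin_Suc) auto
  finally show ?case by (simp add: add_ac)
qed simp

section \<open>The Riemann zeta function and Bernoulli numbers\<close>

text \<open>The entire function \<open>\<zeta>(s) - 1/(s - 1)\<close>; any \<open>N > - Re s\<close> gives the same value.\<close>

definition zeta_reg :: "complex \<Rightarrow> complex" where
  "zeta_reg s = (let N = nat \<lceil>- Re s\<rceil> + 1 in (-1) ^ N * kern_mellin N (s + of_nat N) 0)"

text \<open>The expressions at levels \<open>L\<close> and \<open>N\<close> are both pushed up to
  level \<open>L + N\<close>.\<close>

lemma zeta_reg_eq:
  assumes "Re s + real N > 0"
  shows "zeta_reg s = (-1) ^ N * kern_mellin N (s + of_nat N) 0"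
proof -
  define L where "L = nat \<lceil>- Re s\<rceil> + 1"
  have "- Re s \<le> real_of_int \<lceil>- Re s\<rceil>" by (rule le_of_int_ceiling)
  also have "\<dots> \<le> real (nat \<lceil>- Re s\<rceil>)" by linarith
  finally have L: "Re s + real L > 0" by (simp add: L_def)
  have "(-1) ^ L * kern_mellin L (s + of_nat L) 0 = (-1) ^ (L + N) * kern_mellin (L + N) (s + of_nat (L + N)) 0"
    using kern_mellin_shift[of "s + of_nat L" 0 L N] L by (simp add: power_add add_ac)
  also have "\<dots> = (-1) ^ N * kern_mellin N (s + of_nat N) 0"
    using kern_mellin_shift[of "s + of_nat N" 0 N L] assms by (simp add: power_add add_ac)
  finally show ?thesis by (simp add: zeta_reg_def L_def Let_def)
qed

lemma zeta_reg_holomorphic: "zeta_reg holomorphic_on A"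
proof -
  have "zeta_reg holomorphic_on (\<Union>N. {s. Re s > - real N})"
  proof (rule holomorphic_on_UN_open)
    fix N :: nat
    have "(\<lambda>s. (-1) ^ N * kern_mellin N (s + of_nat N) 0) holomorphic_on {s. Re s > - real N}"
      by (intro holomorphic_intros holomorphic_on_compose_gen[where g="\<lambda>z. kern_mellin N z 0" and f="\<lambda>s. s + of_nat N"
            and t="{z. Re z > 0}", unfolded o_def])
         (auto intro!: holomorphic_intros kern_mellin_holomorphic)
    then show "zeta_reg holomorphic_on {s. Re s > - real N}"
      by (rule holomorphic_transform) (auto intro!: zeta_reg_eq[symmetric])
  qed (rule open_halfspace_Re_gt)
  moreover have "(\<Union>N. {s. Re s > - real N}) = UNIV"
  proof (intro set_eqI iffI UNIV_I)
    fix s :: complex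
    obtain N where "- Re s < real N" using reals_Archimedean2 by blast
    then show "s \<in> (\<Union>N. {s. Re s > - real N})" by (auto intro!: exI[of _ N])
  qed
  ultimately show ?thesis by (metis holomorphic_on_subset subset_UNIV)
qed

lemma exp_geometric_sums:
  assumes "y > 0"
  shows "integrable (count_space UNIV) (\<lambda>n. complex_of_real (exp (- (real (Suc n) * y))))"
    and "(\<integral>n. complex_of_real (exp (- (real (Suc n) * y))) \<partial>count_space UNIV) = 1 / (exp (of_real y) - 1)"
proof -
  define r where "r = exp (- y)"
  have r: "0 < r" "r < 1" using assms by (auto simp: r_def)
  have eq: "exp (- (real (Suc n) * y)) = r ^ Suc n" for n
    unfolding r_def exp_of_nat_mult[symmetric] by simp
  have s: "(\<lambda>n. r ^ Suc n) sums (r * (1 / (1 - r)))"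
    using sums_mult[OF geometric_sums[of r], of r] r by simp
  show int: "integrable (count_space UNIV) (\<lambda>n. complex_of_real (exp (- (real (Suc n) * y))))"
    unfolding eq integrable_count_space_nat_iff using sums_summable[OF s] r
    by (simp add: norm_mult norm_power)
  have "r * (1 / (1 - r)) = 1 / (exp y - 1)"
    using assms by (simp add: r_def exp_minus field_simps)
  with s have "(\<lambda>n. complex_of_real (exp (- (real (Suc n) * y)))) sums of_real (1 / (exp y - 1))"
    unfolding eq by (intro sums_of_real) simp
  also have "complex_of_real (1 / (exp y - 1)) = 1 / (exp (of_real y) - 1)"
    by (simp add: exp_of_real)
  finally show "(\<integral>n. complex_of_real (exp (- (real (Suc n) * y))) \<partial>count_space UNIV) = 1 / (exp (of_real y) - 1)"
    unfolding integral_count_space_nat[OF int] by (rule sums_unique[symmetric])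
qed

lemma kern_deriv_0_eq:
  assumes "x > 0"
  shows "kern_deriv 0 x = 1 / (exp (of_real x) - 1) - of_real (exp (- x)) / of_real x"
proof -
  have "exp (- complex_of_real x) = of_real (exp (- x))" by (metis exp_of_real of_real_minus)
  then show ?thesis using assms by (simp add: kern_deriv_def kern_def)
qed

lemma summable_Suc_powr: "\<sigma> > 1 \<Longrightarrow> summable (\<lambda>n. real (Suc n) powr (- \<sigma>))"
  using summable_Suc_iff[of "\<lambda>n. real n powr (- \<sigma>)"] summable_real_powr_iff[of "- \<sigma>"] by simp

lemma norm_Suc_powr: "norm (complex_of_nat (Suc n) powr s) = real (Suc n) powr Re s"
  using norm_of_real_powr[of "real (Suc n)" s] by simp

lemma summable_norm_zeta: "Re s > 1 \<Longrightarrow> summable (\<lambda>n. norm (complex_of_nat (Suc n) powr (- s)))"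
  unfolding norm_Suc_powr using summable_Suc_powr[of "Re s"] by simp

lemma not_nonpos_Int_Re: "Re z > 0 \<Longrightarrow> z \<notin> \<int>\<^sub>\<le>\<^sub>0"
  by (auto elim!: nonpos_Ints_cases)

text \<open>The Mellin transforms of the two parts of the kernel, 1/(e^t - 1) and e^-t/t, are
  Gamma(s) zeta(s) and Gamma(s - 1); after division by Gamma(s) the second one becomes 1/(s -
  1).\<close>

lemma zeta_series:
  assumes s: "Re s > 1"
  shows "(\<Sum>n. complex_of_nat (Suc n) powr (- s)) = 1 / (s - 1) + zeta_reg s"
proof -
  let ?N = "count_space (UNIV :: nat set)"
  have int: "integrable ?N (\<lambda>n. norm (1::complex) * real (Suc n) powr (- Re s))"
    unfolding integrable_count_space_nat_iff using summable_Suc_powr[OF s] by simp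
  have geo: "(\<integral>n. 1 * complex_of_real (exp (- (real (Suc n) * t))) \<partial>?N) = 1 / (exp (of_real t) - 1)"
    if "t \<in> space halfline" for t using exp_geometric_sums(2)[of t] that by (simp only: mult_1_left) simp
  have "integrable halfline (\<lambda>t. of_real t powr (s - 1) * (\<integral>n. 1 * complex_of_real (exp (- (real (Suc n) * t))) \<partial>?N))"
    using s by (intro integrable_mellin int sigma_finite_measure_count_space) auto
  then have i1: "integrable halfline (\<lambda>t. of_real t powr (s - 1) * (1 / (exp (of_real t) - 1)))"
    by (rule Bochner_Integration.integrable_cong[THEN iffD1, OF refl, rotated]) (simp only: geo)
  have "(\<integral>t. of_real t powr (s - 1) * (1 / (exp (of_real t) - 1)) \<partial>halfline) =
      (\<integral>t. of_real t powr (s - 1) * (\<integral>n. 1 * complex_of_real (exp (- (real (Suc n) * t))) \<partial>?N) \<partial>halfline)"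
    by (intro Bochner_Integration.integral_cong refl) (simp only: geo)
  also have "\<dots> = Gamma s * (\<integral>n. 1 * of_real (real (Suc n)) powr (- s) \<partial>?N)"
    using s by (intro integral_mellin int sigma_finite_measure_count_space) auto
  also have "(\<integral>n. 1 * of_real (real (Suc n)) powr (- s) \<partial>?N) = (\<Sum>n. complex_of_nat (Suc n) powr (- s))"
    using summable_norm_zeta[OF s] by (subst integral_count_space_nat) (auto simp: integrable_count_space_nat_iff)
  finally have e1: "(\<integral>t. of_real t powr (s - 1) * (1 / (exp (of_real t) - 1)) \<partial>halfline) =
      Gamma s * (\<Sum>n. complex_of_nat (Suc n) powr (- s))" .
  have g: "has_bochner_integral halfline (\<lambda>t. of_real t powr (s - 1 - 1) * of_real (exp (- (1 * t)))) (Gamma (s - 1))"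
    using has_bochner_integral_Gamma[of 1 "s - 1"] s by simp
  have g': "has_bochner_integral halfline (\<lambda>t. of_real t powr (s - 1) * (of_real (exp (- t)) / of_real t)) (Gamma (s - 1))"
    by (rule has_bochner_integral_transform[OF g]) (auto simp: powr_diff power2_eq_square)
  have "mellin (\<lambda>x. kern_deriv 0 (x + 0)) s =
      (\<integral>t. of_real t powr (s - 1) * (1 / (exp (of_real t) - 1)) - of_real t powr (s - 1) * (of_real (exp (- t)) / of_real t) \<partial>halfline)"
    unfolding mellin_def
    by (intro Bochner_Integration.integral_cong refl) (simp only: add_0_right space_halfline greaterThan_iff kern_deriv_0_eq right_diff_distrib)
  also have "\<dots> = Gamma s * (\<Sum>n. complex_of_nat (Suc n) powr (- s)) - Gamma (s - 1)"
    using g' i1 e1 by (simp add: has_bochner_integral_iff)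
  finally have mk: "mellin (\<lambda>x. kern_deriv 0 (x + 0)) s = Gamma s * (\<Sum>n. complex_of_nat (Suc n) powr (- s)) - Gamma (s - 1)" .
  have s1: "s - 1 \<notin> \<int>\<^sub>\<le>\<^sub>0" "s \<notin> \<int>\<^sub>\<le>\<^sub>0" 
    using s by (intro not_nonpos_Int_Re; simp)+
  have "Gamma s = (s - 1) * Gamma (s - 1)" using Gamma_plus1[OF s1(1)] by simp
  moreover have "Gamma s \<noteq> 0" "Gamma (s - 1) \<noteq> 0" using s1 by (simp_all add: Gamma_eq_zero_iff)
  ultimately have "rGamma s * Gamma (s - 1) = 1 / (s - 1)"
    by (simp add: rGamma_inverse_Gamma divide_inverse)
  moreover have "rGamma s * Gamma s = 1"
    using s1 by (simp add: rGamma_inverse_Gamma Gamma_eq_zero_iff)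
  ultimately have "kern_mellin 0 s 0 = (\<Sum>n. complex_of_nat (Suc n) powr (- s)) - 1 / (s - 1)"
    unfolding kern_mellin_def mk by (simp add: right_diff_distrib flip: mult.assoc)
  moreover have "zeta_reg s = kern_mellin 0 s 0" using zeta_reg_eq[of s 0] s by simp
  ultimately show ?thesis by simp
qed

lemma zeta_has_sum:
  assumes s: "Re s > 1"
  shows "(\<Sum>\<^sub>\<infinity>n\<in>{1::nat..}. 1 / of_nat n powr s) = (\<Sum>n. complex_of_nat (Suc n) powr (- s))"
proof -
  have "{1::nat..} = range Suc"
    by (auto simp: image_iff Suc_le_eq gr0_conv_Suc)
  then have "(\<Sum>\<^sub>\<infinity>n\<in>{1::nat..}. 1 / of_nat n powr s) = (\<Sum>\<^sub>\<infinity>n. 1 / complex_of_nat (Suc n) powr s)"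
    by (simp add: infsum_reindex o_def)
  also have "\<dots> = (\<Sum>\<^sub>\<infinity>n. complex_of_nat (Suc n) powr (- s))"
    by (simp only: powr_minus divide_inverse mult_1_left)
  also have "\<dots> = (\<Sum>n. complex_of_nat (Suc n) powr (- s))"
    by (rule infsumI[OF norm_summable_imp_has_sum[OF summable_norm_zeta[OF s]
            summable_sums[OF summable_norm_cancel[OF summable_norm_zeta[OF s]]]]])
  finally show ?thesis .
qed

text \<open>The explicit continuation is a witness for the \<open>SOME\<close> in the definition.
  That the chosen function coincides with it off 1 is a separate matter, settled by the identity
  theorem in \<open>riemann_zeta_eq\<close>.\<close>

lemma riemann_zeta_props:
  "riemann_zeta holomorphic_on - {1}"
  "Re s > 1 \<Longrightarrow> riemann_zeta s = (\<Sum>\<^sub>\<infinity>n\<in>{1::nat..}. 1 / of_nat n powr s)"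
proof -
  have "\<exists>f. f holomorphic_on - {1} \<and> (\<forall>s. Re s > 1 \<longrightarrow> f s = (\<Sum>\<^sub>\<infinity>n\<in>{1::nat..}. 1 / of_nat n powr s))"
  proof (intro exI conjI allI impI)
    show "(\<lambda>s. 1 / (s - 1) + zeta_reg s) holomorphic_on - {1}"
      by (intro holomorphic_intros zeta_reg_holomorphic) auto
    show "1 / (s - 1) + zeta_reg s = (\<Sum>\<^sub>\<infinity>n\<in>{1::nat..}. 1 / of_nat n powr s)" if "Re s > 1" for s
      using that by (simp only: zeta_series zeta_has_sum)
  qed
  from someI_ex[OF this]
  show "riemann_zeta holomorphic_on - {1}"
    "Re s > 1 \<Longrightarrow> riemann_zeta s = (\<Sum>\<^sub>\<infinity>n\<in>{1::nat..}. 1 / of_nat n powr s)"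
    unfolding riemann_zeta_def by blast+
qed

lemma riemann_zeta_eq_series:
  "Re s > 1 \<Longrightarrow> riemann_zeta s = (\<Sum>n. complex_of_nat (Suc n) powr (- s))"
  by (simp only: riemann_zeta_props(2) zeta_has_sum)

lemma riemann_zeta_eq:
  assumes "s \<noteq> 1"
  shows "riemann_zeta s = 1 / (s - 1) + zeta_reg s"
proof -
  have "riemann_zeta s - (1 / (s - 1) + zeta_reg s) = 0"
  proof (rule analytic_continuation[of "\<lambda>s. riemann_zeta s - (1 / (s - 1) + zeta_reg s)" "- {1}" "{s. Re s > 1}" 2])
    show "(\<lambda>s. riemann_zeta s - (1 / (s - 1) + zeta_reg s)) holomorphic_on - {1}"
      by (intro holomorphic_intros zeta_reg_holomorphic riemann_zeta_props) auto
    show "connected (- {1::complex})" by (rule connected_punctured_universe) simp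
    show "(2::complex) islimpt {s. Re s > 1}"
      by (intro interior_limit_point) (simp add: interior_open open_halfspace_Re_gt)
    show "riemann_zeta z - (1 / (z - 1) + zeta_reg z) = 0" if "z \<in> {s. Re s > 1}" for z
      using that by (simp only: mem_Collect_eq riemann_zeta_eq_series zeta_series) simp
  qed (use assms in auto)
  then show ?thesis by simp
qed

text \<open>At \<open>z = 1\<close> the weight is constant, so the transform integrates a derivative
  and only the boundary value at 0 survives. This turns \<open>zeta_reg\<close> at non-positive
  integers into Taylor coefficients of \<open>kern\<close>.\<close>

lemma kern_mellin_1: "kern_mellin (Suc l) 1 0 = - kern_deriv l 0"
proof -
  obtain C where C: "C \<ge> 0" "\<And>x. x \<ge> 0 \<Longrightarrow> norm (kern_deriv l x) \<le> C * exp (- x)"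
    using kern_deriv_bound by blast
  have i: "integrable halfline (kern_deriv (Suc l))"
  proof -
    have "integrable halfline (\<lambda>x. of_real x powr (1 - 1) * kern_deriv (Suc l) (x + 0))"
      by (rule integrable_kern_deriv) auto
    then show ?thesis by (rule Bochner_Integration.integrable_cong[THEN iffD1, OF refl, rotated]) auto
  qed
  have "((\<lambda>x. C * exp (- x)) \<longlongrightarrow> C * 0) at_top"
    by (intro tendsto_mult_left) real_asymp
  then have lim: "(kern_deriv l \<longlongrightarrow> 0) at_top"
    by (intro Lim_null_comparison[of "kern_deriv l"]) (auto intro!: C(2) eventually_mono[OF eventually_ge_at_top[of 0]])
  have "(LBINT x=0..\<infinity>. kern_deriv (Suc l) x) = 0 - kern_deriv l 0"
  proof (rule interval_integral_FTC_integrable)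
    fix x :: real assume "0 < ereal x" "ereal x < \<infinity>"
    then show "(kern_deriv l has_vector_derivative kern_deriv (Suc l) x) (at x)" by (intro has_vector_derivative_kern_deriv) simp
    show "isCont (kern_deriv (Suc l)) x" using continuous_kern_deriv by (simp add: continuous_on_eq_continuous_at)
  next
    show "set_integrable lborel (einterval 0 \<infinity>) (kern_deriv (Suc l))"
      using i by (simp add: integrable_halfline_iff[symmetric] zero_ereal_def)
    have "isCont (kern_deriv l) 0" using continuous_kern_deriv by (simp add: continuous_on_eq_continuous_at)
    then have "(kern_deriv l \<longlongrightarrow> kern_deriv l 0) (at_right 0)"
      unfolding isCont_def by (rule tendsto_within_subset) auto
    then show "((kern_deriv l \<circ> real_of_ereal) \<longlongrightarrow> kern_deriv l 0) (at_right 0)"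
      by (simp add: ereal_tendsto_simps1 zero_ereal_def)
    show "((kern_deriv l \<circ> real_of_ereal) \<longlongrightarrow> 0) (at_left \<infinity>)"
      using lim by (simp add: ereal_tendsto_simps1)
  qed simp
  then have "(\<integral>x. kern_deriv (Suc l) x \<partial>halfline) = - kern_deriv l 0"
    by (simp add: integral_halfline interval_lebesgue_integral_def zero_ereal_def)
  moreover have "mellin (\<lambda>x. kern_deriv (Suc l) (x + 0)) 1 = (\<integral>x. kern_deriv (Suc l) x \<partial>halfline)"
    unfolding mellin_def by (intro Bochner_Integration.integral_cong refl) simp
  ultimately show ?thesis by (simp add: kern_mellin_def rGamma_inverse_Gamma)
qed

section \<open>Bernoulli numbers and the values of zeta at non-positive integers\<close>

lemma fps_exp_neq_1: "fps_exp (1::'a::field_char_0) - 1 \<noteq> 0"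
proof
  assume "fps_exp (1::'a) - 1 = 0"
  then have "fps_nth (fps_exp (1::'a) - 1) 1 = 0" by (simp only: fps_zero_nth)
  then show False by simp
qed

definition bern_fps :: "complex fps" where
  "bern_fps = Abs_fps (\<lambda>n. of_real (bernoulli n / fact n))"

lemma bern_fps_eq: "bern_fps * (fps_exp 1 - 1) = fps_X * fps_exp 1"
proof (rule fps_ext)
  fix n
  have "fps_nth (bern_fps * (fps_exp 1 - 1)) n = of_real (fps_nth (Abs_fps (\<lambda>n. bernoulli n / fact n) * (fps_exp 1 - 1)) n)"
    unfolding fps_mult_nth of_real_sum by (intro sum.cong refl) (auto simp: bern_fps_def)
  also have "\<dots> = fps_nth (fps_X * fps_exp 1) n"
    unfolding bernoulli_fps by simp
  finally show "fps_nth (bern_fps * (fps_exp 1 - 1)) n = fps_nth (fps_X * fps_exp 1) n" .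
qed

text \<open>Clearing denominators gives z kern(z) (e^z - 1) = z - 1 + e^-z. Replacing X by -X
  accounts for the sign (-1)^l and fits the convention B_1 = 1/2; multiplying by e^X and cancelling
  e^X - 1 leaves X H(-X) = e^X - sum B_n X^n/n!.\<close>

lemma kern_taylor:
  "(-1) ^ l * (deriv ^^ l) kern 0 = of_real ((1 - bernoulli (l + 1)) / real (l + 1))"
proof -
  define H where "H = fps_expansion kern 0"
  have H: "kern has_fps_expansion H"
    unfolding H_def by (rule has_fps_expansion_fps_expansion[OF open_strip _ holomorphic_kern]) (simp add: strip_def)
  have nthH: "fps_nth H l = (deriv ^^ l) kern 0 / fact l" by (rule fps_nth_fps_expansion[OF H])
  have 1: "(\<lambda>z. z * kern z * (exp z - 1)) has_fps_expansion fps_X * H * (fps_exp 1 - 1)"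
    by (intro fps_expansion_intros H)
  have 2: "(\<lambda>z::complex. z - 1 + exp (- z)) has_fps_expansion fps_X - 1 + fps_exp (-1)"
    by (intro has_fps_expansion_add has_fps_expansion_diff has_fps_expansion_fps_X has_fps_expansion_1
        has_fps_expansion_exp_neg1)
  have 3: "\<forall>\<^sub>F z in nhds 0. z * kern z * (exp z - 1) = z - 1 + exp (- z)"
  proof -
    have "\<forall>\<^sub>F z in nhds (0::complex). z \<in> strip"
      using open_strip by (intro eventually_nhds_in_open) (auto simp: strip_def)
    then show ?thesis
    proof eventually_elim
      case (elim z)
      show ?case
      proof (cases "z = 0")
        case False
        have alg: "z * (1 / (e - 1) - q / z) * (e - 1) = z - q * e + q" if "e \<noteq> 1" for e q
          using that False by (simp add: field_simps)
        have "exp (- z) * exp z = 1" by (simp flip: exp_add)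
        then show ?thesis
          using alg[OF exp_neq_1_on_strip[OF elim False], of "exp (- z)"] False by (simp add: kern_def)
      qed simp
    qed
  qed
  have "fps_X * H * (fps_exp 1 - 1) = fps_X - 1 + fps_exp (-1)"
    using 1[unfolded has_fps_expansion_cong[OF 3 refl]] 2 by (rule fps_expansion_unique_complex)
  then have "(fps_X * H * (fps_exp 1 - 1)) oo (- fps_X) = (fps_X - 1 + fps_exp (-1)) oo (- fps_X)" by simp
  moreover define H' where "H' = H oo (- fps_X)"
  ultimately have "(- fps_X) * H' * (fps_exp (-1) - 1) = - fps_X - 1 + fps_exp 1"
    by (simp add: fps_compose_mult_distrib fps_compose_sub_distrib fps_compose_add_distrib)
  then have "(- fps_X) * H' * (fps_exp (-1) - 1) * fps_exp 1 = (- fps_X - 1 + fps_exp 1) * fps_exp 1"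
    by simp
  moreover have "fps_exp (-1) * fps_exp 1 = (1 :: complex fps)"
    using fps_exp_add_mult[of "-1" "1::complex"] by simp
  then have "(- fps_X) * H' * (fps_exp (-1) - 1) * fps_exp 1 = fps_X * H' * (fps_exp 1 - 1)"
    by (simp add: algebra_simps)
  ultimately have "fps_X * H' * (fps_exp 1 - 1) = (fps_exp 1 - bern_fps) * (fps_exp 1 - 1)"
    using bern_fps_eq by (simp add: algebra_simps)
  then have "fps_X * H' = fps_exp 1 - bern_fps"
    using fps_exp_neq_1 by (metis mult_right_cancel)
  then have "fps_nth (fps_X * H') (Suc l) = fps_nth (fps_exp 1 - bern_fps) (Suc l)" by simp
  then have "(-1) ^ l * fps_nth H l = 1 / fact (Suc l) - of_real (bernoulli (Suc l) / fact (Suc l))"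
    by (simp add: H'_def fps_compose_uminus' bern_fps_def del: fact_Suc of_nat_Suc)
  then have "(-1) ^ l * (deriv ^^ l) kern 0 = fact l * (1 / fact (Suc l) - of_real (bernoulli (Suc l) / fact (Suc l)))"
    unfolding nthH by (simp add: field_simps)
  also have "\<dots> = of_real ((1 - bernoulli (l + 1)) / real (l + 1))"
    by (simp add: right_diff_distrib diff_divide_distrib del: of_nat_Suc)
  finally show ?thesis .
qed

text \<open>With \<open>zeta_reg (- of_nat l)\<close> equal to (1 - B_(l+1))/(l + 1), the polar part
  1/(s - 1) = -1/(l + 1) removes the 1. By the convention B_1 = 1/2 the formula includes
  \<open>l = 0\<close>.\<close>

lemma riemann_zeta_neg:
  "riemann_zeta (- of_nat l) = - of_real (bernoulli (l + 1)) / of_nat (l + 1)"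
proof -
  have "zeta_reg (- of_nat l) = (-1) ^ Suc l * kern_mellin (Suc l) 1 0"
    using zeta_reg_eq[of "- of_nat l" "Suc l"] by simp
  also have "\<dots> = (-1) ^ l * (deriv ^^ l) kern 0"
    by (simp add: kern_mellin_1 kern_deriv_def)
  also have "\<dots> = of_real ((1 - bernoulli (l + 1)) / real (l + 1))"
    by (rule kern_taylor)
  finally have zeta_reg: "zeta_reg (- of_nat l) = of_real ((1 - bernoulli (l + 1)) / real (l + 1))" .
  have nz: "of_nat l + 1 \<noteq> (0::complex)" by (metis of_nat_Suc of_nat_eq_0_iff nat.simps(3) add.commute)
  have "- of_nat l \<noteq> (1::complex)" using nz by (metis add.commute add.right_inverse)
  then have "riemann_zeta (- of_nat l) = 1 / (- of_nat l - 1) + zeta_reg (- of_nat l)"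
    by (rule riemann_zeta_eq)
  also have "1 / (- of_nat l - 1) = - 1 / (of_nat l + 1 :: complex)"
    by (metis minus_add_distrib uminus_add_conv_diff diff_minus_eq_add minus_divide_right minus_divide_left add.commute minus_diff_eq)
  also have "zeta_reg (- of_nat l) = (1 - of_real (bernoulli (l + 1))) / (of_nat l + 1)"
    unfolding zeta_reg by (simp add: add_ac)
  finally show ?thesis by (simp add: diff_divide_distrib add_ac)
qed

text \<open>The generating series satisfies B(X) - B(-X) = X, so it has no odd coefficients beyond
  degree 1.\<close>

lemma bernoulli_odd_eq_0:
  assumes "odd n" "n \<ge> 2"
  shows "bernoulli n = 0"
proof -
  define B where "B = Abs_fps (\<lambda>n. bernoulli n / fact n)"
  define B' where "B' = B oo (- fps_X)"
  have B: "B * (fps_exp 1 - 1) = fps_X * fps_exp 1" unfolding B_def by (rule bernoulli_fps)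
  then have "(B * (fps_exp 1 - 1)) oo (- fps_X) = (fps_X * fps_exp 1) oo (- fps_X)" by simp
  then have "B' * (fps_exp (-1) - 1) = - fps_X * fps_exp (-1)"
    by (simp add: fps_compose_mult_distrib fps_compose_sub_distrib B'_def)
  then have "B' * (fps_exp (-1) - 1) * fps_exp 1 = - fps_X * fps_exp (-1) * fps_exp 1" by simp
  moreover have e: "fps_exp (-1) * fps_exp 1 = (1 :: real fps)"
    using fps_exp_add_mult[of "-1" "1::real"] by simp
  ultimately have "B' * (fps_exp 1 - 1) = fps_X"
    by (simp add: algebra_simps)
  with B have "(B - B') * (fps_exp 1 - 1) = fps_X * (fps_exp 1 - 1)"
    by (simp add: algebra_simps)
  then have "B - B' = fps_X" using fps_exp_neq_1 by (metis mult_right_cancel)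
  then have "fps_nth (B - B') n = fps_nth fps_X n" by simp
  then have "fps_nth B n - fps_nth B' n = 0" using assms by (simp add: fps_X_def)
  then show ?thesis using assms by (simp add: B_def B'_def fps_compose_uminus')
qed

text \<open>The series \<open>c = X coth (X/2)\<close>, which generates twice the even Bernoulli numbers, satisfies
  \<open>2 X c' = 2 c - c\<^sup>2 + X\<^sup>2\<close>; comparing coefficients shows that their signs alternate.\<close>

lemma bernoulli_even_neq_0:
  assumes "even n" "n \<ge> 2"
  shows "bernoulli n \<noteq> 0"
proof -
  define B where "B = Abs_fps (\<lambda>n. bernoulli n / fact n)"
  define E where "E = (fps_exp 1 :: real fps)"
  define c where "c = 2 * B - fps_X"
  have B: "B * (E - 1) = fps_X * E" unfolding B_def E_def by (rule bernoulli_fps)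
  have "c * (E - 1) = 2 * (B * (E - 1)) - fps_X * (E - 1)" by (simp add: c_def algebra_simps)
  then have c1: "c * (E - 1) = fps_X * (E + 1)" unfolding B by (simp add: algebra_simps)
  have "fps_deriv (c * (E - 1)) = fps_deriv (fps_X * (E + 1))" using c1 by simp
  then have c2: "fps_deriv c * (E - 1) = E + 1 + fps_X * E - c * E"
    by (simp add: E_def algebra_simps)
  have "2 * fps_X * fps_deriv c * (E - 1) ^ 2 = 2 * fps_X * (E - 1) * (fps_deriv c * (E - 1))"
    by (simp add: power2_eq_square algebra_simps)
  also have "\<dots> = 2 * fps_X * ((E - 1) * (E + 1 + fps_X * E)) - 2 * fps_X * E * (c * (E - 1))"
    unfolding c2 by (simp add: algebra_simps)
  also have "\<dots> = 2 * fps_X * ((E - 1) * (E + 1 + fps_X * E)) - 2 * fps_X * E * (fps_X * (E + 1))"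
    unfolding c1 ..
  also have "\<dots> = 2 * (fps_X * (E + 1)) * (E - 1) - (fps_X * (E + 1)) ^ 2 + fps_X ^ 2 * (E - 1) ^ 2"
    by (simp add: power2_eq_square algebra_simps)
  also have "\<dots> = 2 * (c * (E - 1)) * (E - 1) - (c * (E - 1)) ^ 2 + fps_X ^ 2 * (E - 1) ^ 2"
    unfolding c1 ..
  also have "\<dots> = (2 * c - c ^ 2 + fps_X ^ 2) * (E - 1) ^ 2"
    by (simp add: power2_eq_square algebra_simps)
  finally have "2 * fps_X * fps_deriv c = 2 * c - c ^ 2 + fps_X ^ 2"
    using fps_exp_neq_1[where 'a=real] unfolding E_def by (metis mult_right_cancel power_not_zero)
  then have ode: "fps_nth (2 * fps_X * fps_deriv c) k = fps_nth (2 * c - c ^ 2 + fps_X ^ 2) k" for k by simp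
  define d where "d k = fps_nth c k" for k
  have c0: "d 0 = 2"
  proof -
    have "fps_nth (c * (E - 1)) 1 = fps_nth (fps_X * (E + 1)) 1" using c1 by simp
    then show ?thesis by (simp add: fps_mult_nth E_def d_def)
  qed
  have two: "fps_nth (2 * f) k = 2 * fps_nth f k" for f :: "real fps" and k
    by (simp add: numeral_fps_const)
  \<comment> \<open>Since \<open>d 0 = 2\<close>, the two outer terms of the square contribute
    \<open>4 * d k\<close>; moving them to the left turns the coefficient 2k - 2 into 2k +
    2.\<close>
  have rec: "(2 * real k + 2) * d k = - (\<Sum>i\<in>{0<..<k}. d i * d (k - i)) + (if k = 2 then 1 else 0)"
    if k: "k \<ge> 1" for k
  proof -
    have "fps_nth (2 * fps_X * fps_deriv c) k = 2 * real k * d k"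
      using k by (simp add: d_def two mult.assoc)
    moreover have "fps_nth (2 * c - c ^ 2 + fps_X ^ 2) k =
        2 * d k - (\<Sum>i=0..k. d i * d (k - i)) + (if k = 2 then 1 else 0)"
      unfolding power2_eq_square[of c] by (simp add: two fps_mult_nth[of c c] d_def fps_X_power_nth)
    moreover have "(\<Sum>i=0..k. d i * d (k - i)) = 4 * d k + (\<Sum>i\<in>{0<..<k}. d i * d (k - i))"
    proof -
      have "{0..k} = insert 0 (insert k {0<..<k})" using k by auto
      then show ?thesis using k by (simp add: c0)
    qed
    ultimately show ?thesis using ode[of k] by (simp add: algebra_simps)
  qed
  have "{0<..<Suc 0} = {}" by auto
  then have d1: "d 1 = 0" using rec[of 1] by simp
  have odd0: "d k = 0" if "odd k" for k
  proof (cases "k = 1")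
    case False
    then have "k \<ge> 2" using that by (cases k) auto
    then show ?thesis using bernoulli_odd_eq_0[OF that] that
      by (simp add: d_def c_def two B_def fps_X_def)
  qed (use d1 in simp)
  \<comment> \<open>In a product \<open>d (2 * k) * d (2 * (j - k))\<close> the signs multiply to
    (-1)^j for every k, so nothing cancels in the recurrence. The induction starts from the X^2 of
    the differential equation, which gives 6 d(2) = 1.\<close>
  have pos: "(-1) ^ (j + 1) * d (2 * j) > 0" if "j \<ge> 1" for j
    using that
  proof (induction j rule: less_induct)
    case (less j)
    show ?case
    proof (cases "j = 1")
      case True
      have "{0<..<2::nat} = {1}" by auto
      then show ?thesis using rec[of 2] d1 True by simp
    next
      case False
      then have j: "j \<ge> 2" using less.prems by simp
      have pos_term: "(-1) ^ j * (d (2 * k) * d (2 * j - 2 * k)) > 0" if "0 < k" "k < j" for k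
      proof -
        have "(-1) ^ (k + 1) * d (2 * k) > 0" "(-1) ^ (j - k + 1) * d (2 * (j - k)) > 0"
          using that by (intro less.IH; simp)+
        then have "((-1) ^ (k + 1) * d (2 * k)) * ((-1) ^ (j - k + 1) * d (2 * (j - k))) > 0"
          by (rule mult_pos_pos)
        also have "((-1) ^ (k + 1) * d (2 * k)) * ((-1) ^ (j - k + 1) * d (2 * (j - k))) =
            (-1) ^ (k + (j - k)) * (d (2 * k) * d (2 * (j - k)))"
          by (simp add: power_add mult_ac)
        finally show ?thesis using that by (simp add: right_diff_distrib')
      qed
      have nn: "(-1) ^ j * (d i * d (2 * j - i)) \<ge> 0" if "i \<in> {0<..<2 * j}" for i
      proof (cases "even i")
        case True
        then obtain k where "i = 2 * k" by blast
        then show ?thesis using pos_term[of k] that by simp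
      qed (simp add: odd0)
      have sum_pos: "(\<Sum>i\<in>{0<..<2 * j}. (-1) ^ j * (d i * d (2 * j - i))) > 0"
        using j nn pos_term[of 1] by (intro sum_pos2[of _ 2]) auto
      have "(2 * real (2 * j) + 2) * ((-1) ^ (j + 1) * d (2 * j)) =
          (-1) ^ (j + 1) * ((2 * real (2 * j) + 2) * d (2 * j))"
        by (rule mult.left_commute)
      moreover have "(2 * real (2 * j) + 2) * d (2 * j) = - (\<Sum>i\<in>{0<..<2 * j}. d i * d (2 * j - i))"
        using rec[of "2 * j"] j by simp
      ultimately have "(2 * real (2 * j) + 2) * ((-1) ^ (j + 1) * d (2 * j)) =
          (-1) ^ j * (\<Sum>i\<in>{0<..<2 * j}. d i * d (2 * j - i))"
        by (simp only: power_add power_one_right mult_minus1_right minus_mult_minus)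
      moreover note sum_distrib_left[of "(-1) ^ j" "\<lambda>i. d i * d (2 * j - i)" "{0<..<2 * j}"]
      ultimately have "(2 * real (2 * j) + 2) * ((-1) ^ (j + 1) * d (2 * j)) > 0"
        using sum_pos by simp
      then show ?thesis by (rule zero_less_mult_pos) simp
    qed
  qed
  obtain j where j: "n = 2 * j" using assms by blast
  then have "d n \<noteq> 0" using pos[of j] assms by auto
  then show ?thesis using assms by (auto simp: d_def c_def two B_def fps_X_def)
qed

section \<open>The expansion of the polylogarithm\<close>

definition Li :: "complex \<Rightarrow> real \<Rightarrow> complex" where
  "Li s t = (\<integral>n. of_nat (Suc n) powr (- s) * of_real (exp (- (real (Suc n) * t))) \<partial>count_space UNIV)"

lemma integrable_Li:
  assumes "Re s \<ge> 0" "t > 0"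
  shows "integrable (count_space UNIV) (\<lambda>n. of_nat (Suc n) powr (- s) * complex_of_real (exp (- (real (Suc n) * t))))"
proof (rule Bochner_Integration.integrable_bound[OF exp_geometric_sums(1)[OF assms(2)]])
  have "real (Suc n) powr - Re s \<le> 1" for n
    using assms(1) by (simp add: powr_minus inverse_le_1_iff ge_one_powr_ge_zero)
  then show "AE n in count_space UNIV. norm (of_nat (Suc n) powr (- s) * complex_of_real (exp (- (real (Suc n) * t))))
      \<le> norm (complex_of_real (exp (- (real (Suc n) * t))))"
    by (intro AE_I2) (simp add: norm_mult norm_Suc_powr mult_le_cancel_right1 del: of_nat_Suc)
qed simp

lemma Li_mellin:
  assumes s: "Re s > 0" and t: "t > 0"
  shows "integrable halfline (\<lambda>x. of_real x powr (s - 1) * (1 / (exp (of_real (x + t)) - 1)))"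
    and "(\<integral>x. of_real x powr (s - 1) * (1 / (exp (of_real (x + t)) - 1)) \<partial>halfline) = Gamma s * Li s t"
proof -
  let ?N = "count_space (UNIV :: nat set)"
  let ?c = "\<lambda>n. complex_of_real (exp (- (real (Suc n) * t)))"
  have int: "integrable ?N (\<lambda>n. norm (?c n) * real (Suc n) powr (- Re s))"
    using integrable_norm[OF integrable_Li[of s t]] s t
    by (simp add: norm_mult norm_Suc_powr mult.commute del: of_nat_Suc)
  have geo: "(\<integral>n. ?c n * complex_of_real (exp (- (real (Suc n) * x))) \<partial>?N) = 1 / (exp (of_real (x + t)) - 1)"
    if "x \<in> space halfline" for x
  proof -
    have "?c n * complex_of_real (exp (- (real (Suc n) * x))) = complex_of_real (exp (- (real (Suc n) * (x + t))))" for n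
      unfolding of_real_mult[symmetric] exp_add[symmetric] by (simp add: algebra_simps)
    then show ?thesis using exp_geometric_sums(2)[of "x + t"] that t by simp
  qed
  have "integrable halfline (\<lambda>x. of_real x powr (s - 1) * (\<integral>n. ?c n * complex_of_real (exp (- (real (Suc n) * x))) \<partial>?N))"
    using s by (intro integrable_mellin int sigma_finite_measure_count_space) auto
  then show "integrable halfline (\<lambda>x. of_real x powr (s - 1) * (1 / (exp (of_real (x + t)) - 1)))"
    by (rule Bochner_Integration.integrable_cong[THEN iffD1, OF refl, rotated]) (simp only: geo)
  have "(\<integral>x. of_real x powr (s - 1) * (1 / (exp (of_real (x + t)) - 1)) \<partial>halfline) =
      (\<integral>x. of_real x powr (s - 1) * (\<integral>n. ?c n * complex_of_real (exp (- (real (Suc n) * x))) \<partial>?N) \<partial>halfline)"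
    by (intro Bochner_Integration.integral_cong refl) (simp only: geo)
  also have "\<dots> = Gamma s * (\<integral>n. ?c n * of_real (real (Suc n)) powr (- s) \<partial>?N)"
    using s by (intro integral_mellin int sigma_finite_measure_count_space) auto
  finally show "(\<integral>x. of_real x powr (s - 1) * (1 / (exp (of_real (x + t)) - 1)) \<partial>halfline) = Gamma s * Li s t"
    by (simp add: Li_def mult.commute)
qed

lemma has_bochner_integral_ray:
  assumes "y > 0"
  shows "has_bochner_integral halfline (\<lambda>v. complex_of_real (indicator {1..} v * exp (- (v * y)))) (of_real (exp (- y) / y))"
proof -
  have "has_bochner_integral halfline (\<lambda>t. t powr (1 - 1) * exp (- (y * t))) (Gamma 1 * y powr (- 1))"
    by (rule has_bochner_integral_Gamma_real[OF assms]) simp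
  then have "has_bochner_integral lborel (\<lambda>t. indicator {0<..} t *\<^sub>R (t powr 0 * exp (- (y * t)))) (1 / y)"
    using assms unfolding halfline_def has_bochner_integral_iff
    by (simp add: integrable_restrict_space integral_restrict_space powr_minus divide_inverse)
  then have "has_bochner_integral lborel (\<lambda>t. indicator {0<..} (-1 + 1 * t) *\<^sub>R ((-1 + 1 * t) powr 0 * exp (- (y * (-1 + 1 * t))))) ((1 / y) /\<^sub>R \<bar>1\<bar>)"
    by (subst lborel_has_bochner_integral_real_affine_iff[symmetric]) auto
  then have "has_bochner_integral lborel (\<lambda>t. exp (- y) * (indicator {0<..} (-1 + 1 * t) *\<^sub>R ((-1 + 1 * t) powr 0 * exp (- (y * (-1 + 1 * t)))))) (exp (- y) * ((1 / y) /\<^sub>R \<bar>1\<bar>))"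
    by (rule has_bochner_integral_mult_right)
  moreover have "exp (- y) * (indicator {0<..} (-1 + 1 * t) *\<^sub>R ((-1 + 1 * t) powr 0 * exp (- (y * (-1 + 1 * t))))) =
      indicator {1<..} t * exp (- (t * y))" for t
    by (auto simp: indicator_def algebra_simps simp flip: exp_add)
  ultimately have "has_bochner_integral lborel (\<lambda>t. indicator {1<..} t * exp (- (t * y))) (exp (- y) / y)"
    by simp
  \<comment> \<open>The translated half-line is open at 1, the statement has it closed; the
    difference is the null set {1}.\<close>
  moreover have "AE t in lborel. indicator {1<..} t * exp (- (t * y)) = indicator {0<..} t *\<^sub>R (indicator {1..} t * exp (- (t * y)))"
    using AE_lborel_singleton[of 1] by eventually_elim (auto simp: indicator_def)
  ultimately have "has_bochner_integral lborel (\<lambda>t. indicator {0<..} t *\<^sub>R (indicator {1..} t * exp (- (t * y)))) (exp (- y) / y)"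
    by (subst (asm) has_bochner_integral_cong_AE) auto
  then have "has_bochner_integral halfline (\<lambda>t. indicator {1..} t * exp (- (t * y))) (exp (- y) / y)"
    unfolding halfline_def has_bochner_integral_iff
    by (simp add: integrable_restrict_space integral_restrict_space)
  then show ?thesis by (rule has_bochner_integral_of_real)
qed

lemma measurable_halfline_borel: "f \<in> borel_measurable borel \<Longrightarrow> f \<in> borel_measurable halfline"
  using measurable_compose[OF measurable_halfline_ident] by blast

text \<open>Treats the subtracted part of the kernel: e^-(x+t)/(x + t) is the integral of
  e^(-v(x+t)) over v >= 1, so the Mellin transform in x is found by exchanging two integrals, with
  \<open>halfline\<close> as index measure. What remains is an incomplete gamma integral.\<close>

lemma ray_mellin:
  assumes s: "Re s > 0" "Re s < 1" and t: "t > 0"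
  shows "integrable halfline (\<lambda>x. of_real x powr (s - 1) * of_real (exp (- (x + t)) / (x + t)))"
    and "(\<integral>x. of_real x powr (s - 1) * of_real (exp (- (x + t)) / (x + t)) \<partial>halfline) =
      Gamma s * (\<integral>v. of_real v powr (- s) * of_real (indicator {1..} v * exp (- (v * t))) \<partial>halfline)"
proof -
  let ?c = "\<lambda>v. complex_of_real (indicator {1..} v * exp (- (v * t)))"
  have "has_bochner_integral halfline (\<lambda>v. v powr (1 - Re s - 1) * exp (- (t * v))) (Gamma (1 - Re s) * t powr (- (1 - Re s)))"
    using s t by (intro has_bochner_integral_Gamma_real) auto
  then have i: "integrable halfline (\<lambda>v. v powr (- Re s) * exp (- (t * v)))"
    by (simp add: has_bochner_integral_iff)
  have cm [measurable]: "?c \<in> borel_measurable halfline"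
    by (rule measurable_halfline_borel) measurable
  have int: "integrable halfline (\<lambda>v. norm (?c v) * v powr (- Re s))"
    by (rule Bochner_Integration.integrable_bound[OF i]) (auto intro!: AE_I2 simp: indicator_def mult.commute)
  have inner: "(\<integral>v. ?c v * complex_of_real (exp (- (v * x))) \<partial>halfline) = of_real (exp (- (x + t)) / (x + t))"
    if "x \<in> space halfline" for x
  proof -
    have eq: "?c v * complex_of_real (exp (- (v * x))) = complex_of_real (indicator {1..} v * exp (- (v * (x + t))))" for v
      unfolding of_real_mult[symmetric] mult.assoc exp_add[symmetric] by (simp add: algebra_simps)
    show ?thesis
      unfolding eq by (rule has_bochner_integral_integral_eq[OF has_bochner_integral_ray]) (use that t in simp)
  qed
  have "integrable halfline (\<lambda>x. of_real x powr (s - 1) * (\<integral>v. ?c v * complex_of_real (exp (- (v * x))) \<partial>halfline))"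
    using s by (intro integrable_mellin int sigma_finite_halfline cm measurable_halfline_ident) auto
  then show "integrable halfline (\<lambda>x. of_real x powr (s - 1) * of_real (exp (- (x + t)) / (x + t)))"
    by (rule Bochner_Integration.integrable_cong[THEN iffD1, OF refl, rotated]) (simp only: inner)
  have "(\<integral>x. of_real x powr (s - 1) * of_real (exp (- (x + t)) / (x + t)) \<partial>halfline) =
      (\<integral>x. of_real x powr (s - 1) * (\<integral>v. ?c v * complex_of_real (exp (- (v * x))) \<partial>halfline) \<partial>halfline)"
    by (intro Bochner_Integration.integral_cong refl) (simp only: inner)
  also have "\<dots> = Gamma s * (\<integral>v. ?c v * of_real v powr (- s) \<partial>halfline)"
    using s by (intro integral_mellin int sigma_finite_halfline cm measurable_halfline_ident) auto
  finally show "(\<integral>x. of_real x powr (s - 1) * of_real (exp (- (x + t)) / (x + t)) \<partial>halfline) =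
      Gamma s * (\<integral>v. of_real v powr (- s) * ?c v \<partial>halfline)"
    by (simp only: mult.commute)
qed

lemma unit_powr_integral:
  assumes w: "Re w > 0"
  shows "has_bochner_integral halfline (\<lambda>v. of_real v powr (w - 1) * of_real (indicator {..<1} v)) (1 / w)"
proof -
  have [measurable]: "(\<lambda>v::real. complex_of_real (indicator {..<1} v)) \<in> borel_measurable halfline"
    by (rule measurable_halfline_borel) measurable
  \<comment> \<open>The majorant is a gamma integrand; the factor \<open>exp 1\<close> makes up for
    \<open>exp (- v)\<close>, since \<open>exp (1 - v) \<ge> 1\<close> for
    \<open>v < 1\<close>.\<close>
  have "has_bochner_integral halfline (\<lambda>v. exp 1 * (v powr (Re w - 1) * exp (- (1 * v)))) (exp 1 * (Gamma (Re w) * 1 powr (- Re w)))"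
    using w by (intro has_bochner_integral_mult_right has_bochner_integral_Gamma_real) auto
  then have i: "integrable halfline (\<lambda>v. exp 1 * (v powr (Re w - 1) * exp (- v)))"
    by (simp add: has_bochner_integral_iff)
  have int: "integrable halfline (\<lambda>v. of_real v powr (w - 1) * of_real (indicator {..<1} v))"
  proof (rule Bochner_Integration.integrable_bound[OF i])
    have "v powr (Re w - 1) \<le> exp 1 * (v powr (Re w - 1) * exp (- v))" if "v < 1" for v
    proof -
      have "1 \<le> exp (1 - v)" using that by simp
      then have "v powr (Re w - 1) * 1 \<le> v powr (Re w - 1) * exp (1 - v)" by (intro mult_left_mono) auto
      then show ?thesis by (simp add: exp_diff exp_minus divide_inverse mult_ac)
    qed
    note le = this
    show "AE v in halfline. norm (complex_of_real v powr (w - 1) * of_real (indicator {..<1} v))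
        \<le> norm (exp 1 * (v powr (Re w - 1) * exp (- v)))"
    proof (rule AE_I2)
      fix v assume v: "v \<in> space halfline"
      show "norm (complex_of_real v powr (w - 1) * of_real (indicator {..<1} v))
        \<le> norm (exp 1 * (v powr (Re w - 1) * exp (- v)))"
      proof (cases "v < 1")
        case True
        then have "norm (complex_of_real v powr (w - 1) * of_real (indicator {..<1} v)) = v powr (Re w - 1)"
          using v by (simp add: norm_mult norm_of_real_powr)
        also have "\<dots> \<le> \<bar>exp 1 * (v powr (Re w - 1) * exp (- v))\<bar>"
          using le[OF True] by (rule order_trans[OF _ abs_ge_self])
        finally show ?thesis by (simp only: real_norm_def)
      qed simp
    qed
  qed measurable
  have ind: "indicator {0<..} v *\<^sub>R (of_real v powr (w - 1) * of_real (indicator {..<1} v)) =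
      indicator {0<..<1} v *\<^sub>R (complex_of_real v powr (w - 1))" for v :: real
    by (auto simp: indicator_def)
  have int': "set_integrable lborel {0<..<1} (\<lambda>v. complex_of_real v powr (w - 1))"
    using int unfolding integrable_halfline_iff set_integrable_def ind .
  have "(LBINT v=0..1. complex_of_real v powr (w - 1)) = of_real 1 powr w / w - 0"
  proof (rule interval_integral_FTC_integrable)
    fix x :: real assume "0 < ereal x" "ereal x < 1"
    then have x: "x > 0" by simp
    have "w \<noteq> 0" using w by auto
    then show "((\<lambda>x. of_real x powr w / w) has_vector_derivative of_real x powr (w - 1)) (at x)"
      using x by (intro has_vector_derivative_real_field) (auto intro!: derivative_eq_intros)
    show "isCont (\<lambda>v. complex_of_real v powr (w - 1)) x"
      using x by (intro continuous_intros) (auto simp: complex_nonpos_Reals_iff)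
  next
    show "set_integrable lborel (einterval 0 1) (\<lambda>v. complex_of_real v powr (w - 1))"
      using int' by (simp add: zero_ereal_def one_ereal_def)
    have "((\<lambda>x. x powr Re w) \<longlongrightarrow> 0) (at_right 0)" using w by real_asymp
    then have "((\<lambda>x. complex_of_real x powr w) \<longlongrightarrow> 0) (at_right 0)"
      by (rule Lim_null_comparison[rotated])
         (auto intro!: eventually_mono[OF eventually_at_right_less] simp: norm_of_real_powr)
    then have "((\<lambda>x. complex_of_real x powr w / w) \<longlongrightarrow> 0) (at_right 0)"
      using tendsto_divide_zero by blast
    then show "(((\<lambda>x. of_real x powr w / w) \<circ> real_of_ereal) \<longlongrightarrow> 0) (at_right 0)"
      by (simp add: ereal_tendsto_simps1 zero_ereal_def)
    have "isCont (\<lambda>x. complex_of_real x powr w / w) 1"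
      by (cases "w = 0") (auto intro!: continuous_intros simp: complex_nonpos_Reals_iff)
    then have "((\<lambda>x. complex_of_real x powr w / w) \<longlongrightarrow> of_real 1 powr w / w) (at_left 1)"
      unfolding isCont_def by (rule tendsto_within_subset) auto
    then show "(((\<lambda>x. complex_of_real x powr w / w) \<circ> real_of_ereal) \<longlongrightarrow> of_real 1 powr w / w) (at_left 1)"
      by (simp add: ereal_tendsto_simps1 one_ereal_def)
  qed simp
  then have "(LBINT v:{0<..<1}. complex_of_real v powr (w - 1)) = 1 / w"
    by (simp add: interval_lebesgue_integral_def zero_ereal_def one_ereal_def)
  then have "(\<integral>v. of_real v powr (w - 1) * of_real (indicator {..<1} v) \<partial>halfline) = 1 / w"
    unfolding integral_halfline set_lebesgue_integral_def ind .
  with int show ?thesis by (simp add: has_bochner_integral_iff)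
qed

section \<open>Taylor remainders in t\<close>

definition exp_rem :: "nat \<Rightarrow> real \<Rightarrow> real" where
  "exp_rem K y = exp (- y) - (\<Sum>k<K. (- y) ^ k / fact k)"

lemma divide_fact_le: "0 \<le> (a::real) \<Longrightarrow> a / fact n \<le> a"
  using divide_left_mono[of 1 "fact n" a] fact_ge_1[of n, where 'a=real] by simp

lemma exp_rem_bound:
  assumes "y \<ge> 0"
  shows "\<bar>exp_rem (Suc n) y\<bar> \<le> y ^ Suc n"
proof -
  have "norm ((-1) ^ 0 * exp (- y) - (\<Sum>i\<le>n. (-1) ^ i * exp (- 0) * (y - 0) ^ i / fact i)) \<le> 1 * norm (y - 0) ^ Suc n / fact n"
  proof (rule field_Taylor[of "{0..}" n "\<lambda>i x. (-1) ^ i * exp (- x)" 1 0 y])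
    show "((\<lambda>x::real. (-1) ^ i * exp (- x)) has_field_derivative (-1) ^ Suc i * exp (- x)) (at x within {0..})" for i x
      by (auto intro!: derivative_eq_intros)
  qed (use assms in \<open>auto simp: abs_mult\<close>)
  also have "(\<Sum>i\<le>n. (-1) ^ i * exp (- 0) * (y - 0) ^ i / fact i) = (\<Sum>k<Suc n. (- y) ^ k / fact k)"
    unfolding lessThan_Suc_atMost by (intro sum.cong refl) (simp flip: power_mult_distrib)
  also have "1 * norm (y - 0) ^ Suc n / fact n \<le> y ^ Suc n"
    using divide_fact_le[of "y ^ Suc n" n] assms by simp
  finally show ?thesis unfolding exp_rem_def by simp
qed

definition kern_rem :: "nat \<Rightarrow> nat \<Rightarrow> real \<Rightarrow> real \<Rightarrow> complex" where
  "kern_rem N K x t = kern_deriv N (x + t) - (\<Sum>k<K. of_real (t ^ k / fact k) * kern_deriv (N + k) x)"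

text \<open>Taylor's formula along the ray to the right of \<open>x\<close>, where the top
  derivative is at most \<open>C * exp (- x)\<close>; the remainder therefore keeps its decay in
  \<open>x\<close>, uniformly in \<open>t\<close>.\<close>

lemma kern_rem_bound:
  obtains C where "C \<ge> 0" "\<And>x t. x > 0 \<Longrightarrow> t \<ge> 0 \<Longrightarrow> norm (kern_rem N (Suc n) x t) \<le> C * t ^ Suc n * exp (- x)"
proof -
  obtain C where C: "C \<ge> 0" "\<And>x. x \<ge> 0 \<Longrightarrow> norm (kern_deriv (N + Suc n) x) \<le> C * exp (- x)"
    using kern_deriv_bound by blast
  have "norm (kern_rem N (Suc n) x t) \<le> C * t ^ Suc n * exp (- x)" if x: "x > 0" and t: "t \<ge> 0" for x t
  proof -
    define S where "S = complex_of_real ` {x..}"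
    have SI: "z \<in> strip" if "z \<in> S" for z using that by (auto simp: S_def)
    have "norm ((deriv ^^ (N + 0)) kern (of_real (x + t)) -
        (\<Sum>i\<le>n. (deriv ^^ (N + i)) kern (of_real x) * (of_real (x + t) - of_real x) ^ i / fact i))
        \<le> C * exp (- x) * norm (complex_of_real (x + t) - of_real x) ^ Suc n / fact n"
    proof (rule complex_Taylor[of S n "\<lambda>i. (deriv ^^ (N + i)) kern"])
      have "linear complex_of_real" by (intro bounded_linear.linear bounded_linear_of_real)
      then show "convex S" unfolding S_def by (intro convex_linear_image) auto
      show "((deriv ^^ (N + i)) kern has_field_derivative (deriv ^^ (N + Suc i)) kern z) (at z within S)"
        if "z \<in> S" for i z
        using has_field_derivative_kern[OF SI[OF that], of "N + i"] by (simp add: has_field_derivative_at_within)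
      show "norm ((deriv ^^ (N + Suc n)) kern z) \<le> C * exp (- x)" if z: "z \<in> S" for z
      proof -
        obtain y where y: "z = of_real y" "y \<ge> x" using z by (auto simp: S_def)
        have "norm ((deriv ^^ (N + Suc n)) kern z) \<le> C * exp (- y)"
          using C(2)[of y] y x by (simp add: kern_deriv_def max_absorb2)
        also have "\<dots> \<le> C * exp (- x)" using y C(1) by (intro mult_left_mono) auto
        finally show ?thesis .
      qed
    qed (use x t in \<open>auto simp: S_def simp del: of_real_add\<close>)
    also have "(\<Sum>i\<le>n. (deriv ^^ (N + i)) kern (of_real x) * (of_real (x + t) - of_real x) ^ i / fact i) =
        (\<Sum>k<Suc n. of_real (t ^ k / fact k) * kern_deriv (N + k) x)"
      unfolding lessThan_Suc_atMost using x by (intro sum.cong refl) (simp add: kern_deriv_def max_absorb2)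
    also have "(deriv ^^ (N + 0)) kern (of_real (x + t)) = kern_deriv N (x + t)"
      using x t by (simp add: kern_deriv_def max_absorb2)
    also have "C * exp (- x) * norm (complex_of_real (x + t) - of_real x) ^ Suc n / fact n =
        (C * t ^ Suc n * exp (- x)) / fact n"
      using t by simp
    also have "\<dots> \<le> C * t ^ Suc n * exp (- x)"
      using C(1) t by (intro divide_fact_le) simp
    finally show ?thesis unfolding kern_rem_def .
  qed
  then show ?thesis using that C(1) by blast
qed

lemma measurable_kern_rem [measurable]: "(\<lambda>(x, t). kern_rem N K x t) \<in> borel_measurable (borel \<Otimes>\<^sub>M borel)"
  unfolding kern_rem_def by measurable

text \<open>The part of the remainder coming from \<open>\<integral>\<^sub>1\<^sup>\<infinity> v\<^sup>-\<^sup>s e\<^sup>-\<^sup>v\<^sup>t dv\<close> is rewritten on \<open>[0, 1]\<close>: there it is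
  holomorphic for \<open>Re s < K + 1\<close>, whereas \<open>\<Gamma>(1 - s)\<close> and \<open>\<zeta>(s - k)\<close> have poles.\<close>

definition Li_rem :: "nat \<Rightarrow> nat \<Rightarrow> complex \<Rightarrow> real \<Rightarrow> complex" where
  "Li_rem N K s t = (-1) ^ N * rGamma (s + of_nat N) * mellin (\<lambda>x. kern_rem N K x t) (s + of_nat N)
     - mellin (\<lambda>v. of_real (indicator {..<1} v * exp_rem K (v * t))) (1 - s)"

lemma measurable_kern_rem1 [measurable]: "(\<lambda>x. kern_rem N K x t) \<in> borel_measurable halfline"
  by (rule measurable_halfline_borel) measurable

lemma measurable_exp_rem [measurable]: "exp_rem K \<in> borel_measurable borel"
  unfolding exp_rem_def by measurable

lemma measurable_exp_rem1 [measurable]: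
  "(\<lambda>v. complex_of_real (indicator {..<1} v * exp_rem K (v * t))) \<in> borel_measurable halfline"
  by (rule measurable_halfline_borel) measurable

text \<open>Expanding the kernel in \<open>t\<close> produces transforms of
  \<open>kern_deriv (N + k)\<close> at \<open>s + N = (s - k) + (N + k)\<close>, which is
  \<open>zeta_reg (s - k)\<close> written at level \<open>N + k\<close>. The number \<open>N\<close>
  of integrations by parts moves the domain to the left and is independent of the order
  \<open>Suc n\<close> of the expansion.\<close>

lemma kern_mellin_taylor:
  assumes s: "Re s + real N > 0" and t: "t \<ge> 0"
  shows "(-1) ^ N * kern_mellin N (s + of_nat N) t =
     (-1) ^ N * rGamma (s + of_nat N) * mellin (\<lambda>x. kern_rem N (Suc n) x t) (s + of_nat N) +
     (\<Sum>k<Suc n. of_real ((- t) ^ k / fact k) * zeta_reg (s - of_nat k))"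
proof -
  let ?z = "s + of_nat N"
  have z: "Re ?z > 0" using s by simp
  obtain C where C: "C \<ge> 0" "\<And>x t. x > 0 \<Longrightarrow> t \<ge> 0 \<Longrightarrow> norm (kern_rem N (Suc n) x t) \<le> C * t ^ Suc n * exp (- x)"
    using kern_rem_bound by blast
  have ir: "integrable halfline (\<lambda>x. of_real x powr (?z - 1) * kern_rem N (Suc n) x t)"
    by (intro mellin_integrable integrable_exp_decay(1)[of _ "C * t ^ Suc n"] measurable_kern_rem1 C(2) z t)
  have ik: "integrable halfline (\<lambda>x. of_real x powr (?z - 1) * kern_deriv (N + k) x)" for k
    using integrable_kern_deriv[OF z, of 0 "N + k"] by simp
  have zeta_reg: "zeta_reg (s - of_nat k) = (-1) ^ (N + k) * (rGamma ?z * mellin (kern_deriv (N + k)) ?z)" for k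
    using zeta_reg_eq[of "s - of_nat k" "N + k"] s by (simp add: kern_mellin_def)
  have sum_eq: "(\<Sum>k<Suc n. of_real (t ^ k / fact k) * (a * kern_deriv (N + k) x)) = a * (\<Sum>k<Suc n. of_real (t ^ k / fact k) * kern_deriv (N + k) x)"
    for a x by (simp only: sum_distrib_left mult.left_commute)
  have pt: "a * kern_deriv N (x + t) = a * kern_rem N (Suc n) x t + (\<Sum>k<Suc n. of_real (t ^ k / fact k) * (a * kern_deriv (N + k) x))" for a x
    unfolding sum_eq kern_rem_def by (simp only: right_diff_distrib diff_add_cancel)
  have "mellin (\<lambda>x. kern_deriv N (x + t)) ?z =
      (\<integral>x. of_real x powr (?z - 1) * kern_rem N (Suc n) x t +
         (\<Sum>k<Suc n. of_real (t ^ k / fact k) * (of_real x powr (?z - 1) * kern_deriv (N + k) x)) \<partial>halfline)"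
    unfolding mellin_def by (intro Bochner_Integration.integral_cong refl pt)
  also have "\<dots> = mellin (\<lambda>x. kern_rem N (Suc n) x t) ?z + (\<Sum>k<Suc n. of_real (t ^ k / fact k) * mellin (kern_deriv (N + k)) ?z)"
    using ir ik unfolding mellin_def
    by (subst Bochner_Integration.integral_add) (auto simp del: sum.lessThan_Suc)
  finally have "(-1) ^ N * kern_mellin N ?z t = (-1) ^ N * rGamma ?z * mellin (\<lambda>x. kern_rem N (Suc n) x t) ?z +
      (\<Sum>k<Suc n. (-1) ^ N * rGamma ?z * (of_real (t ^ k / fact k) * mellin (kern_deriv (N + k)) ?z))"
    unfolding kern_mellin_def by (simp add: algebra_simps sum_distrib_left del: sum.lessThan_Suc)
  also have "(\<Sum>k<Suc n. (-1) ^ N * rGamma ?z * (of_real (t ^ k / fact k) * mellin (kern_deriv (N + k)) ?z)) =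
      (\<Sum>k<Suc n. of_real ((- t) ^ k / fact k) * zeta_reg (s - of_nat k))"
  proof (intro sum.cong refl)
    fix k
    have t: "of_real ((- t) ^ k / fact k) = (-1) ^ k * complex_of_real (t ^ k / fact k)"
      by (simp add: power_minus[of t])
    have "(-1) ^ (N + k) = (-1) ^ k * (-1::complex) ^ N" by (simp add: power_add mult.commute)
    then have "(-1) ^ k * ((-1) ^ (N + k) * q) = (-1) ^ N * q" for q :: complex
      by (simp only: mult.assoc left_minus_one_mult_self)
    then have "of_real ((- t) ^ k / fact k) * zeta_reg (s - of_nat k) =
        of_real (t ^ k / fact k) * ((-1) ^ N * (rGamma ?z * mellin (kern_deriv (N + k)) ?z))"
      unfolding zeta_reg t by (subst mult.assoc, subst mult.left_commute) (simp only:)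
    then show "(-1) ^ N * rGamma ?z * (of_real (t ^ k / fact k) * mellin (kern_deriv (N + k)) ?z) =
        of_real ((- t) ^ k / fact k) * zeta_reg (s - of_nat k)"
      by (simp only: mult_ac)
  qed
  finally show ?thesis .
qed

text \<open>The moments 1/(k + 1 - s) of v^(-s) on [0, 1] are the polar parts by which zeta(s - k)
  differs from \<open>zeta_reg (s - k)\<close>.\<close>

lemma unit_taylor:
  assumes s: "Re s < 1" and t: "t > 0"
  shows "mellin (\<lambda>v. of_real (indicator {..<1} v * exp (- (v * t)))) (1 - s) =
     mellin (\<lambda>v. of_real (indicator {..<1} v * exp_rem (Suc n) (v * t))) (1 - s) +
     (\<Sum>k<Suc n. of_real ((- t) ^ k / fact k) * (1 / (of_nat k + 1 - s)))"
    and "integrable halfline (\<lambda>v. of_real v powr (- s) * of_real (indicator {..<1} v * exp (- (v * t))))"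
proof -
  have u: "has_bochner_integral halfline (\<lambda>v. of_real v powr (- s) * of_real (v ^ k * indicator {..<1} v)) (1 / (of_nat k + 1 - s))" for k
  proof (rule has_bochner_integral_transform[OF unit_powr_integral[of "of_nat k + 1 - s"]])
    fix v :: real assume "v \<in> space halfline"
    then have "complex_of_real v powr of_nat k = of_real v ^ k" by (simp add: powr_nat')
    moreover have "of_nat k + 1 - s - 1 = - s + of_nat k" by simp
    ultimately have "complex_of_real v powr (of_nat k + 1 - s - 1) = of_real v powr (- s) * of_real v ^ k"
      by (simp only: powr_add)
    then show "of_real v powr (of_nat k + 1 - s - 1) * of_real (indicator {..<1} v) =
        of_real v powr (- s) * complex_of_real (v ^ k * indicator {..<1} v)"
      by (simp add: mult_ac)
  qed (use s in auto)
  let ?r = "\<lambda>v. complex_of_real (indicator {..<1} v * exp_rem (Suc n) (v * t))"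
  let ?e = "\<lambda>v. complex_of_real (indicator {..<1} v * exp (- (v * t)))"
  have [measurable]: "?e \<in> borel_measurable halfline"
    by (rule measurable_halfline_borel) measurable
  have u0: "integrable halfline (\<lambda>v. complex_of_real v powr (- s) * of_real (indicator {..<1} v))"
    using u[of 0] by (simp add: has_bochner_integral_iff)
  show ie: "integrable halfline (\<lambda>v. of_real v powr (- s) * ?e v)"
    by (rule Bochner_Integration.integrable_bound[OF u0])
       (use t in \<open>auto intro!: AE_I2 mult_left_mono simp: norm_mult indicator_def\<close>)
  have split: "of_real v powr (- s) * ?e v = of_real v powr (- s) * ?r v +
     (\<Sum>k<Suc n. of_real ((- t) ^ k / fact k) * (of_real v powr (- s) * of_real (v ^ k * indicator {..<1} v)))" for v
  proof -
    have "(\<Sum>k<Suc n. of_real ((- t) ^ k / fact k) * (of_real v powr (- s) * of_real (v ^ k * indicator {..<1} v))) =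
        of_real v powr (- s) * complex_of_real (indicator {..<1} v * (\<Sum>k<Suc n. (- (v * t)) ^ k / fact k))"
      unfolding sum_distrib_left of_real_sum
    proof (intro sum.cong refl)
      fix k
      have "- (v * t) = (- t) * v" by simp
      then have pw: "(- (v * t)) ^ k = (- t) ^ k * v ^ k" by (simp only: power_mult_distrib)
      have alg: "of_real (A / f) * (p * of_real (w * i)) = p * complex_of_real (i * (A * w / f))" for A f w i :: real and p
        by simp
      show "of_real ((- t) ^ k / fact k) * (of_real v powr (- s) * of_real (v ^ k * indicator {..<1} v)) =
          of_real v powr (- s) * complex_of_real (indicator {..<1} v * ((- (v * t)) ^ k / fact k))"
        unfolding pw by (rule alg)
    qed
    then show ?thesis
      unfolding exp_rem_def by (simp only: right_diff_distrib of_real_diff diff_add_cancel)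
  qed
  have isum: "integrable halfline (\<lambda>v. \<Sum>k<Suc n. of_real ((- t) ^ k / fact k) *
      (complex_of_real v powr (- s) * of_real (v ^ k * indicator {..<1} v)))"
    using u by (intro Bochner_Integration.integrable_sum integrable_mult_right) (simp add: has_bochner_integral_iff)
  have "integrable halfline (\<lambda>v. of_real v powr (- s) * ?e v -
      (\<Sum>k<Suc n. of_real ((- t) ^ k / fact k) * (of_real v powr (- s) * of_real (v ^ k * indicator {..<1} v))))"
    by (intro Bochner_Integration.integrable_diff ie isum)
  then have ir: "integrable halfline (\<lambda>v. of_real v powr (- s) * ?r v)"
    unfolding split by (simp only: add_diff_cancel_right')
  have es: "1 - s - 1 = - s" by simp
  have "mellin ?e (1 - s) = (\<integral>v. of_real v powr (- s) * ?r v +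
     (\<Sum>k<Suc n. of_real ((- t) ^ k / fact k) * (of_real v powr (- s) * of_real (v ^ k * indicator {..<1} v))) \<partial>halfline)"
    unfolding mellin_def es by (intro Bochner_Integration.integral_cong refl split)
  also have "\<dots> = (\<integral>v. of_real v powr (- s) * ?r v \<partial>halfline) +
     (\<integral>v. (\<Sum>k<Suc n. of_real ((- t) ^ k / fact k) * (of_real v powr (- s) * of_real (v ^ k * indicator {..<1} v))) \<partial>halfline)"
    by (rule Bochner_Integration.integral_add[OF ir isum])
  also have "(\<integral>v. of_real v powr (- s) * ?r v \<partial>halfline) = mellin ?r (1 - s)"
    unfolding mellin_def by simp
  also have "(\<integral>v. (\<Sum>k<Suc n. of_real ((- t) ^ k / fact k) * (of_real v powr (- s) * of_real (v ^ k * indicator {..<1} v))) \<partial>halfline)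
     = (\<Sum>k<Suc n. \<integral>v. of_real ((- t) ^ k / fact k) * (of_real v powr (- s) * of_real (v ^ k * indicator {..<1} v)) \<partial>halfline)"
    using u by (intro Bochner_Integration.integral_sum integrable_mult_right) (simp add: has_bochner_integral_iff)
  also have "\<dots> = (\<Sum>k<Suc n. of_real ((- t) ^ k / fact k) * (1 / (of_nat k + 1 - s)))"
    using has_bochner_integral_integral_eq[OF u] by (intro sum.cong refl) (simp only: integral_mult_right_zero)
  finally show "mellin ?e (1 - s) = mellin ?r (1 - s) + (\<Sum>k<Suc n. of_real ((- t) ^ k / fact k) * (1 / (of_nat k + 1 - s)))" .
qed

text \<open>The ray integral is the full gamma integral, equal to Gamma(1 - s) t^(s-1), minus the
  integral over [0, 1]. The Taylor terms of the latter combine with those of the kernel transform to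
  complete \<open>zeta_reg (s - k)\<close> to zeta(s - k).\<close>

lemma Li_expansion:
  assumes s: "Re s > 0" "Re s < 1" and t: "t > 0"
  shows "Li s t = Gamma (1 - s) * of_real t powr (s - 1)
    + (\<Sum>k<Suc n. of_real ((- t) ^ k / fact k) * riemann_zeta (s - of_nat k)) + Li_rem N (Suc n) s t"
proof -
  let ?e = "\<lambda>v. complex_of_real (indicator {..<1} v * exp (- (v * t)))"
  let ?f = "\<lambda>v. complex_of_real (indicator {1..} v * exp (- (v * t)))"
  have kern_deriv: "kern_deriv 0 (x + t) = 1 / (exp (of_real (x + t)) - 1) - of_real (exp (- (x + t)) / (x + t))"
    if "x \<in> space halfline" for x
    using kern_deriv_0_eq[of "x + t"] that t by simp
  have "mellin (\<lambda>x. kern_deriv 0 (x + t)) s = (\<integral>x. of_real x powr (s - 1) * (1 / (exp (of_real (x + t)) - 1)) -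
      of_real x powr (s - 1) * of_real (exp (- (x + t)) / (x + t)) \<partial>halfline)"
    unfolding mellin_def
    by (intro Bochner_Integration.integral_cong refl) (simp only: kern_deriv right_diff_distrib)
  also have "\<dots> = Gamma s * Li s t - Gamma s * (\<integral>v. of_real v powr (- s) * ?f v \<partial>halfline)"
    using Li_mellin[of s t] ray_mellin[of s t] s t by (subst Bochner_Integration.integral_diff) auto
  finally have m: "mellin (\<lambda>x. kern_deriv 0 (x + t)) s = Gamma s * (Li s t - (\<integral>v. of_real v powr (- s) * ?f v \<partial>halfline))"
    by (simp add: algebra_simps)
  have "Gamma s \<noteq> 0" using not_nonpos_Int_Re[of s] s by (simp add: Gamma_eq_zero_iff)
  then have T0: "kern_mellin 0 s t = Li s t - (\<integral>v. of_real v powr (- s) * ?f v \<partial>halfline)"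
    unfolding kern_mellin_def m by (simp add: rGamma_inverse_Gamma flip: mult.assoc)
  have g: "has_bochner_integral halfline (\<lambda>v. of_real v powr (1 - s - 1) * of_real (exp (- (t * v)))) (Gamma (1 - s) * of_real t powr (- (1 - s)))"
    using s t by (intro has_bochner_integral_Gamma) auto
  have ie: "integrable halfline (\<lambda>v. of_real v powr (- s) * ?e v)"
    using unit_taylor(2) s t by blast
  have gi: "integrable halfline (\<lambda>v. complex_of_real v powr (- s) * of_real (exp (- (v * t))))"
    using g by (simp add: has_bochner_integral_iff mult.commute)
  have f_eq: "of_real v powr (- s) * ?f v = of_real v powr (- s) * of_real (exp (- (v * t))) - of_real v powr (- s) * ?e v" for v
    by (simp add: indicator_def)
  have "(\<integral>v. of_real v powr (- s) * ?f v \<partial>halfline) =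
     (\<integral>v. of_real v powr (- s) * of_real (exp (- (v * t))) \<partial>halfline) - (\<integral>v. of_real v powr (- s) * ?e v \<partial>halfline)"
    unfolding f_eq by (rule Bochner_Integration.integral_diff[OF gi ie])
  also have "(\<integral>v. of_real v powr (- s) * of_real (exp (- (v * t))) \<partial>halfline) = Gamma (1 - s) * of_real t powr (s - 1)"
    using has_bochner_integral_integral_eq[OF g] by (simp add: mult.commute)
  also have "(\<integral>v. of_real v powr (- s) * ?e v \<partial>halfline) = mellin ?e (1 - s)"
    by (simp add: mellin_def)
  finally have F: "(\<integral>v. of_real v powr (- s) * ?f v \<partial>halfline) = Gamma (1 - s) * of_real t powr (s - 1) - mellin ?e (1 - s)" .
  have "kern_mellin 0 s t = (-1) ^ N * kern_mellin N (s + of_nat N) t"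
    using kern_mellin_shift[of s t 0 N] s t by simp
  also have "\<dots> = (-1) ^ N * rGamma (s + of_nat N) * mellin (\<lambda>x. kern_rem N (Suc n) x t) (s + of_nat N) +
     (\<Sum>k<Suc n. of_real ((- t) ^ k / fact k) * zeta_reg (s - of_nat k))"
    using s t by (intro kern_mellin_taylor) auto
  finally have kern_mellin: "kern_mellin 0 s t = \<dots>" .
  have zeta: "riemann_zeta (s - of_nat k) = zeta_reg (s - of_nat k) - 1 / (of_nat k + 1 - s)" for k
  proof -
    have "Re (s - of_nat k) < 1" using s by simp
    then have "s - of_nat k \<noteq> 1" by (metis less_irrefl one_complex.sel(1))
    moreover have "1 / (s - of_nat k - 1) = - (1 / (of_nat k + 1 - s))"
      by (metis minus_diff_eq minus_divide_right diff_diff_eq)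
    ultimately show ?thesis by (simp add: riemann_zeta_eq)
  qed
  show ?thesis
    using kern_mellin T0 F unit_taylor(1)[OF s(2) t, of n] unfolding zeta Li_rem_def
    by (simp add: algebra_simps sum_subtractf del: sum.lessThan_Suc)
qed

lemma unit_rem_bound:
  assumes "v > 0" "t > 0"
  shows "norm (complex_of_real (indicator {..<1} v * exp_rem (Suc n) (v * t))) \<le> t ^ Suc n * (v ^ Suc n * indicator {..<1} v)"
  using exp_rem_bound[of "v * t" n] assms
  by (auto simp: indicator_def power_mult_distrib mult_ac)

lemma unit_rem_integrable:
  assumes t: "t > 0" and \<tau>: "\<tau> > - real (Suc n)"
  shows "integrable halfline (\<lambda>v. v powr (\<tau> - 1) * norm (complex_of_real (indicator {..<1} v * exp_rem (Suc n) (v * t))))"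
    and "(\<integral>v. v powr (\<tau> - 1) * norm (complex_of_real (indicator {..<1} v * exp_rem (Suc n) (v * t))) \<partial>halfline)
      \<le> t ^ Suc n * (1 / (\<tau> + real (Suc n)))"
proof -
  have "has_bochner_integral halfline (\<lambda>v. Re (of_real v powr (of_real (\<tau> + real (Suc n)) - 1) * of_real (indicator {..<1} v)))
     (Re (1 / of_real (\<tau> + real (Suc n))))"
    using \<tau> by (intro has_bochner_integral_bounded_linear[OF bounded_linear_Re] unit_powr_integral) simp
  then have "has_bochner_integral halfline (\<lambda>v. v powr (\<tau> - 1) * (v ^ Suc n * indicator {..<1} v)) (1 / (\<tau> + real (Suc n)))"
  proof (rule has_bochner_integral_transform)
    fix v assume "v \<in> space halfline"
    then have v: "v > 0" by simp
    have "complex_of_real v powr (of_real (\<tau> + real (Suc n)) - 1) = of_real (v powr (\<tau> + real (Suc n) - 1))"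
      using powr_of_real[of v "\<tau> + real (Suc n) - 1"] v by simp
    moreover have "\<tau> + real (Suc n) - 1 = (\<tau> - 1) + real (Suc n)" by simp
    then have "v powr (\<tau> + real (Suc n) - 1) = v powr (\<tau> - 1) * v ^ Suc n"
      by (simp only: powr_add powr_realpow[OF v])
    ultimately show "Re (of_real v powr (of_real (\<tau> + real (Suc n)) - 1) * of_real (indicator {..<1} v)) =
        v powr (\<tau> - 1) * (v ^ Suc n * indicator {..<1} v)" by simp
  next
    have "1 / complex_of_real (\<tau> + real (Suc n)) = of_real (1 / (\<tau> + real (Suc n)))" by simp
    then show "Re (1 / complex_of_real (\<tau> + real (Suc n))) = 1 / (\<tau> + real (Suc n))" by (simp only: Re_complex_of_real)
  qed
  then have hb: "has_bochner_integral halfline (\<lambda>v. t ^ Suc n * (v powr (\<tau> - 1) * (v ^ Suc n * indicator {..<1} v))) (t ^ Suc n * (1 / (\<tau> + real (Suc n))))"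
    by (rule has_bochner_integral_mult_right)
  have le: "v powr (\<tau> - 1) * norm (complex_of_real (indicator {..<1} v * exp_rem (Suc n) (v * t))) \<le>
      t ^ Suc n * (v powr (\<tau> - 1) * (v ^ Suc n * indicator {..<1} v))" if "v > 0" for v
    using mult_left_mono[OF unit_rem_bound[OF that t, of n], of "v powr (\<tau> - 1)"] by (simp add: mult_ac)
  show int: "integrable halfline (\<lambda>v. v powr (\<tau> - 1) * norm (complex_of_real (indicator {..<1} v * exp_rem (Suc n) (v * t))))"
  proof (rule Bochner_Integration.integrable_bound)
    show "integrable halfline (\<lambda>v. t ^ Suc n * (v powr (\<tau> - 1) * (v ^ Suc n * indicator {..<1} v)))"
      using hb by (simp add: has_bochner_integral_iff)
    show "AE v in halfline. norm (v powr (\<tau> - 1) * norm (complex_of_real (indicator {..<1} v * exp_rem (Suc n) (v * t))))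
       \<le> norm (t ^ Suc n * (v powr (\<tau> - 1) * (v ^ Suc n * indicator {..<1} v)))"
    proof (rule AE_I2)
      fix v assume "v \<in> space halfline"
      then have v: "v > 0" by simp
      have "v powr (\<tau> - 1) * norm (complex_of_real (indicator {..<1} v * exp_rem (Suc n) (v * t))) \<le>
         \<bar>t ^ Suc n * (v powr (\<tau> - 1) * (v ^ Suc n * indicator {..<1} v))\<bar>"
        by (rule order_trans[OF le[OF v] abs_ge_self])
      moreover have "norm (v powr (\<tau> - 1) * norm w) = v powr (\<tau> - 1) * norm w" for w :: complex by simp
      ultimately show "norm (v powr (\<tau> - 1) * norm (complex_of_real (indicator {..<1} v * exp_rem (Suc n) (v * t))))
         \<le> norm (t ^ Suc n * (v powr (\<tau> - 1) * (v ^ Suc n * indicator {..<1} v)))"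
        by (simp only: real_norm_def)
    qed
  qed measurable
  show "(\<integral>v. v powr (\<tau> - 1) * norm (complex_of_real (indicator {..<1} v * exp_rem (Suc n) (v * t))) \<partial>halfline)
      \<le> t ^ Suc n * (1 / (\<tau> + real (Suc n)))"
    unfolding has_bochner_integral_integral_eq[OF hb, symmetric]
    by (intro integral_mono int integrable.intros[OF hb] le) simp
qed

lemma Li_rem_holomorphic:
  assumes t: "t > 0"
  shows "(\<lambda>s. Li_rem N (Suc n) s t) holomorphic_on {s. - real N < Re s \<and> Re s < real (Suc n) + 1}"
proof -
  let ?S = "{s. - real N < Re s \<and> Re s < real (Suc n) + 1}"
  obtain C where C: "C \<ge> 0" "\<And>x t. x > 0 \<Longrightarrow> t \<ge> 0 \<Longrightarrow> norm (kern_rem N (Suc n) x t) \<le> C * t ^ Suc n * exp (- x)"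
    using kern_rem_bound by blast
  have 1: "mellin (\<lambda>x. kern_rem N (Suc n) x t) holomorphic_on {z. Re z > 0}"
    using t by (intro mellin_holomorphic integrable_exp_decay(1)[of _ "C * t ^ Suc n"] measurable_kern_rem1 C(2)) auto
  have 2: "mellin (\<lambda>v. of_real (indicator {..<1} v * exp_rem (Suc n) (v * t))) holomorphic_on {z. Re z > - real (Suc n)}"
    by (intro mellin_holomorphic unit_rem_integrable t measurable_exp_rem1)
  have "(\<lambda>s. mellin (\<lambda>x. kern_rem N (Suc n) x t) (s + of_nat N)) holomorphic_on ?S"
    by (rule holomorphic_on_compose_gen[OF _ 1, of "\<lambda>s. s + of_nat N", unfolded o_def]) (auto intro!: holomorphic_intros)
  moreover have "(\<lambda>s. mellin (\<lambda>v. of_real (indicator {..<1} v * exp_rem (Suc n) (v * t))) (1 - s)) holomorphic_on ?S"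
    by (rule holomorphic_on_compose_gen[OF _ 2, of "\<lambda>s. 1 - s", unfolded o_def]) (auto intro!: holomorphic_intros)
  ultimately show ?thesis unfolding Li_rem_def by (intro holomorphic_intros)
qed

lemma measurable_Li_rem: "Li_rem N K s \<in> borel_measurable halfline"
proof -
  interpret H: sigma_finite_measure halfline by (rule sigma_finite_halfline)
  have 1: "(\<lambda>(t, x). kern_rem N K x t) \<in> borel_measurable (halfline \<Otimes>\<^sub>M halfline)"
  proof -
    have "(\<lambda>p. case (snd p, fst p) of (x, t) \<Rightarrow> kern_rem N K x t) \<in> borel_measurable (halfline \<Otimes>\<^sub>M halfline)"
      by (rule measurable_compose[OF _ measurable_kern_rem]) measurable
    then show ?thesis by (simp add: case_prod_unfold)
  qed
  have 2: "(\<lambda>(t, v). complex_of_real (indicator {..<1} v * exp_rem K (v * t))) \<in> borel_measurable (halfline \<Otimes>\<^sub>M halfline)"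
    by measurable
  show ?thesis
    unfolding Li_rem_def mellin_def
    using 1 2
    by (intro borel_measurable_diff borel_measurable_times borel_measurable_const H.borel_measurable_lebesgue_integral)
       (auto simp: case_prod_unfold intro!: borel_measurable_times measurable_compose[OF measurable_snd measurable_halfline_powr])
qed

text \<open>One constant for a whole neighbourhood of \<open>s0\<close> and all
  \<open>t > 0\<close>, not only small \<open>t\<close>; the growth for large \<open>t\<close> is
  absorbed by the weighted integrability of \<open>lam\<close>.\<close>

lemma Li_rem_bound:
  assumes s0: "- real N < Re s0" "Re s0 < real (Suc n) + 1"
  obtains V C where "open V" "s0 \<in> V" "V \<subseteq> {s. - real N < Re s \<and> Re s < real (Suc n) + 1}"
    "\<And>s t. s \<in> V \<Longrightarrow> t > 0 \<Longrightarrow> norm (Li_rem N (Suc n) s t) \<le> C * t ^ Suc n"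
proof -
  let ?S = "{s. - real N < Re s} \<inter> {s. Re s < real (Suc n) + 1}"
  obtain C where C: "C \<ge> 0" "\<And>x t. x > 0 \<Longrightarrow> t \<ge> 0 \<Longrightarrow> norm (kern_rem N (Suc n) x t) \<le> C * t ^ Suc n * exp (- x)"
    using kern_rem_bound by blast
  have "open ?S" by (intro open_Int open_halfspace_Re_gt open_halfspace_Re_lt)
  moreover have "s0 \<in> ?S" using s0 by simp
  ultimately obtain r where r: "r > 0" "cball s0 r \<subseteq> ?S"
    unfolding open_contains_cball by blast
  have S: "z \<in> ?S" if "z \<in> cball s0 r" for z using r(2) that by blast
  \<comment> \<open>The explicit constant at the point \<open>s\<close>. It is continuous on a
    closed ball inside the strip and hence bounded there; the complex Gamma function under the norm
    dominates the real one.\<close>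
  define b where "b s = norm (rGamma (s + of_nat N)) * (C * norm (Gamma (complex_of_real (Re s + real N)))) + 1 / (1 - Re s + real (Suc n))" for s
  have nz: "complex_of_real (Re z + real N) \<notin> \<int>\<^sub>\<le>\<^sub>0" if "z \<in> cball s0 r" for z
    using S[OF that] by (intro not_nonpos_Int_Re) simp
  have nz': "1 - Re z + real (Suc n) \<noteq> 0" if "z \<in> cball s0 r" for z
    using S[OF that] by simp
  have "continuous_on (cball s0 r) (\<lambda>s. rGamma (s + of_nat N))"
    by (intro continuous_on_compose2[OF continuous_on_rGamma] continuous_intros) auto
  moreover have "continuous_on (cball s0 r) (\<lambda>s. Gamma (complex_of_real (Re s + real N)))"
    by (intro continuous_on_compose2[OF continuous_on_Gamma[of "- \<int>\<^sub>\<le>\<^sub>0"]] continuous_intros) (use nz in auto)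
  ultimately have "continuous_on (cball s0 r) b"
    unfolding b_def using nz' by (intro continuous_intros) auto
  then have "compact (b ` cball s0 r)" by (intro compact_continuous_image compact_cball)
  then obtain B where B: "\<And>s. s \<in> cball s0 r \<Longrightarrow> norm (b s) \<le> B"
    using compact_imp_bounded bounded_iff by (metis imageI)
  show ?thesis
  proof (rule that[of "ball s0 r" B])
    show "ball s0 r \<subseteq> {s. - real N < Re s \<and> Re s < real (Suc n) + 1}"
      using r ball_subset_cball[of s0 r] by blast
    fix s t assume s: "s \<in> ball s0 r" and t: "(t::real) > 0"
    have sS: "s \<in> ?S" using s r ball_subset_cball by blast
    then have reN: "Re s + real N > 0" by simp
    have "norm (mellin (\<lambda>x. kern_rem N (Suc n) x t) (s + of_nat N)) \<le> C * t ^ Suc n * Gamma (Re (s + of_nat N))"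
      using sS t by (intro norm_mellin_le measurable_kern_rem1 C(2)) auto
    also have "Gamma (Re (s + of_nat N)) \<le> norm (Gamma (complex_of_real (Re s + real N)))"
      unfolding Gamma_complex_of_real by simp
    then have "C * t ^ Suc n * Gamma (Re (s + of_nat N)) \<le> C * t ^ Suc n * norm (Gamma (complex_of_real (Re s + real N)))"
      using C(1) t by (intro mult_left_mono) auto
    finally have 1: "norm (mellin (\<lambda>x. kern_rem N (Suc n) x t) (s + of_nat N)) \<le>
        C * t ^ Suc n * norm (Gamma (complex_of_real (Re s + real N)))" .
    have \<tau>: "Re (1 - s) > - real (Suc n)" using sS by simp
    have "norm (mellin (\<lambda>v. of_real (indicator {..<1} v * exp_rem (Suc n) (v * t))) (1 - s)) \<le>
      (\<integral>v. norm (of_real v powr (1 - s - 1) * complex_of_real (indicator {..<1} v * exp_rem (Suc n) (v * t))) \<partial>halfline)"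
      unfolding mellin_def by (rule integral_norm_bound)
    also have "\<dots> = (\<integral>v. v powr (Re (1 - s) - 1) * norm (complex_of_real (indicator {..<1} v * exp_rem (Suc n) (v * t))) \<partial>halfline)"
      by (intro Bochner_Integration.integral_cong refl) (simp add: norm_mult norm_of_real_powr)
    also have "\<dots> \<le> t ^ Suc n * (1 / (Re (1 - s) + real (Suc n)))"
      by (rule unit_rem_integrable(2)[OF t \<tau>])
    finally have 2: "norm (mellin (\<lambda>v. of_real (indicator {..<1} v * exp_rem (Suc n) (v * t))) (1 - s)) \<le>
      t ^ Suc n * (1 / (1 - Re s + real (Suc n)))" by simp
    have "norm (Li_rem N (Suc n) s t) \<le> norm ((-1) ^ N * rGamma (s + of_nat N) * mellin (\<lambda>x. kern_rem N (Suc n) x t) (s + of_nat N)) +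
       norm (mellin (\<lambda>v. of_real (indicator {..<1} v * exp_rem (Suc n) (v * t))) (1 - s))"
      unfolding Li_rem_def by (rule norm_triangle_ineq4)
    also have "\<dots> \<le> norm (rGamma (s + of_nat N)) * (C * t ^ Suc n * norm (Gamma (complex_of_real (Re s + real N)))) +
       t ^ Suc n * (1 / (1 - Re s + real (Suc n)))"
      using 1 2 by (intro add_mono) (auto simp: norm_mult norm_power intro: mult_left_mono)
    also have "\<dots> = b s * t ^ Suc n" by (simp add: b_def algebra_simps)
    also have "\<dots> \<le> B * t ^ Suc n"
      using B[of s] s t by (intro mult_right_mono) auto
    finally show "norm (Li_rem N (Suc n) s t) \<le> B * t ^ Suc n" .
  qed (use r in auto)
qed

section \<open>The logarithmic derivative of zeta\<close>

text \<open>This notion of summability is integrability with respect to \<open>count_space\<close>,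
  so the results on parameter integrals apply to series.\<close>

abbreviation abs_sum :: "('a \<Rightarrow> 'b::{banach, second_countable_topology}) \<Rightarrow> 'a set \<Rightarrow> bool" where
  "abs_sum \<equiv> Infinite_Set_Sum.abs_summable_on"

lemma abs_summable_nat_powr:
  assumes "\<sigma> > 1"
  shows "abs_sum (\<lambda>n. real n powr (- \<sigma>)) {1..}"
proof -
  have "summable (\<lambda>n. real n powr (- \<sigma>))"
    using assms by (subst summable_real_powr_iff) simp
  then have "summable (\<lambda>n. norm (real n powr (- \<sigma>)))" by simp
  then have "abs_sum (\<lambda>n. real n powr (- \<sigma>)) UNIV"
    by (simp add: abs_summable_on_nat_iff')
  then show ?thesis by (rule abs_summable_on_subset) simp
qed

lemma norm_nat_powr: "n \<ge> 1 \<Longrightarrow> norm (complex_of_nat n powr s) = real n powr Re s"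
  using norm_of_real_powr[of "real n" s] by simp

text \<open>Trades the logarithm for a small power of \<open>n\<close>.\<close>

lemma ln_mult_powr_le:
  assumes "n \<ge> 1" "\<delta> > 0" "\<sigma> > 1 + \<delta>"
  shows "ln (real n) * real n powr (- \<sigma>) \<le> (1 / \<delta>) * real n powr (- (\<sigma> - \<delta>))"
proof -
  have "ln (real n) \<le> real n powr \<delta> / \<delta>" using assms by (intro ln_powr_bound) auto
  then have "ln (real n) * real n powr (- \<sigma>) \<le> real n powr \<delta> / \<delta> * real n powr (- \<sigma>)"
    by (rule mult_right_mono) simp
  also have "\<dots> = (1 / \<delta>) * real n powr (- (\<sigma> - \<delta>))"
    by (simp flip: powr_add)
  finally show ?thesis .
qed

lemma mangoldt_le_ln: "n \<ge> 1 \<Longrightarrow> mangoldt n \<le> ln (real n)"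
  by (rule mangoldt_le) simp

lemma abs_summable_ln:
  assumes "\<sigma> > 1" "\<And>n. n \<ge> 1 \<Longrightarrow> norm (c n) \<le> ln (real n)"
  shows "abs_sum (\<lambda>n. c n * complex_of_real (real n powr (- \<sigma>))) {1..}"
proof (rule abs_summable_on_comparison_test)
  define \<delta> where "\<delta> = (\<sigma> - 1) / 2"
  have \<delta>: "\<delta> > 0" "\<sigma> > 1 + \<delta>" using assms(1) by (auto simp: \<delta>_def field_simps)
  have "\<sigma> - \<delta> > 1" using \<delta> by simp
  then show "abs_sum (\<lambda>n. (1 / \<delta>) * real n powr (- (\<sigma> - \<delta>))) {1..}"
    by (intro abs_summable_on_cmult_right abs_summable_nat_powr)
  fix n :: nat assume n: "n \<in> {1..}"
  have "norm (c n * complex_of_real (real n powr (- \<sigma>))) \<le> ln (real n) * real n powr (- \<sigma>)"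
    using assms(2)[of n] n by (simp add: norm_mult mult_right_mono)
  also have "\<dots> \<le> (1 / \<delta>) * real n powr (- (\<sigma> - \<delta>))"
    using n \<delta> by (intro ln_mult_powr_le) auto
  also have "\<dots> \<le> norm ((1 / \<delta>) * real n powr (- (\<sigma> - \<delta>)))"
    by (simp only: real_norm_def abs_ge_self)
  finally show "norm (c n * complex_of_real (real n powr (- \<sigma>))) \<le> norm ((1 / \<delta>) * real n powr (- (\<sigma> - \<delta>)))" .
qed

definition dirichlet :: "(nat \<Rightarrow> complex) \<Rightarrow> complex \<Rightarrow> complex" where
  "dirichlet c s = infsetsum (\<lambda>n. c n * of_nat n powr (- s)) {1..}"

lemma abs_summable_dirichlet:
  assumes "abs_sum (\<lambda>n. c n * complex_of_real (real n powr (- Re s))) {1..}"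
  shows "abs_sum (\<lambda>n. c n * of_nat n powr (- s)) {1..}"
  using assms by (rule abs_summable_on_comparison_test) (simp add: norm_mult norm_nat_powr)

lemma abs_summable_zeta:
  assumes "Re s > 1"
  shows "abs_sum (\<lambda>n. 1 * complex_of_nat n powr (- s)) {1..}"
proof (rule abs_summable_dirichlet)
  show "abs_sum (\<lambda>n. 1 * complex_of_real (real n powr (- Re s))) {1..}"
    by (rule abs_summable_on_comparison_test[OF abs_summable_nat_powr[OF assms]]) simp
qed

lemma dirichlet_bound:
  assumes n: "n \<in> space (count_space {1..})" and s: "Re s > a"
  shows "norm (c n * complex_of_nat n powr (- s)) \<le> norm (c n * complex_of_real (real n powr (- a)))"
  using n s by (auto simp: norm_mult norm_nat_powr intro!: mult_left_mono powr_mono)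

text \<open>Parameter integrals over a counting measure; the midpoint \<open>a\<close> of 1 and
  \<open>Re s\<close> provides the summable majorant near \<open>s\<close>.\<close>

lemma
  assumes sum: "\<And>\<sigma>. \<sigma> > 1 \<Longrightarrow> abs_sum (\<lambda>n. c n * complex_of_real (real n powr (- \<sigma>))) {1..}"
  shows dirichlet_holomorphic: "dirichlet c holomorphic_on {s. Re s > 1}"
    and dirichlet_deriv: "Re s > 1 \<Longrightarrow> deriv (dirichlet c) s = - dirichlet (\<lambda>n. of_real (ln (real n)) * c n) s"
proof -
  have hol: "(\<lambda>s. c n * complex_of_nat n powr (- s)) holomorphic_on A" if "n \<in> space (count_space {1..})" for n A
    using that by (auto intro!: holomorphic_intros)
  have "(\<lambda>s. \<integral>n. c n * complex_of_nat n powr (- s) \<partial>count_space {1..}) holomorphic_on {s. Re s > 1}"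
  proof (rule holomorphic_on_integral)
    fix s assume s: "s \<in> {s. Re s > 1}"
    define a where "a = (1 + Re s) / 2"
    have a: "a > 1" "a < Re s" using s by (auto simp: a_def)
    show "\<exists>V g. open V \<and> s \<in> V \<and> V \<subseteq> {s. Re s > 1} \<and> integrable (count_space {1..}) g \<and>
      (\<forall>w\<in>V. \<forall>n\<in>space (count_space {1..}). norm (c n * complex_of_nat n powr (- w)) \<le> g n)"
    proof (intro exI conjI ballI)
      show "open {s. Re s > a}" by (rule open_halfspace_Re_gt)
      show "integrable (count_space {1..}) (\<lambda>n. norm (c n * complex_of_real (real n powr (- a))))"
        using sum[OF a(1)] unfolding abs_summable_on_def by (rule integrable_norm)
    qed (use a dirichlet_bound in auto)
  qed (auto intro: open_halfspace_Re_gt hol)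
  then show "dirichlet c holomorphic_on {s. Re s > 1}"
    by (simp add: dirichlet_def[abs_def] infsetsum_def)
  assume s: "Re s > 1"
  define a where "a = (1 + Re s) / 2"
  have a: "a > 1" "a < Re s" using s by (auto simp: a_def)
  have D1: "((\<lambda>s. \<integral>n. c n * complex_of_nat n powr (- s) \<partial>count_space {1..}) has_field_derivative
      (\<integral>n. deriv (\<lambda>s. c n * complex_of_nat n powr (- s)) s \<partial>count_space {1..})) (at s)"
  proof (rule deriv_integral)
    show "integrable (count_space {1..}) (\<lambda>n. norm (c n * complex_of_real (real n powr (- a))))"
      using sum[OF a(1)] unfolding abs_summable_on_def by (rule integrable_norm)
    show "open {s. Re s > a}" by (rule open_halfspace_Re_gt)
    show "norm (c n * complex_of_nat n powr (- s)) \<le> norm (c n * complex_of_real (real n powr (- a)))"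
      if "s \<in> {s. Re s > a}" "n \<in> space (count_space {1..})" for s n
      using that by (intro dirichlet_bound) auto
  qed (use a hol in auto)
  have "deriv (\<lambda>s. c n * complex_of_nat n powr (- s)) s = - (of_real (ln (real n)) * c n * of_nat n powr (- s))"
    if "n \<in> {1..}" for n
  proof -
    have "((\<lambda>s. c n * complex_of_nat n powr (- s)) has_field_derivative - (of_real (ln (real n)) * c n * of_nat n powr (- s))) (at s)"
    proof -
      have "((\<lambda>s. complex_of_nat n powr (- s)) has_field_derivative (Ln (of_nat n) * of_nat n powr (- s)) * (- 1)) (at s)"
        using that by (intro DERIV_chain2[OF has_field_derivative_powr_right]) (auto intro!: derivative_eq_intros)
      from DERIV_cmult[OF this, of "c n"] show ?thesis
        using that by (simp add: Ln_of_nat mult_ac)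
    qed
    then show ?thesis by (rule DERIV_imp_deriv)
  qed
  then have "(\<integral>n. deriv (\<lambda>s. c n * complex_of_nat n powr (- s)) s \<partial>count_space {1..}) =
      (\<integral>n. - (of_real (ln (real n)) * c n * of_nat n powr (- s)) \<partial>count_space {1..})"
    by (intro Bochner_Integration.integral_cong refl) simp
  also have "\<dots> = - dirichlet (\<lambda>n. of_real (ln (real n)) * c n) s"
    by (simp add: dirichlet_def infsetsum_def)
  finally show "deriv (dirichlet c) s = - dirichlet (\<lambda>n. of_real (ln (real n)) * c n) s"
    using DERIV_imp_deriv[OF D1]
    by (simp add: dirichlet_def[abs_def] infsetsum_def)
qed

lemma riemann_zeta_dirichlet:
  assumes "Re s > 1"
  shows "riemann_zeta s = dirichlet (\<lambda>n. 1) s"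
  using infsetsum_infsum[OF abs_summable_zeta[OF assms]] assms
  by (simp add: riemann_zeta_props(2) dirichlet_def powr_minus divide_inverse)

lemma abs_summable_mangoldt:
  assumes "Re s > 1"
  shows "abs_sum (\<lambda>n. mangoldt n * complex_of_nat n powr (- s)) {1..}"
  using assms by (intro abs_summable_dirichlet abs_summable_ln) (auto intro: mangoldt_le_ln)

text \<open>The Dirichlet convolution of the constant 1 with the von Mangoldt function is the
  logarithm. Sending \<open>(a, b)\<close> to \<open>(a * b, b)\<close> regroups the product series
  over pairs of a number and one of its divisors.\<close>

lemma zeta_times_mangoldt:
  assumes s: "Re s > 1"
  shows "riemann_zeta s * dirichlet mangoldt s = dirichlet (\<lambda>n. of_real (ln (real n))) s"
proof -
  define D where "D = (SIGMA n:{1::nat..}. {d. d dvd n})"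
  define F where "F = (\<lambda>(n::nat, d). mangoldt d * complex_of_nat n powr (- s))"
  have bij: "bij_betw (\<lambda>(a, b). (a * b, b)) ({1..} \<times> {1..}) D"
  proof (rule bij_betw_byWitness[where f'="\<lambda>(n, d). (n div d, d)"])
    show "(\<lambda>(n, d). (n div d, d)) ` D \<subseteq> {1..} \<times> {1..}"
      by (auto simp: D_def Suc_le_eq dvd_def)
  qed (auto simp: D_def Suc_le_eq)
  have eq: "F ((\<lambda>(a, b). (a * b, b)) x) = (case x of (a, b) \<Rightarrow> (1 * of_nat a powr (- s)) * (mangoldt b * of_nat b powr (- s)))"
    if "x \<in> {1..} \<times> {1..}" for x
    using that by (auto simp: F_def powr_times_real mult_ac)
  have "abs_sum (\<lambda>x. F ((\<lambda>(a, b). (a * b, b)) x)) ({1..} \<times> {1..})"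
    by (subst abs_summable_on_cong[OF eq refl], assumption)
       (rule abs_summable_on_product[OF _ _ abs_summable_zeta[OF s] abs_summable_mangoldt[OF s]]; simp)
  then have FD: "abs_sum F D"
    using abs_summable_on_reindex_bij_betw[OF bij] by blast
  have "riemann_zeta s * dirichlet mangoldt s =
      infsetsum (\<lambda>n. 1 * complex_of_nat n powr (- s)) {1..} * infsetsum (\<lambda>n. mangoldt n * complex_of_nat n powr (- s)) {1..}"
    unfolding riemann_zeta_dirichlet[OF s] dirichlet_def ..
  also have "\<dots> = infsetsum (\<lambda>(a, b). (1 * of_nat a powr (- s)) * (mangoldt b * of_nat b powr (- s))) ({1..} \<times> {1..})"
    by (rule infsetsum_product[symmetric, OF _ _ abs_summable_zeta[OF s] abs_summable_mangoldt[OF s]]) auto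
  also have "\<dots> = infsetsum (\<lambda>x. F ((\<lambda>(a, b). (a * b, b)) x)) ({1..} \<times> {1..})"
    by (rule infsetsum_cong) (simp_all only: eq)
  also have "\<dots> = infsetsum F D"
    by (rule infsetsum_reindex_bij_betw[OF bij])
  also have "\<dots> = infsetsum (\<lambda>n. infsetsum (\<lambda>d. F (n, d)) {d. d dvd n}) {1..}"
    using FD unfolding D_def by (intro infsetsum_Sigma) auto
  also have "\<dots> = infsetsum (\<lambda>n. of_real (ln (real n)) * complex_of_nat n powr (- s)) {1..}"
  proof (rule infsetsum_cong)
    fix n :: nat assume n: "n \<in> {1..}"
    then have "finite {d. d dvd n}" by (intro finite_divisors_nat) auto
    then have "infsetsum (\<lambda>d. F (n, d)) {d. d dvd n} = (\<Sum>d | d dvd n. mangoldt d) * complex_of_nat n powr (- s)"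
      by (simp add: F_def sum_distrib_right)
    then show "infsetsum (\<lambda>d. F (n, d)) {d. d dvd n} = of_real (ln (real n)) * complex_of_nat n powr (- s)"
      using n by (subst (asm) mangoldt_sum) auto
  qed simp
  finally show ?thesis unfolding dirichlet_def .
qed

text \<open>The entire function (s - 1) zeta(s), not Riemann's completed zeta function. It writes
  zeta and \<open>M\<close> as quotients of entire functions.\<close>

definition xi :: "complex \<Rightarrow> complex" where
  "xi s = 1 + (s - 1) * zeta_reg s"

lemma xi_holomorphic: "xi holomorphic_on A"
  unfolding xi_def by (intro holomorphic_intros zeta_reg_holomorphic)

lemma xi_1: "xi 1 = 1"
  by (simp add: xi_def)

lemma riemann_zeta_xi:
  assumes "s \<noteq> 1"
  shows "riemann_zeta s = xi s / (s - 1)"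
  using assms unfolding riemann_zeta_eq[OF assms] xi_def by (simp add: field_simps)

lemma xi_eq_0_iff: "s \<noteq> 1 \<Longrightarrow> xi s = 0 \<longleftrightarrow> riemann_zeta s = 0"
  by (simp add: riemann_zeta_xi)

lemma deriv_riemann_zeta:
  assumes "Re s > 1"
  shows "deriv riemann_zeta s = - (riemann_zeta s * dirichlet mangoldt s)"
proof -
  have sum: "abs_sum (\<lambda>n. 1 * complex_of_real (real n powr (- \<sigma>))) {1..}" if "\<sigma> > 1" for \<sigma>
    by (rule abs_summable_on_comparison_test[OF abs_summable_nat_powr[OF that]]) simp
  have "deriv riemann_zeta s = deriv (dirichlet (\<lambda>n. 1)) s"
  proof (rule deriv_cong_ev)
    have "\<forall>\<^sub>F s in nhds s. s \<in> {s. Re s > 1}"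
      using assms by (intro eventually_nhds_in_open open_halfspace_Re_gt) simp
    then show "\<forall>\<^sub>F s in nhds s. riemann_zeta s = dirichlet (\<lambda>n. 1) s"
      by (rule eventually_mono) (simp add: riemann_zeta_dirichlet)
  qed simp
  also have "\<dots> = - dirichlet (\<lambda>n. of_real (ln (real n)) * 1) s"
    by (rule dirichlet_deriv[OF sum assms])
  also have "\<dots> = - (riemann_zeta s * dirichlet mangoldt s)"
    by (simp add: zeta_times_mangoldt[OF assms])
  finally show ?thesis .
qed

text \<open>By \<open>\<zeta>' = - \<zeta> D\<close> a zero of \<open>\<zeta>\<close> in the half-plane would be a zero of all its derivatives.\<close>

lemma riemann_zeta_nonzero:
  assumes s: "Re s > 1"
  shows "riemann_zeta s \<noteq> 0"
proof
  assume z: "riemann_zeta s = 0"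
  let ?H = "{s. Re s > 1}"
  have opH: "open ?H" by (rule open_halfspace_Re_gt)
  have cH: "connected ?H" by (intro convex_connected convex_halfspace_Re_gt)
  have hz: "riemann_zeta holomorphic_on ?H"
    using riemann_zeta_props(1) by (rule holomorphic_on_subset) auto
  have "dirichlet mangoldt holomorphic_on ?H"
    by (rule dirichlet_holomorphic, rule abs_summable_ln) (auto intro: mangoldt_le_ln)
  then have hD: "(\<lambda>s. - dirichlet mangoldt s) holomorphic_on ?H"
    by (rule holomorphic_on_minus)
  have der: "(deriv ^^ n) riemann_zeta s = 0" for n
  proof (induction n rule: less_induct)
    case (less n)
    show ?case
    proof (cases n)
      case (Suc m)
      have "(deriv ^^ n) riemann_zeta s = (deriv ^^ m) (deriv riemann_zeta) s"
        unfolding Suc by (simp only: funpow_Suc_right o_apply)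
      also have "\<dots> = (deriv ^^ m) (\<lambda>s. riemann_zeta s * (- dirichlet mangoldt s)) s"
        by (rule higher_deriv_transform_within_open[OF holomorphic_deriv[OF hz opH] holomorphic_on_mult[OF hz hD] opH])
           (use s in \<open>auto simp: deriv_riemann_zeta\<close>)
      also have "\<dots> = (\<Sum>i = 0..m. of_nat (m choose i) * (deriv ^^ i) riemann_zeta s * (deriv ^^ (m - i)) (\<lambda>s. - dirichlet mangoldt s) s)"
        using s by (intro higher_deriv_mult[OF hz hD opH]) simp
      also have "\<dots> = 0" using less Suc by (intro sum.neutral) auto
      finally show ?thesis .
    qed (use z in simp)
  qed
  have z0: "riemann_zeta w = 0" if "w \<in> ?H" for w
    using holomorphic_fun_eq_0_on_connected[OF hz opH cH der _ that] s by simp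
  \<comment> \<open>The contradiction comes from the pole: if zeta vanished on the half-plane, then
    \<open>xi\<close> would vanish everywhere, although it equals 1 at 1.\<close>
  have "xi 1 = 0"
  proof (rule analytic_continuation[of xi UNIV ?H 2])
    show "(2::complex) islimpt ?H"
      using opH by (intro interior_limit_point) (simp add: interior_open)
    show "xi z = 0" if "z \<in> ?H" for z
      using z0[OF that] that by (subst xi_eq_0_iff) auto
  qed (auto intro: xi_holomorphic)
  then show False by (simp add: xi_1)
qed

lemma M_eq_dirichlet: "Re s > 1 \<Longrightarrow> M s = dirichlet mangoldt s"
  using riemann_zeta_nonzero[of s] by (simp add: M_def deriv_riemann_zeta)

text \<open>The logarithmic derivative of xi(s)/(s - 1), with opposite sign, is 1/(s - 1) -
  xi'(s)/xi(s); this is its numerator over (s - 1) xi(s).\<close>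

definition M_num :: "complex \<Rightarrow> complex" where
  "M_num s = xi s - (s - 1) * deriv xi s"

lemma M_num_holomorphic: "M_num holomorphic_on A"
proof -
  have "M_num holomorphic_on UNIV"
    unfolding M_num_def by (intro holomorphic_intros xi_holomorphic) auto
  then show ?thesis by (rule holomorphic_on_subset) simp
qed

lemma M_eq_quotient:
  assumes "s \<noteq> 1" "xi s \<noteq> 0"
  shows "M s = M_num s / ((s - 1) * xi s)"
proof -
  have "deriv riemann_zeta s = deriv (\<lambda>s. xi s / (s - 1)) s"
  proof (rule deriv_cong_ev)
    have "\<forall>\<^sub>F s in nhds s. s \<in> - {1}"
      using assms by (intro eventually_nhds_in_open) auto
    then show "\<forall>\<^sub>F s in nhds s. riemann_zeta s = xi s / (s - 1)"
      by (rule eventually_mono) (simp add: riemann_zeta_xi)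
  qed simp
  also have "\<dots> = (deriv xi s * (s - 1) - xi s) / (s - 1) ^ 2"
  proof -
    have "(xi has_field_derivative deriv xi s) (at s)"
      using holomorphic_derivI[OF xi_holomorphic[of UNIV] open_UNIV] by blast
    then have "((\<lambda>s. xi s / (s - 1)) has_field_derivative (deriv xi s * (s - 1) - xi s) / (s - 1) ^ 2) (at s)"
      using assms by (auto intro!: derivative_eq_intros simp: power2_eq_square)
    then show ?thesis by (rule DERIV_imp_deriv)
  qed
  finally have d: "deriv riemann_zeta s = (deriv xi s * (s - 1) - xi s) / (s - 1) ^ 2" .
  have alg: "- ((d * u - x) / u ^ 2) / (x / u) = (x - u * d) / (u * x)" if "u \<noteq> 0" "x \<noteq> 0" for d u x :: complex
    using that by (simp add: field_simps power2_eq_square)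
  show ?thesis
    unfolding M_def d riemann_zeta_xi[OF assms(1)] M_num_def using assms by (intro alg) auto
qed

lemma isCont_xi [continuous_intros]: "isCont f z \<Longrightarrow> isCont (\<lambda>z. xi (f z)) z"
proof -
  have "isCont xi (f z)"
    using holomorphic_on_imp_continuous_on[OF xi_holomorphic[of UNIV]] by (simp add: continuous_on_eq_continuous_at)
  then show "isCont f z \<Longrightarrow> isCont (\<lambda>z. xi (f z)) z" by (rule isCont_o2[rotated])
qed

lemma isCont_M:
  assumes "s \<noteq> 1" "riemann_zeta s \<noteq> 0"
  shows "isCont M s"
proof -
  have x: "xi s \<noteq> 0" using assms by (simp add: xi_eq_0_iff)
  have cM: "isCont M_num s"
    using holomorphic_on_imp_continuous_on[OF M_num_holomorphic[of UNIV]] by (simp add: continuous_on_eq_continuous_at)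
  have "isCont (\<lambda>s. M_num s / ((s - 1) * xi s)) s"
    using assms x cM by (intro continuous_intros) auto
  moreover have "\<forall>\<^sub>F s in nhds s. M s = M_num s / ((s - 1) * xi s)"
  proof -
    have "isCont (\<lambda>s. (s - 1) * xi s) s" by (intro continuous_intros)
    then have "((\<lambda>s. (s - 1) * xi s) \<longlongrightarrow> (s - 1) * xi s) (nhds s)"
      using tendsto_at_iff_tendsto_nhds[of "\<lambda>s. (s - 1) * xi s" s] by (simp only: isCont_def)
    then have "\<forall>\<^sub>F s in nhds s. (s - 1) * xi s \<noteq> 0"
      by (rule tendsto_imp_eventually_ne) (use x assms(1) in simp)
    then show ?thesis by eventually_elim (rule M_eq_quotient, auto)
  qed
  ultimately show ?thesis by (simp cong: isCont_cong)
qed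

text \<open>Residue 1 at the simple pole of zeta: \<open>M_num\<close> and \<open>xi\<close> both
  take the value 1 there.\<close>

lemma tendsto_M_at_1: "((\<lambda>s. (s - 1) * M s) \<longlongrightarrow> 1) (at 1)"
proof -
  have cM: "isCont M_num 1"
    using holomorphic_on_imp_continuous_on[OF M_num_holomorphic[of UNIV]] by (simp add: continuous_on_eq_continuous_at)
  then have "isCont (\<lambda>s. M_num s / xi s) 1"
    by (intro continuous_intros) (auto simp: xi_1)
  then have "((\<lambda>s. M_num s / xi s) \<longlongrightarrow> 1) (at 1)"
    by (simp add: isCont_def M_num_def xi_1)
  moreover have "\<forall>\<^sub>F s in at 1. M_num s / xi s = (s - 1) * M s"
  proof -
    have "(xi \<longlongrightarrow> xi 1) (at 1)" using isCont_xi[of 1 "\<lambda>z. z"] by (simp add: isCont_def)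
    then have "\<forall>\<^sub>F s in at 1. xi s \<noteq> 0" by (rule tendsto_imp_eventually_ne) (simp add: xi_1)
    moreover have "\<forall>\<^sub>F s::complex in at 1. s \<noteq> 1" by (simp add: eventually_at_filter)
    ultimately show ?thesis
      by eventually_elim (simp add: M_eq_quotient)
  qed
  ultimately show ?thesis by (rule Lim_transform_eventually)
qed

section \<open>The logarithmic derivative of zeta at 0\<close>

text \<open>Second-order Taylor expansion at the centre \<open>x\<close> in both directions; the
  first-order terms cancel. The second derivative has exponent \<open>- Re s - 2\<close>, which is
  below -3/2 for \<open>Re s > -1/2\<close>, and \<open>x \<ge> 2\<close> keeps all bases at least
  1.\<close>

lemma second_difference_bound:
  assumes x: "x \<ge> 2" and s: "Re s > -1/2"
  shows "norm (complex_of_real (x - 1) powr (- s) - 2 * of_real x powr (- s) + of_real (x + 1) powr (- s))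
    \<le> 2 * (norm s * (norm s + 1)) * (x - 1) powr (- 3/2)"
proof -
  define S where "S = complex_of_real ` {x - 1..}"
  define f where "f i z = (if i = 0 then z powr (- s) else if i = Suc 0 then - s * z powr (- s - 1) else s * (s + 1) * z powr (- s - 2))" for i and z :: complex
  define B where "B = norm s * (norm s + 1) * (x - 1) powr (- 3/2)"
  have SI: "z \<notin> \<real>\<^sub>\<le>\<^sub>0" if "z \<in> S" for z using that x by (auto simp: S_def complex_nonpos_Reals_iff)
  have taylor: "norm (f 0 (of_real y) - (\<Sum>i\<le>1. f i (of_real x) * (of_real y - of_real x) ^ i / fact i))
      \<le> B * norm (complex_of_real y - of_real x) ^ Suc 1 / fact 1" if y: "y \<ge> x - 1" for y
  proof (rule complex_Taylor[of S])
    have "linear complex_of_real" by (intro bounded_linear.linear bounded_linear_of_real)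
    then show "convex S" unfolding S_def by (intro convex_linear_image) auto
    show "(f i has_field_derivative f (Suc i) z) (at z within S)" if "z \<in> S" "i \<le> 1" for i z
    proof -
      have "i = 0 \<or> i = Suc 0" using that by auto
      then have "(f i has_field_derivative f (Suc i) z) (at z)"
        unfolding f_def using SI[OF that(1)]
        by (auto intro!: derivative_eq_intros simp: algebra_simps)
      then show ?thesis by (rule has_field_derivative_at_within)
    qed
    show "norm (f (Suc 1) z) \<le> B" if z: "z \<in> S" for z
    proof -
      obtain w where w: "z = of_real w" "w \<ge> x - 1" using z by (auto simp: S_def)
      have "norm (f (Suc 1) z) = norm s * norm (s + 1) * w powr (- Re s - 2)"
        using w x by (simp add: f_def norm_mult norm_of_real_powr)
      also have "\<dots> \<le> norm s * (norm s + 1) * (x - 1) powr (- 3/2)"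
      proof (intro mult_mono)
        show "norm (s + 1) \<le> norm s + 1" using norm_triangle_ineq[of s 1] by simp
        have "-1/2 + 2 \<le> Re s + 2" using s by (intro add_right_mono less_imp_le)
        then have "- Re s - 2 \<le> - 3/2" by simp
        then have "w powr (- Re s - 2) \<le> w powr (- 3/2)" using w x by (intro powr_mono) auto
        also have "\<dots> \<le> (x - 1) powr (- 3/2)" using w x by (intro powr_mono2') auto
        finally show "w powr (- Re s - 2) \<le> (x - 1) powr (- 3/2)" .
      qed auto
      finally show ?thesis by (simp add: B_def)
    qed
  qed (use y in \<open>auto simp: S_def\<close>)
  define fx where "fx = complex_of_real x powr (- s)"
  define f' where "f' = - s * complex_of_real x powr (- s - 1)"
  have 1: "norm (complex_of_real (x - 1) powr (- s) - (fx - f')) \<le> B"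
    using taylor[of "x - 1"] by (simp add: f_def fx_def f'_def)
  have 2: "norm (complex_of_real (x + 1) powr (- s) - (fx + f')) \<le> B"
    using taylor[of "x + 1"] by (simp add: f_def fx_def f'_def)
  have "complex_of_real (x - 1) powr (- s) - 2 * fx + of_real (x + 1) powr (- s) =
     (complex_of_real (x - 1) powr (- s) - (fx - f')) + (complex_of_real (x + 1) powr (- s) - (fx + f'))"
    by simp
  also have "norm \<dots> \<le> B + B" using 1 2 by (intro order_trans[OF norm_triangle_ineq] add_mono)
  finally show ?thesis by (simp add: B_def fx_def)
qed

text \<open>Pairing the terms of \<open>\<Sum> (-1)\<^sup>n\<^sup>-\<^sup>1 n\<^sup>-\<^sup>s\<close> into second differences gives absolute convergence in a
  neighbourhood of \<open>0\<close>, where the derivative is the logarithm of Wallis' product.\<close>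

definition alt_term :: "complex \<Rightarrow> nat \<Rightarrow> complex" where
  "alt_term s i = of_nat (2 * i + 1) powr (- s) - 2 * of_nat (2 * i + 2) powr (- s) + of_nat (2 * i + 3) powr (- s)"

definition alt_sum :: "complex \<Rightarrow> complex" where
  "alt_sum s = (\<integral>i. alt_term s i \<partial>count_space UNIV)"

lemma alt_term_bound:
  assumes s: "Re s > -1/2" "norm s < R"
  shows "norm (alt_term s i) \<le> 2 * (R * (R + 1)) * real (Suc i) powr (- 3/2)"
proof -
  have n: "norm (alt_term s i) \<le> 2 * (norm s * (norm s + 1)) * (real (2 * i + 2) - 1) powr (- 3/2)"
    using second_difference_bound[of "real (2 * i + 2)" s] s by (simp add: alt_term_def add_ac)
  have R: "0 \<le> R" using s norm_ge_zero[of s] by linarith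
  have "2 * (norm s * (norm s + 1)) * (real (2 * i + 2) - 1) powr (- 3/2) \<le> 2 * (R * (R + 1)) * real (Suc i) powr (- 3/2)"
  proof (intro mult_mono)
    show "(real (2 * i + 2) - 1) powr (- 3/2) \<le> real (Suc i) powr (- 3/2)"
      by (intro powr_mono2') auto
    show "0 \<le> 2 * (R * (R + 1))" using R by simp
    show "norm s \<le> R" "norm s + 1 \<le> R + 1" using s by auto
  qed (use R in auto)
  with n show ?thesis by linarith
qed

lemma integrable_alt_bound: "integrable (count_space UNIV) (\<lambda>i. c * real (Suc i) powr (- 3/2))"
  using summable_Suc_powr[of "3/2"] by (intro integrable_mult_right) (simp add: integrable_count_space_nat_iff)

lemma alt_term_holomorphic: "(\<lambda>s. alt_term s i) holomorphic_on A"
  unfolding alt_term_def by (intro holomorphic_intros) (auto simp del: of_nat_add of_nat_mult)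

lemma alt_sum_holomorphic: "alt_sum holomorphic_on {s. Re s > -1/2}"
proof -
  have "(\<lambda>s. \<integral>i. alt_term s i \<partial>count_space UNIV) holomorphic_on {s. Re s > -1/2}"
  proof (rule holomorphic_on_integral)
    fix s assume s: "s \<in> {s. Re s > -1/2}"
    show "\<exists>V g. open V \<and> s \<in> V \<and> V \<subseteq> {s. Re s > -1/2} \<and> integrable (count_space UNIV) g \<and>
      (\<forall>w\<in>V. \<forall>i\<in>space (count_space UNIV). norm (alt_term w i) \<le> g i)"
    proof (intro exI conjI ballI)
      show "open ({s. Re s > -1/2} \<inter> ball 0 (norm s + 1))"
        by (intro open_Int open_halfspace_Re_gt open_ball)
      show "norm (alt_term w i) \<le> 2 * ((norm s + 1) * (norm s + 1 + 1)) * real (Suc i) powr (- 3/2)"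
        if "w \<in> {s. Re s > -1/2} \<inter> ball 0 (norm s + 1)" for w i
        using that by (intro alt_term_bound) auto
    qed (use s integrable_alt_bound in auto)
  qed (auto intro: alt_term_holomorphic open_halfspace_Re_gt)
  then show ?thesis by (simp add: alt_sum_def[abs_def])
qed

lemma alt_sum_0: "alt_sum 0 = 0"
proof -
  have "complex_of_nat n powr (- 0) = 1" if "n > 0" for n using that by simp
  then have "alt_term 0 i = 1 - 2 * 1 + 1" for i unfolding alt_term_def by (metis add_gr_0 zero_less_numeral zero_less_one)
  then show ?thesis by (simp add: alt_sum_def)
qed

lemma alt_sum_deriv_0: "(alt_sum has_field_derivative of_real (ln (pi / 2))) (at 0)"
proof -
  let ?V = "{s. Re s > -1/2} \<inter> ball 0 1"
  have "((\<lambda>s. \<integral>i. alt_term s i \<partial>count_space UNIV) has_field_derivative (\<integral>i. deriv (\<lambda>s. alt_term s i) 0 \<partial>count_space UNIV)) (at 0)"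
  proof (rule deriv_integral)
    show "open ?V" by (intro open_Int open_halfspace_Re_gt open_ball)
    show "integrable (count_space UNIV) (\<lambda>i. 2 * (1 * (1 + 1)) * real (Suc i) powr (- 3/2))"
      by (rule integrable_alt_bound)
    show "norm (alt_term s i) \<le> 2 * (1 * (1 + 1)) * real (Suc i) powr (- 3/2)" if "s \<in> ?V" for s i
      using that by (intro alt_term_bound) auto
  qed (auto intro: alt_term_holomorphic)
  note D = this
  have "((\<lambda>s. complex_of_nat n powr (- s)) has_field_derivative - of_real (ln (real n))) (at 0)" if "n > 0" for n
  proof -
    have "((\<lambda>s. complex_of_nat n powr (- s)) has_field_derivative (Ln (of_nat n) * of_nat n powr (- 0)) * (- 1)) (at 0)"
      using that by (intro DERIV_chain2[OF has_field_derivative_powr_right]) (auto intro!: derivative_eq_intros)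
    then show ?thesis using that by (simp add: Ln_of_nat)
  qed
  note Dp = this
  have "deriv (\<lambda>s. alt_term s i) 0 = of_real (ln ((4 * real (Suc i) ^ 2) / (4 * real (Suc i) ^ 2 - 1)))" for i
  proof -
    have "((\<lambda>s. alt_term s i) has_field_derivative
      (- of_real (ln (real (2 * i + 1))) - 2 * (- of_real (ln (real (2 * i + 2)))) + - of_real (ln (real (2 * i + 3))))) (at 0)"
      unfolding alt_term_def by (intro DERIV_add DERIV_diff DERIV_cmult Dp) auto
    then have "deriv (\<lambda>s. alt_term s i) 0 = of_real (2 * ln (real (2 * i + 2)) - (ln (real (2 * i + 1)) + ln (real (2 * i + 3))))"
      by (simp add: DERIV_imp_deriv)
    also have "2 * ln (real (2 * i + 2)) - (ln (real (2 * i + 1)) + ln (real (2 * i + 3))) =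
        ln (real (2 * i + 2) ^ 2 / (real (2 * i + 1) * real (2 * i + 3)))"
      by (simp add: ln_div ln_mult ln_realpow del: of_nat_add of_nat_mult)
    also have "real (2 * i + 1) * real (2 * i + 3) = 4 * real (Suc i) ^ 2 - 1"
      by (simp add: algebra_simps power2_eq_square)
    also have "real (2 * i + 2) ^ 2 = 4 * real (Suc i) ^ 2"
      by (simp add: algebra_simps power2_eq_square)
    finally show ?thesis .
  qed
  moreover have "(\<lambda>i. complex_of_real (ln ((4 * real (Suc i) ^ 2) / (4 * real (Suc i) ^ 2 - 1)))) sums of_real (ln (pi / 2))"
  proof (rule sums_of_real)
    have pos: "(4 * real (Suc i) ^ 2) / (4 * real (Suc i) ^ 2 - 1) > 0" for i
    proof -
      have "real (Suc i) ^ 2 \<ge> 1" by (intro one_le_power) simp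
      then have "4 * real (Suc i) ^ 2 > 0" "4 * real (Suc i) ^ 2 - 1 > 0" by linarith+
      then show ?thesis by (rule divide_pos_pos)
    qed
    have part: "(\<Sum>i<n. ln ((4 * real (Suc i) ^ 2) / (4 * real (Suc i) ^ 2 - 1))) =
      ln (\<Prod>k=1..n. (4 * real k ^ 2) / (4 * real k ^ 2 - 1))" for n
    proof -
      have "(\<Prod>k=1..n. (4 * real k ^ 2) / (4 * real k ^ 2 - 1)) = (\<Prod>i<n. (4 * real (Suc i) ^ 2) / (4 * real (Suc i) ^ 2 - 1))"
        by (rule prod.reindex_bij_witness[of _ Suc "\<lambda>k. k - 1"]) auto
      then show ?thesis
        by (simp only:) (rule ln_prod[symmetric, OF finite_lessThan less_imp_neq[OF pos, symmetric]])
    qed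
    show "(\<lambda>i. ln ((4 * real (Suc i) ^ 2) / (4 * real (Suc i) ^ 2 - 1))) sums ln (pi / 2)"
      unfolding sums_def part by (intro tendsto_ln wallis) simp
  qed
  ultimately have sums: "(\<lambda>i. deriv (\<lambda>s. alt_term s i) 0) sums of_real (ln (pi / 2))" by simp
  \<comment> \<open>Cauchy's estimate on the circle of radius 1/4, on which the bound for
    \<open>alt_term\<close> with \<open>R = 1\<close> holds; its constant 4 divided by 1/4 gives
    \<open>2 * 8\<close>.\<close>
  have "integrable (count_space UNIV) (\<lambda>i. deriv (\<lambda>s. alt_term s i) 0)"
  proof (rule Bochner_Integration.integrable_bound[OF integrable_alt_bound[of "2 * 8"]])
    have "norm (deriv (\<lambda>s. alt_term s i) 0) \<le> norm (2 * 8 * real (Suc i) powr (- 3/2))" for i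
    proof -
      have "norm ((deriv ^^ 1) (\<lambda>s. alt_term s i) 0) \<le> fact 1 * (2 * (1 * (1 + 1)) * real (Suc i) powr (- 3/2)) / (1/4) ^ 1"
      proof (rule Cauchy_inequality)
        fix x :: complex assume x: "norm (0 - x) = 1/4"
        then have "Re x > -1/2" using abs_Re_le_cmod[of x] by auto
        then show "norm (alt_term x i) \<le> 2 * (1 * (1 + 1)) * real (Suc i) powr (- 3/2)"
          using x by (intro alt_term_bound) auto
      qed (auto intro: alt_term_holomorphic holomorphic_on_imp_continuous_on)
      then show ?thesis by simp
    qed
    then show "AE i in count_space UNIV. norm (deriv (\<lambda>s. alt_term s i) 0) \<le> norm (2 * 8 * real (Suc i) powr (- 3/2))"
      by (intro AE_I2)
  qed simp
  then have "(\<integral>i. deriv (\<lambda>s. alt_term s i) 0 \<partial>count_space UNIV) = of_real (ln (pi / 2))"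
    using sums by (simp add: integral_count_space_nat sums_unique[symmetric])
  then show ?thesis using D by (simp add: alt_sum_def[abs_def])
qed

text \<open>With eta(s) = (1 - 2^(1-s)) zeta(s), the alternating zeta series,
  \<open>alt_sum s = 2 eta(s) - 1\<close>: every odd number from 3 on belongs to two adjacent second
  differences, the number 1 to only one. The factor s - 1 removes the pole, so that the identity
  theorem carries the relation from \<open>Re s > 1\<close> to \<open>Re s > -1/2\<close>.\<close>

lemma xi_alt_sum:
  assumes "Re s > -1/2"
  shows "(1 - 2 powr (1 - s)) * xi s = (s - 1) * (1/2 + alt_sum s / 2)"
proof -
  let ?H = "{s. Re s > -1/2}"
  have "(1 - 2 powr (1 - s)) * xi s - (s - 1) * (1/2 + alt_sum s / 2) = 0"
  proof (rule analytic_continuation[of "\<lambda>s. (1 - 2 powr (1 - s)) * xi s - (s - 1) * (1/2 + alt_sum s / 2)" ?H "{s. Re s > 1}" 2])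
    show "(\<lambda>s. (1 - 2 powr (1 - s)) * xi s - (s - 1) * (1/2 + alt_sum s / 2)) holomorphic_on ?H"
      by (intro holomorphic_intros xi_holomorphic alt_sum_holomorphic) auto
    show "connected ?H" by (intro convex_connected convex_halfspace_Re_gt)
    show "(2::complex) islimpt {s. Re s > 1}"
      by (intro interior_limit_point) (simp add: interior_open open_halfspace_Re_gt)
    fix s assume "s \<in> {s. Re s > 1}"
    then have s: "Re s > 1" by simp
    define a where "a n = complex_of_nat (Suc n) powr (- s)" for n
    define Z where "Z = riemann_zeta s"
    have sa: "summable a" unfolding a_def
      using summable_norm_cancel[OF summable_norm_zeta[OF s]] .
    have Z: "a sums Z"
      using sa riemann_zeta_eq_series[OF s] by (simp add: Z_def a_def[abs_def] summable_sums)
    have "a (2 * n + 1) = 2 powr (- s) * a n" for n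
    proof -
      have "complex_of_nat (Suc (2 * n + 1)) = of_real 2 * of_real (real (Suc n))" by simp
      then have "a (2 * n + 1) = (of_real 2 * of_real (real (Suc n))) powr (- s)"
        unfolding a_def by (simp only:)
      also have "\<dots> = of_real 2 powr (- s) * of_real (real (Suc n)) powr (- s)"
        by (rule powr_times_real) auto
      finally show ?thesis by (simp add: a_def)
    qed
    then have E: "(\<lambda>n. a (2 * n + 1)) sums (2 powr (- s) * Z)"
      using sums_mult[OF Z, of "2 powr (- s)"] by simp
    \<comment> \<open>Grouping consecutive pairs and subtracting the even integers isolates the sum
      over the odd ones.\<close>
    have "(\<lambda>n. sum a {n * 2..<n * 2 + 2}) sums Z" by (rule sums_group[OF Z]) simp
    moreover have "sum a {n * 2..<n * 2 + 2} = a (2 * n) + a (2 * n + 1)" for n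
      by (simp add: mult.commute numeral_2_eq_2)
    ultimately have "(\<lambda>n. a (2 * n) + a (2 * n + 1)) sums Z" by simp
    from sums_diff[OF this E] have O: "(\<lambda>n. a (2 * n)) sums (Z - 2 powr (- s) * Z)" by simp
    have "(\<lambda>n. a (2 * Suc n)) sums (Z - 2 powr (- s) * Z - a (2 * 0))"
      using O by (subst sums_Suc_iff) simp
    then have O1: "(\<lambda>n. a (2 * Suc n)) sums (Z - 2 powr (- s) * Z - 1)" by (simp add: a_def)
    have "(\<lambda>n. a (2 * n) - 2 * a (2 * n + 1) + a (2 * Suc n)) sums
        ((Z - 2 powr (- s) * Z) - 2 * (2 powr (- s) * Z) + (Z - 2 powr (- s) * Z - 1))"
      by (intro sums_add sums_diff sums_mult O E O1)
    moreover have "a (2 * n) - 2 * a (2 * n + 1) + a (2 * Suc n) = alt_term s n" for n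
      by (simp add: a_def alt_term_def add_ac)
    ultimately have sums: "alt_term s sums (2 * Z - 4 * (2 powr (- s) * Z) - 1)" by (simp add: algebra_simps)
    have "integrable (count_space UNIV) (alt_term s)"
    proof (rule Bochner_Integration.integrable_bound[OF integrable_alt_bound[of "2 * ((norm s + 1) * (norm s + 1 + 1))"]])
      have "norm (alt_term s i) \<le> 2 * ((norm s + 1) * (norm s + 1 + 1)) * real (Suc i) powr (- 3/2)" for i
        using s by (intro alt_term_bound) auto
      then show "AE i in count_space UNIV. norm (alt_term s i) \<le> norm (2 * ((norm s + 1) * (norm s + 1 + 1)) * real (Suc i) powr (- 3/2))"
        by (intro AE_I2) (simp only: real_norm_def order_trans[OF _ abs_ge_self])
    qed simp
    then have "alt_sum s = 2 * Z - 4 * (2 powr (- s) * Z) - 1"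
      using sums by (simp add: alt_sum_def integral_count_space_nat sums_unique[symmetric])
    moreover have "2 powr (1 - s) = 2 * 2 powr (- s)" by (simp add: powr_diff powr_minus divide_inverse)
    moreover have "s \<noteq> 1" using s by auto
    then have "xi s = (s - 1) * Z" by (simp add: riemann_zeta_xi Z_def)
    moreover have "(1 - 2 * p) * ((s - 1) * z) - (s - 1) * (1/2 + (2 * z - 4 * (p * z) - 1) / 2) = 0" for p z
      by (simp add: field_simps)
    ultimately show "(1 - 2 powr (1 - s)) * xi s - (s - 1) * (1/2 + alt_sum s / 2) = 0"
      by (simp only:)
  qed (use assms in \<open>auto intro: open_halfspace_Re_gt\<close>)
  then show ?thesis by simp
qed

text \<open>Differentiating \<open>xi_alt_sum\<close> at 0 expresses xi'(0) by the Wallis value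
  log(pi/2). With xi(0) = 1/2 the quotient formula gives M(0) = -(1 + 2 xi'(0)).\<close>

lemma M_0: "M 0 = - of_real (ln (2 * pi))"
proof -
  have x0: "xi 0 = 1/2" using xi_alt_sum[of 0] by (simp add: alt_sum_0)
  have dxi: "(xi has_field_derivative deriv xi 0) (at 0)"
    using holomorphic_derivI[OF xi_holomorphic[of UNIV] open_UNIV] by blast
  have d2: "((\<lambda>s. 2 powr (1 - s)) has_field_derivative - 2 * of_real (ln 2)) (at (0::complex))"
  proof -
    have "((\<lambda>s. 2 powr (1 - s)) has_field_derivative (Ln 2 * 2 powr (1 - 0)) * (- 1)) (at (0::complex))"
      by (intro DERIV_chain2[OF has_field_derivative_powr_right]) (auto intro!: derivative_eq_intros)
    then show ?thesis using Ln_of_real[of 2] by (simp add: mult.commute)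
  qed
  have L: "((\<lambda>s. (1 - 2 powr (1 - s)) * xi s) has_field_derivative (2 * of_real (ln 2) * (1/2) - deriv xi 0)) (at 0)"
    using d2 dxi by (auto intro!: derivative_eq_intros simp: x0)
  have R: "((\<lambda>s. (s - 1) * (1/2 + alt_sum s / 2)) has_field_derivative (1/2 - of_real (ln (pi / 2)) / 2)) (at 0)"
    using alt_sum_deriv_0 by (auto intro!: derivative_eq_intros simp: alt_sum_0)
  have "\<forall>\<^sub>F s in nhds 0. (1 - 2 powr (1 - s)) * xi s = (s - 1) * (1/2 + alt_sum s / 2)"
  proof -
    have "\<forall>\<^sub>F s in nhds (0::complex). s \<in> {s. Re s > -1/2}"
      by (intro eventually_nhds_in_open open_halfspace_Re_gt) simp
    then show ?thesis by (rule eventually_mono) (auto intro!: xi_alt_sum)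
  qed
  then have "deriv (\<lambda>s. (1 - 2 powr (1 - s)) * xi s) 0 = deriv (\<lambda>s. (s - 1) * (1/2 + alt_sum s / 2)) 0"
    by (intro deriv_cong_ev refl)
  then have eq: "2 * of_real (ln 2) * (1/2) - deriv xi 0 = 1/2 - of_real (ln (pi / 2)) / 2"
    using DERIV_imp_deriv[OF L] DERIV_imp_deriv[OF R] by simp
  have "deriv xi 0 = 2 * of_real (ln 2) * (1/2) - (2 * of_real (ln 2) * (1/2) - deriv xi 0)" by simp
  also have "\<dots> = of_real (ln 2 - 1/2 + ln (pi / 2) / 2)" unfolding eq by simp
  finally have dx: "deriv xi 0 = of_real (ln 2 - 1/2 + ln (pi / 2) / 2)" .
  have "M 0 = M_num 0 / ((0 - 1) * xi 0)" using x0 by (intro M_eq_quotient) auto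
  also have "\<dots> = - of_real (2 * ln 2 + ln (pi / 2))"
    by (simp add: M_num_def x0 dx)
  also have "2 * ln 2 + ln (pi / 2) = ln (2 * pi)"
    by (simp add: ln_div ln_mult)
  finally show ?thesis .
qed

section \<open>Continuation of the double series\<close>

definition lam :: "real \<Rightarrow> complex" where
  "lam t = (\<integral>n. mangoldt n * of_real (exp (- (real n * t))) \<partial>count_space {1..})"

lemma sigma_finite_count: "sigma_finite_measure (count_space (A :: nat set))"
  by (rule sigma_finite_measure_count_space_countable) simp

lemma
  assumes s: "Re s > 1"
  shows lam_mellin_integrable: "integrable halfline (\<lambda>t. of_real t powr (s - 1) * lam t)"
    and lam_mellin: "(\<integral>t. of_real t powr (s - 1) * lam t \<partial>halfline) = Gamma s * dirichlet mangoldt s"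
proof -
  have "abs_sum (\<lambda>n. mangoldt n * complex_of_real (real n powr (- Re s))) {1..}"
    using s by (intro abs_summable_ln) (auto intro: mangoldt_le_ln)
  then have int: "integrable (count_space {1..}) (\<lambda>n. norm (mangoldt n :: complex) * real n powr (- Re s))"
    unfolding abs_summable_on_def by (drule_tac integrable_norm) (simp add: norm_mult)
  show "integrable halfline (\<lambda>t. of_real t powr (s - 1) * lam t)"
    unfolding lam_def using s by (intro integrable_mellin int sigma_finite_count) auto
  show "(\<integral>t. of_real t powr (s - 1) * lam t \<partial>halfline) = Gamma s * dirichlet mangoldt s"
    unfolding lam_def dirichlet_def infsetsum_def
    using s by (subst integral_mellin[OF sigma_finite_count _ _ _ _ int]) auto
qed

lemma measurable_lam [measurable]: "lam \<in> borel_measurable halfline"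
proof -
  interpret N: sigma_finite_measure "count_space {1::nat..}" by (rule sigma_finite_count)
  have [measurable]: "(\<lambda>n. mangoldt n :: complex) \<in> borel_measurable (count_space {1..})"
    "(\<lambda>n. real n) \<in> borel_measurable (count_space {1..})" by simp_all
  show ?thesis unfolding lam_def[abs_def] by measurable
qed

lemma lam_norm_integrable:
  assumes "\<sigma> > 1"
  shows "integrable halfline (\<lambda>t. t powr (\<sigma> - 1) * norm (lam t))"
proof -
  have "integrable halfline (\<lambda>t. norm (of_real t powr (of_real \<sigma> - 1) * lam t))"
    using assms by (intro integrable_norm lam_mellin_integrable) simp
  then show ?thesis
    by (rule Bochner_Integration.integrable_cong[THEN iffD1, OF refl, rotated]) (simp add: norm_mult norm_of_real_powr)
qed

text \<open>The left bound on the first variable comes from \<open>n\<close> integrations by parts,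
  the right one from the integral over [0, 1]. In the second variable the remainder is O(t^(n+1))
  and \<open>lam\<close> requires \<open>Re s2 + (n + 1) > 1\<close>. These convex sets exhaust the
  whole space.\<close>

definition rem_dom :: "nat \<Rightarrow> (complex \<times> complex) set" where
  "rem_dom n = {p. - real n < Re (fst p) \<and> Re (fst p) < real (Suc n) + 1 \<and> - real n < Re (snd p)}"

definition rem_int :: "nat \<Rightarrow> complex \<times> complex \<Rightarrow> complex" where
  "rem_int n p = (\<integral>t. of_real t powr (snd p - 1) * (lam t * Li_rem n (Suc n) (fst p) t) \<partial>halfline)"

text \<open>The factor t^(n+1) gained by \<open>Li_rem\<close> moves the abscissa of
  \<open>lam_norm_integrable\<close> from 1 to -n; the exponents \<open>a\<close> and
  \<open>b\<close> on either side of \<open>Re (snd p)\<close> take care of small and large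
  \<open>t\<close>.\<close>

lemma rem_int_dominated:
  assumes p: "p \<in> rem_dom n"
  shows "\<exists>V g. open V \<and> p \<in> V \<and> V \<subseteq> rem_dom n \<and> integrable halfline g \<and>
    (\<forall>q\<in>V. \<forall>t\<in>space halfline. norm (of_real t powr (snd q - 1) * (lam t * Li_rem n (Suc n) (fst q) t)) \<le> g t)"
proof -
  obtain V1 C where V1: "open V1" "fst p \<in> V1" "V1 \<subseteq> {s. - real n < Re s \<and> Re s < real (Suc n) + 1}"
    "\<And>s t. s \<in> V1 \<Longrightarrow> t > 0 \<Longrightarrow> norm (Li_rem n (Suc n) s t) \<le> C * t ^ Suc n"
    using Li_rem_bound[of n "fst p" n] p unfolding rem_dom_def by blast
  have C: "C \<ge> 0" using order_trans[OF norm_ge_zero V1(4)[OF V1(2), of 1]] by simp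
  define a where "a = (Re (snd p) - real n) / 2"
  define b where "b = Re (snd p) + 1"
  have ab: "a > - real n" "a < Re (snd p)" "b > - real n" "Re (snd p) < b"
    using p by (auto simp: a_def b_def rem_dom_def)
  let ?V2 = "{s. Re s > a} \<inter> {s. Re s < b}"
  define g where "g t = C * (t powr (a + real (Suc n) - 1) * norm (lam t) + t powr (b + real (Suc n) - 1) * norm (lam t))" for t
  have "integrable halfline g"
    unfolding g_def using ab
    by (intro integrable_mult_right Bochner_Integration.integrable_add lam_norm_integrable) auto
  moreover have "open (V1 \<times> ?V2)"
    using V1(1) by (intro open_Times open_Int open_halfspace_Re_gt open_halfspace_Re_lt)
  moreover have "p \<in> V1 \<times> ?V2" using V1(2) ab by (simp add: mem_Times_iff)
  moreover have "V1 \<times> ?V2 \<subseteq> rem_dom n" using V1(3) ab by (auto simp: rem_dom_def)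
  moreover have "norm (of_real t powr (snd q - 1) * (lam t * Li_rem n (Suc n) (fst q) t)) \<le> g t"
    if q: "q \<in> V1 \<times> ?V2" and t: "t \<in> space halfline" for q t
  proof -
    have t0: "t > 0" using t by simp
    have q': "fst q \<in> V1" "a < Re (snd q)" "Re (snd q) < b" using q by (auto simp: mem_Times_iff)
    have "norm (of_real t powr (snd q - 1) * (lam t * Li_rem n (Suc n) (fst q) t)) =
        t powr (Re (snd q) - 1) * norm (lam t) * norm (Li_rem n (Suc n) (fst q) t)"
      using t0 by (simp add: norm_mult norm_of_real_powr)
    also have "\<dots> \<le> t powr (Re (snd q) - 1) * norm (lam t) * (C * t ^ Suc n)"
      by (intro mult_left_mono V1(4) q' t0) simp
    also have "\<dots> = C * (t powr (Re (snd q) - 1) * t ^ Suc n) * norm (lam t)"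
      by (simp only: mult_ac)
    also have "t powr (Re (snd q) - 1) * t ^ Suc n = t powr (Re (snd q) - 1 + real (Suc n))"
      by (simp only: powr_add powr_realpow[OF t0])
    also have "C * t powr (Re (snd q) - 1 + real (Suc n)) * norm (lam t) \<le>
        C * (t powr (a + real (Suc n) - 1) + t powr (b + real (Suc n) - 1)) * norm (lam t)"
      using q' t0 C by (intro mult_right_mono mult_left_mono powr_le_powr_endpoints) auto
    also have "\<dots> = g t" by (simp add: g_def algebra_simps)
    finally show ?thesis .
  qed
  ultimately show ?thesis by (intro exI[of _ "V1 \<times> ?V2"] exI[of _ g]) blast
qed

lemma measurable_rem_integrand:
  "(\<lambda>t. of_real t powr (z - 1) * (lam t * Li_rem n (Suc n) s t)) \<in> borel_measurable halfline"
  using measurable_Li_rem[of n "Suc n" s] by measurable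

lemma rem_int_integrable:
  assumes p: "p \<in> rem_dom n"
  shows "integrable halfline (\<lambda>t. of_real t powr (snd p - 1) * (lam t * Li_rem n (Suc n) (fst p) t))"
proof -
  obtain V g where V: "p \<in> V" "integrable halfline g"
    "\<And>q t. q \<in> V \<Longrightarrow> t \<in> space halfline \<Longrightarrow> norm (of_real t powr (snd q - 1) * (lam t * Li_rem n (Suc n) (fst q) t)) \<le> g t"
    using rem_int_dominated[OF p] by blast
  show ?thesis
    using V(3)[OF V(1)]
    by (intro Bochner_Integration.integrable_bound[OF V(2)] measurable_rem_integrand AE_I2)
       (auto intro: order_trans[OF _ abs_ge_self] simp del: space_halfline)
qed

lemma open_rem_dom: "open (rem_dom n)"
  and convex_rem_dom: "convex (rem_dom n)"
proof -
  have eq: "rem_dom n = ({s. Re s > - real n} \<inter> {s. Re s < real (Suc n) + 1}) \<times> {s. Re s > - real n}"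
    by (auto simp: rem_dom_def)
  show "open (rem_dom n)"
    unfolding eq by (intro open_Times open_Int open_halfspace_Re_gt open_halfspace_Re_lt)
  show "convex (rem_dom n)"
    unfolding eq by (intro convex_Times convex_Int convex_halfspace_Re_gt convex_halfspace_Re_lt)
qed

lemma holomorphic2_fst_compose:
  assumes "\<phi> holomorphic_on V" "open V" "\<And>p. p \<in> U \<Longrightarrow> fst p \<in> V"
  shows "holomorphic2_on (\<lambda>p. \<phi> (fst p)) U"
  using holomorphic2_on_compose_linear[OF assms(1,2), of U 1 0 0] assms(3) by simp

lemma holomorphic2_snd_compose:
  assumes "\<phi> holomorphic_on V" "open V" "\<And>p. p \<in> U \<Longrightarrow> snd p \<in> V"
  shows "holomorphic2_on (\<lambda>p. \<phi> (snd p)) U"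
  using holomorphic2_on_compose_linear[OF assms(1,2), of U 0 1 0] assms(3) by simp

lemma rem_int_holomorphic: "holomorphic2_on (rem_int n) (rem_dom n)"
proof -
  have "holomorphic2_on (\<lambda>p. \<integral>t. of_real t powr (snd p - 1) * (lam t * Li_rem n (Suc n) (fst p) t) \<partial>halfline) (rem_dom n)"
  proof (rule holomorphic2_on_integral)
    fix t assume "t \<in> space halfline"
    then have t: "t > 0" by simp
    have "holomorphic2_on (\<lambda>p. complex_of_real t powr (snd p - 1)) (rem_dom n)"
      using t by (intro holomorphic2_snd_compose[of "\<lambda>z. complex_of_real t powr (z - 1)" UNIV]) (auto intro!: holomorphic_intros)
    moreover have "holomorphic2_on (\<lambda>p. Li_rem n (Suc n) (fst p) t) (rem_dom n)"
    proof (rule holomorphic2_fst_compose[OF Li_rem_holomorphic[OF t]])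
      have "{s. - real n < Re s \<and> Re s < real (Suc n) + 1} = {s. Re s > - real n} \<inter> {s. Re s < real (Suc n) + 1}" by auto
      then show "open {s. - real n < Re s \<and> Re s < real (Suc n) + 1}"
        using open_Int[OF open_halfspace_Re_gt open_halfspace_Re_lt] by metis
    qed (auto simp: rem_dom_def)
    ultimately show "holomorphic2_on (\<lambda>p. of_real t powr (snd p - 1) * (lam t * Li_rem n (Suc n) (fst p) t)) (rem_dom n)"
      by (intro holomorphic2_on_mult holomorphic2_on_const)
  qed (use rem_int_dominated measurable_rem_integrand in auto)
  then show ?thesis by (simp add: rem_int_def[abs_def])
qed

section \<open>The double series in its domain of convergence\<close>

definition pair_term :: "complex \<times> complex \<Rightarrow> nat \<times> nat \<Rightarrow> complex" where
  "pair_term p = (\<lambda>(a, b). mangoldt b * (of_nat a powr (- fst p) * of_nat (a + b) powr (- snd p)))"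

definition pair_sum :: "complex \<times> complex \<Rightarrow> complex" where
  "pair_sum p = infsetsum (pair_term p) ({1..} \<times> {1..})"

definition conv_dom :: "(complex \<times> complex) set" where
  "conv_dom = {p. Re (snd p) > 1 \<and> Re (fst p + snd p) > 2}"

lemma norm_pair_term:
  "a \<ge> 1 \<Longrightarrow> b \<ge> 1 \<Longrightarrow> norm (pair_term p (a, b)) =
     mangoldt b * (real a powr (- Re (fst p)) * real (a + b) powr (- Re (snd p)))"
  by (simp add: pair_term_def norm_mult norm_nat_powr del: of_nat_add)

text \<open>Splitting \<sigma>2 as \<alpha> + (1 + \<delta>) and estimating \<open>a + b\<close>
  from below by \<open>a\<close> in one factor and by \<open>b\<close> in the other bounds the
  series by a product of two single ones. Half of the smaller slack as \<delta> leaves both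
  exponents above 1.\<close>

lemma abs_summable_pair:
  assumes "\<sigma>2 > 1" "\<sigma>1 + \<sigma>2 > 2"
  shows "abs_sum (\<lambda>(a, b). mangoldt b * (real a powr (- \<sigma>1) * real (a + b) powr (- \<sigma>2))) ({1..} \<times> {1..})"
proof -
  define \<delta> where "\<delta> = min (\<sigma>2 - 1) (\<sigma>1 + \<sigma>2 - 2) / 2"
  define \<alpha> where "\<alpha> = \<sigma>2 - 1 - \<delta>"
  have d: "\<delta> > 0" "\<alpha> \<ge> 0" "\<sigma>1 + \<alpha> > 1" "\<sigma>2 = \<alpha> + (1 + \<delta>)"
    using assms by (auto simp: \<delta>_def \<alpha>_def min_def field_simps)
  have s1: "abs_sum (\<lambda>a. real a powr (- (\<sigma>1 + \<alpha>))) {1..}"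
    using d by (intro abs_summable_nat_powr)
  have "abs_sum (\<lambda>b. mangoldt b * complex_of_real (real b powr (- (1 + \<delta>)))) {1..}"
    using d by (intro abs_summable_ln) (auto intro: mangoldt_le_ln)
  then have s2: "abs_sum (\<lambda>b. mangoldt b * real b powr (- (1 + \<delta>))) {1..}"
    by (rule abs_summable_on_comparison_test) (simp add: norm_mult abs_mult)
  show ?thesis
  proof (rule abs_summable_on_comparison_test)
    show "abs_sum (\<lambda>(a, b). real a powr (- (\<sigma>1 + \<alpha>)) * (mangoldt b * real b powr (- (1 + \<delta>)))) ({1..} \<times> {1..})"
      using s1 s2 by (intro abs_summable_on_product) auto
    fix x :: "nat \<times> nat" assume "x \<in> {1..} \<times> {1..}"
    then obtain a b where x: "x = (a, b)" "a \<ge> 1" "b \<ge> 1" by auto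
    have "real (a + b) powr (- \<sigma>2) = real (a + b) powr (- \<alpha>) * real (a + b) powr (- (1 + \<delta>))"
      by (simp only: d(4) minus_add_distrib powr_add)
    also have "\<dots> \<le> real a powr (- \<alpha>) * real b powr (- (1 + \<delta>))"
      using x d by (intro mult_mono powr_mono2') auto
    finally have "mangoldt b * (real a powr (- \<sigma>1) * real (a + b) powr (- \<sigma>2)) \<le>
      mangoldt b * (real a powr (- \<sigma>1) * (real a powr (- \<alpha>) * real b powr (- (1 + \<delta>))))"
      by (intro mult_left_mono mangoldt_nonneg) auto
    also have "\<dots> = real a powr (- (\<sigma>1 + \<alpha>)) * (mangoldt b * real b powr (- (1 + \<delta>)))"
      by (simp only: minus_add_distrib powr_add mult_ac)
    finally show "norm (case x of (a, b) \<Rightarrow> mangoldt b * (real a powr (- \<sigma>1) * real (a + b) powr (- \<sigma>2)))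
      \<le> norm (case x of (a, b) \<Rightarrow> real a powr (- (\<sigma>1 + \<alpha>)) * (mangoldt b * real b powr (- (1 + \<delta>))))"
      by (simp add: x abs_mult mangoldt_nonneg)
  qed
qed

lemma abs_summable_pair_term:
  assumes "p \<in> conv_dom"
  shows "abs_sum (pair_term p) ({1..} \<times> {1..})"
proof (rule abs_summable_on_comparison_test[OF abs_summable_pair[of "Re (snd p)" "Re (fst p)"]])
  fix x :: "nat \<times> nat" assume "x \<in> {1..} \<times> {1..}"
  then show "norm (pair_term p x) \<le> norm (case x of (a, b) \<Rightarrow> mangoldt b * (real a powr (- Re (fst p)) * real (a + b) powr (- Re (snd p))))"
    by (auto simp: norm_pair_term abs_mult mangoldt_nonneg simp del: of_nat_add)
qed (use assms in \<open>auto simp: conv_dom_def\<close>)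

lemma open_conv_dom: "open conv_dom"
proof -
  have "conv_dom = snd -` {z. Re z > 1} \<inter> (\<lambda>p. fst p + snd p) -` {z. Re z > 2}" by (auto simp: conv_dom_def)
  also have "open \<dots>"
    by (intro open_Int open_vimage open_halfspace_Re_gt continuous_intros)
  finally show ?thesis .
qed

lemma convex_conv_dom: "convex conv_dom"
proof -
  have "conv_dom = snd -` {z. Re z > 1} \<inter> (\<lambda>p. fst p + snd p) -` {z. Re z > 2}" by (auto simp: conv_dom_def)
  also have "convex \<dots>"
    by (intro convex_Int convex_linear_vimage linear_snd linear_compose_add linear_fst convex_halfspace_Re_gt)
  finally show ?thesis .
qed

lemma pair_sum_holomorphic: "holomorphic2_on pair_sum conv_dom"
proof -
  have "holomorphic2_on (\<lambda>p. \<integral>x. pair_term p x \<partial>count_space ({1..} \<times> {1..})) conv_dom"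
  proof (rule holomorphic2_on_integral)
    fix x :: "nat \<times> nat" assume "x \<in> space (count_space ({1..} \<times> {1..}))"
    then obtain a b where x: "x = (a, b)" "a \<ge> 1" "b \<ge> 1" by auto
    have "holomorphic2_on (\<lambda>p. of_nat a powr (- fst p)) conv_dom"
      using x by (intro holomorphic2_fst_compose[of "\<lambda>z. of_nat a powr (- z)" UNIV]) (auto intro!: holomorphic_intros)
    moreover have "holomorphic2_on (\<lambda>p. of_nat (a + b) powr (- snd p)) conv_dom"
      using x by (intro holomorphic2_snd_compose[of "\<lambda>z. of_nat (a + b) powr (- z)" UNIV]) (auto intro!: holomorphic_intros simp del: of_nat_add)
    ultimately show "holomorphic2_on (\<lambda>p. pair_term p x) conv_dom"
      unfolding pair_term_def x by (auto intro!: holomorphic2_on_mult simp del: of_nat_add)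
  next
    fix p assume p: "p \<in> conv_dom"
    show "pair_term p \<in> borel_measurable (count_space ({1..} \<times> {1..}))" by simp
    \<comment> \<open>A third of the slack: lowering both exponents by \<open>e\<close> costs
      \<open>e\<close> in one condition and \<open>2 * e\<close> in the other.\<close>
    define e where "e = min (Re (snd p) - 1) (Re (fst p + snd p) - 2) / 3"
    define s1 where "s1 = Re (fst p) - e"
    define s2 where "s2 = Re (snd p) - e"
    have e: "e > 0" "s2 > 1" "s1 + s2 > 2" "s1 < Re (fst p)" "s2 < Re (snd p)"
      using p by (auto simp: e_def s1_def s2_def conv_dom_def min_def field_simps)
    define g where "g = (\<lambda>(a, b). mangoldt b * (real a powr (- s1) * real (a + b) powr (- s2)))"
    show "\<exists>V g. open V \<and> p \<in> V \<and> V \<subseteq> conv_dom \<and> integrable (count_space ({1..} \<times> {1..})) g \<and>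
      (\<forall>q\<in>V. \<forall>x\<in>space (count_space ({1..} \<times> {1..})). norm (pair_term q x) \<le> g x)"
    proof (intro exI conjI ballI)
      show "open ({s. Re s > s1} \<times> {s. Re s > s2})"
        by (intro open_Times open_halfspace_Re_gt)
      show "integrable (count_space ({1..} \<times> {1..})) g"
        using abs_summable_pair[OF e(2,3)] unfolding abs_summable_on_def g_def .
      fix q x assume q: "q \<in> {s. Re s > s1} \<times> {s. Re s > s2}" and "x \<in> space (count_space ({1::nat..} \<times> {1::nat..}))"
      then obtain a b where x: "x = (a, b)" "a \<ge> 1" "b \<ge> 1" by auto
      show "norm (pair_term q x) \<le> g x"
        unfolding x(1) g_def norm_pair_term[OF x(2,3)] prod.case
        using q x by (intro mult_left_mono mult_mono powr_mono mangoldt_nonneg) (auto simp: mem_Times_iff)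
    qed (use e in \<open>auto simp: conv_dom_def mem_Times_iff\<close>)
  qed
  then show ?thesis by (simp add: pair_sum_def[abs_def] infsetsum_def)
qed

lemma bij_Suc: "bij_betw Suc UNIV {1..}"
  by (rule bij_betw_byWitness[where f'="\<lambda>n. n - 1"]) auto

lemma
  assumes "Re s \<ge> 0" "t > 0"
  shows abs_summable_Li: "abs_sum (\<lambda>n. complex_of_nat n powr (- s) * of_real (exp (- (real n * t)))) {1..}"
    and Li_infsetsum: "Li s t = infsetsum (\<lambda>n. complex_of_nat n powr (- s) * of_real (exp (- (real n * t)))) {1..}"
  using integrable_Li[OF assms] abs_summable_on_reindex_bij_betw[OF bij_Suc, of "\<lambda>n. complex_of_nat n powr (- s) * of_real (exp (- (real n * t)))"]
    infsetsum_reindex_bij_betw[OF bij_Suc, of "\<lambda>n. complex_of_nat n powr (- s) * of_real (exp (- (real n * t)))"]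
  by (simp_all only: Li_def abs_summable_on_def infsetsum_def)

lemma abs_summable_lam:
  assumes t: "t > 0"
  shows "abs_sum (\<lambda>n. mangoldt n * complex_of_real (exp (- (real n * t)))) {1..}"
proof (rule abs_summable_on_comparison_test)
  show "abs_sum (\<lambda>n. of_real (2 / t ^ 2) * (mangoldt n * complex_of_real (real n powr (- 2)))) {1..}"
    by (intro abs_summable_on_cmult_right abs_summable_ln) (auto intro: mangoldt_le_ln)
  fix n :: nat assume n: "n \<in> {1..}"
  define x where "x = real n * t"
  have x: "x > 0" using n t by (simp add: x_def)
  have "x ^ 2 / 2 \<le> exp x" using exp_lower_Taylor_quadratic[of x] x by simp
  then have "1 / exp x \<le> 1 / (x ^ 2 / 2)"
    using x by (intro frac_le) auto
  then have "exp (- x) \<le> 1 / (x ^ 2 / 2)"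
    by (simp add: exp_minus inverse_eq_divide)
  also have "1 / (x ^ 2 / 2) = 2 / t ^ 2 * real n powr (- 2)"
    using n by (simp add: x_def power_mult_distrib powr_minus powr_numeral field_simps)
  finally have "mangoldt n * exp (- x) \<le> mangoldt n * (2 / t ^ 2 * real n powr (- 2))"
    by (intro mult_left_mono mangoldt_nonneg)
  then show "norm (mangoldt n * complex_of_real (exp (- (real n * t)))) \<le>
      norm (of_real (2 / t ^ 2) * (mangoldt n * complex_of_real (real n powr (- 2))))"
    unfolding x_def norm_mult norm_of_real norm_mangoldt by (simp add: mult_ac)
qed

text \<open>The Mellin representation of (a + b)^(-s2) replaces the coupling of the two indices by
  e^(-(a+b)t), which factors; for each \<open>t\<close> the double sum becomes a product.\<close>

lemma pair_sum_mellin: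
  assumes s1: "0 < Re s1" and p: "(s1, s2) \<in> conv_dom"
  shows "Gamma s2 * pair_sum (s1, s2) = (\<integral>t. of_real t powr (s2 - 1) * (lam t * Li s1 t) \<partial>halfline)"
proof -
  let ?N = "count_space ({1::nat..} \<times> {1::nat..})"
  define c where "c = (\<lambda>(a::nat, b). mangoldt b * complex_of_nat a powr (- s1))"
  define x where "x = (\<lambda>(a::nat, b::nat). real (a + b))"
  have N: "sigma_finite_measure ?N" by (rule sigma_finite_measure_count_space_countable) simp
  have s2: "Re s2 > 0" using p by (simp add: conv_dom_def)
  have int: "integrable ?N (\<lambda>i. norm (c i) * x i powr (- Re s2))"
  proof -
    have "integrable ?N (\<lambda>i. norm (pair_term (s1, s2) i))"
      using abs_summable_pair_term[OF p] unfolding abs_summable_on_def by (rule integrable_norm)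
    then show ?thesis
      by (rule Bochner_Integration.integrable_cong[THEN iffD1, OF refl, rotated])
         (auto simp: norm_pair_term c_def x_def norm_mult norm_nat_powr simp del: of_nat_add)
  qed
  have inner: "(\<integral>i. c i * of_real (exp (- (x i * t))) \<partial>?N) = lam t * Li s1 t" if t: "t \<in> space halfline" for t
  proof -
    have t0: "t > 0" and s0: "Re s1 \<ge> 0" using t s1 by auto
    have "lam t * Li s1 t = Li s1 t * lam t" by (rule mult.commute)
    also have "\<dots> = infsetsum (\<lambda>(a, b). (complex_of_nat a powr (- s1) * of_real (exp (- (real a * t)))) *
         (mangoldt b * complex_of_real (exp (- (real b * t))))) ({1..} \<times> {1..})"
      unfolding lam_def infsetsum_def[symmetric] Li_infsetsum[OF s0 t0]
      by (rule infsetsum_product[symmetric, OF _ _ abs_summable_Li[OF s0 t0] abs_summable_lam[OF t0]]) simp_all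
    also have "\<dots> = (\<integral>i. c i * of_real (exp (- (x i * t))) \<partial>?N)"
    proof -
      have "exp (- (real (a + b) * t)) = exp (- (real a * t)) * exp (- (real b * t))" for a b
        by (simp add: algebra_simps flip: exp_add)
      then show ?thesis
        unfolding infsetsum_def
        by (intro Bochner_Integration.integral_cong refl) (auto simp: c_def x_def simp del: of_nat_add)
    qed
    finally show ?thesis by simp
  qed
  have pos: "x i > 0" if "i \<in> space ?N" for i using that by (auto simp: x_def)
  have "(\<integral>t. of_real t powr (s2 - 1) * (lam t * Li s1 t) \<partial>halfline) =
      (\<integral>t. of_real t powr (s2 - 1) * (\<integral>i. c i * of_real (exp (- (x i * t))) \<partial>?N) \<partial>halfline)"
    by (intro Bochner_Integration.integral_cong refl) (simp only: inner)
  also have "\<dots> = Gamma s2 * (\<integral>i. c i * of_real (x i) powr (- s2) \<partial>?N)"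
    by (intro integral_mellin int N pos s2) auto
  also have "(\<integral>i. c i * of_real (x i) powr (- s2) \<partial>?N) = pair_sum (s1, s2)"
    unfolding pair_sum_def infsetsum_def
    by (intro Bochner_Integration.integral_cong refl) (auto simp: c_def x_def pair_term_def)
  finally show "Gamma s2 * pair_sum (s1, s2) = (\<integral>t. of_real t powr (s2 - 1) * (lam t * Li s1 t) \<partial>halfline)" ..
qed

definition cont_expr :: "nat \<Rightarrow> complex \<times> complex \<Rightarrow> complex" where
  "cont_expr n p = Gamma (1 - fst p) * Gamma (fst p + snd p - 1) * rGamma (snd p) * M (fst p + snd p - 1)
     + (\<Sum>k<Suc n. of_real ((-1) ^ k / fact k) * pochhammer (snd p) k * riemann_zeta (fst p - of_nat k) * M (snd p + of_nat k))
     + rGamma (snd p) * rem_int n p"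

text \<open>Here the expansion of the polylogarithm holds and every Mellin transform of
  \<open>lam\<close> that occurs has its argument to the right of 1. The set lies in
  \<open>conv_dom\<close> and in every \<open>rem_dom n\<close>, so it is the common starting point
  for all continuations.\<close>

definition base_dom :: "(complex \<times> complex) set" where
  "base_dom = {s. 0 < Re s \<and> Re s < 1} \<times> {s. 2 < Re s}"

lemma pair_sum_eq_cont_expr:
  assumes p: "p \<in> base_dom"
  shows "pair_sum p = cont_expr n p"
proof -
  obtain s1 s2 where p12: "p = (s1, s2)" by force
  have s: "0 < Re s1" "Re s1 < 1" "2 < Re s2" using p by (auto simp: base_dom_def p12)
  have D: "(s1, s2) \<in> conv_dom" using s by (simp add: conv_dom_def)
  have R: "(s1, s2) \<in> rem_dom n" using s by (simp add: rem_dom_def)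
  define m1 where "m1 = (\<lambda>t. of_real t powr (s1 + s2 - 1 - 1) * lam t)"
  define m2 where "m2 = (\<lambda>k t. of_real t powr (s2 + of_nat k - 1) * lam t)"
  define m3 where "m3 = (\<lambda>t. of_real t powr (s2 - 1) * (lam t * Li_rem n (Suc n) s1 t))"
  define ck where "ck k = complex_of_real ((-1) ^ k / fact k) * riemann_zeta (s1 - of_nat k)" for k
  have r1: "Re (s1 + s2 - 1) > 1" using s by simp
  have r2: "Re (s2 + of_nat k) > 1" for k using s by simp
  have i1: "integrable halfline m1" unfolding m1_def by (rule lam_mellin_integrable[OF r1])
  have i2: "integrable halfline (m2 k)" for k unfolding m2_def by (rule lam_mellin_integrable[OF r2])
  have i3: "integrable halfline m3" unfolding m3_def using rem_int_integrable[OF R] by simp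
  have split: "of_real t powr (s2 - 1) * (lam t * Li s1 t) = Gamma (1 - s1) * m1 t + (\<Sum>k<Suc n. ck k * m2 k t) + m3 t"
    if "t \<in> space halfline" for t
  proof -
    have t: "t > 0" using that by simp
    have a: "complex_of_real t powr (s2 - 1) * of_real t powr (s1 - 1) = of_real t powr (s1 + s2 - 1 - 1)"
      by (simp flip: powr_add add: algebra_simps)
    have b: "complex_of_real t powr (s2 - 1) * of_real ((- t) ^ k / fact k) = of_real ((-1) ^ k / fact k) * of_real t powr (s2 + of_nat k - 1)" for k
    proof -
      have "complex_of_real t powr of_nat k = of_real t ^ k" using t by (simp add: powr_nat')
      moreover have "s2 + of_nat k - 1 = (s2 - 1) + of_nat k" by simp
      ultimately have "complex_of_real t powr (s2 + of_nat k - 1) = of_real t powr (s2 - 1) * of_real t ^ k"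
        by (simp only: powr_add)
      then show ?thesis by (simp add: power_minus[of t])
    qed
    have "of_real t powr (s2 - 1) * (lam t * Li s1 t) =
       Gamma (1 - s1) * ((of_real t powr (s2 - 1) * of_real t powr (s1 - 1)) * lam t) +
       (\<Sum>k<Suc n. (of_real t powr (s2 - 1) * of_real ((- t) ^ k / fact k)) * riemann_zeta (s1 - of_nat k) * lam t) +
       of_real t powr (s2 - 1) * (lam t * Li_rem n (Suc n) s1 t)"
      unfolding Li_expansion[OF s(1,2) t, of n n]
      by (simp only: distrib_left sum_distrib_left mult_ac)
    also have "\<dots> = Gamma (1 - s1) * m1 t + (\<Sum>k<Suc n. ck k * m2 k t) + m3 t"
      unfolding a b m1_def m2_def m3_def ck_def by (simp only: mult_ac)
    finally show ?thesis .
  qed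
  have "Gamma s2 * pair_sum p = (\<integral>t. Gamma (1 - s1) * m1 t + (\<Sum>k<Suc n. ck k * m2 k t) + m3 t \<partial>halfline)"
    unfolding p12 pair_sum_mellin[OF s(1) D]
    by (intro Bochner_Integration.integral_cong refl split)
  also have "\<dots> = Gamma (1 - s1) * (\<integral>t. m1 t \<partial>halfline) + (\<Sum>k<Suc n. ck k * (\<integral>t. m2 k t \<partial>halfline)) + (\<integral>t. m3 t \<partial>halfline)"
    using i1 i2 i3 by (simp del: sum.lessThan_Suc)
  also have "(\<integral>t. m1 t \<partial>halfline) = Gamma (s1 + s2 - 1) * M (s1 + s2 - 1)"
    unfolding m1_def M_eq_dirichlet[OF r1] by (rule lam_mellin[OF r1])
  also have "(\<integral>t. m3 t \<partial>halfline) = rem_int n p"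
    by (simp add: m3_def rem_int_def p12)
  also have "(\<Sum>k<Suc n. ck k * (\<integral>t. m2 k t \<partial>halfline)) = (\<Sum>k<Suc n. ck k * (Gamma (s2 + of_nat k) * M (s2 + of_nat k)))"
    unfolding m2_def M_eq_dirichlet[OF r2] using lam_mellin[OF r2] by (intro sum.cong refl) simp
  finally have e: "Gamma s2 * pair_sum p = Gamma (1 - s1) * (Gamma (s1 + s2 - 1) * M (s1 + s2 - 1)) +
     (\<Sum>k<Suc n. ck k * (Gamma (s2 + of_nat k) * M (s2 + of_nat k))) + rem_int n p" .
  have G: "rGamma z * Gamma z = 1" if "Re z > 0" for z
    using not_nonpos_Int_Re[OF that] by (simp add: rGamma_inverse_Gamma Gamma_eq_zero_iff)
  have poch: "rGamma s2 * Gamma (s2 + of_nat k) = pochhammer s2 k" for k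
    using pochhammer_rGamma[of s2 k] G[of "s2 + of_nat k"] s by simp
  have "pair_sum p = rGamma s2 * (Gamma s2 * pair_sum p)"
    using G[of s2] s by (simp flip: mult.assoc)
  also have "\<dots> = Gamma (1 - s1) * Gamma (s1 + s2 - 1) * rGamma s2 * M (s1 + s2 - 1) +
     (\<Sum>k<Suc n. ck k * ((rGamma s2 * Gamma (s2 + of_nat k)) * M (s2 + of_nat k))) + rGamma s2 * rem_int n p"
    unfolding e by (simp only: distrib_left sum_distrib_left mult_ac)
  also have "\<dots> = cont_expr n p"
    unfolding poch cont_expr_def p12 ck_def fst_conv snd_conv by (simp only: mult_ac)
  finally show ?thesis .
qed

text \<open>One quotient valid on all of \<open>U\<close>, in contrast to the local quotients of
  \<open>meromorphic2\<close>; this form is closed under sums and products and can be glued.\<close>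

definition quot_on :: "(complex \<times> complex \<Rightarrow> complex) \<Rightarrow> (complex \<times> complex) set \<Rightarrow> bool" where
  "quot_on F U \<longleftrightarrow> (\<exists>g h. holomorphic2_on g U \<and> holomorphic2_on h U \<and>
     (\<exists>q\<in>U. h q \<noteq> 0) \<and> (\<forall>q\<in>U. h q \<noteq> 0 \<longrightarrow> F q = g q / h q))"

lemma quot_on_holomorphic: "holomorphic2_on f U \<Longrightarrow> U \<noteq> {} \<Longrightarrow> quot_on f U"
  unfolding quot_on_def by (intro exI[of _ f] exI[of _ "\<lambda>_. 1"]) auto

lemma quot_on_mult:
  assumes "quot_on F U" "quot_on G U" "open U" "connected U"
  shows "quot_on (\<lambda>p. F p * G p) U"
proof -
  obtain g h where 1: "holomorphic2_on g U" "holomorphic2_on h U" "\<exists>q\<in>U. h q \<noteq> 0" "\<forall>q\<in>U. h q \<noteq> 0 \<longrightarrow> F q = g q / h q"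
    using assms(1) unfolding quot_on_def by blast
  obtain g' h' where 2: "holomorphic2_on g' U" "holomorphic2_on h' U" "\<exists>q\<in>U. h' q \<noteq> 0" "\<forall>q\<in>U. h' q \<noteq> 0 \<longrightarrow> G q = g' q / h' q"
    using assms(2) unfolding quot_on_def by blast
  have "\<exists>q\<in>U. h q * h' q \<noteq> 0"
    using holomorphic2_prod_nonzero[OF 1(2) 2(2) assms(3,4)] 1(3) 2(3) by blast
  then show ?thesis
    unfolding quot_on_def using 1 2
    by (intro exI[of _ "\<lambda>p. g p * g' p"] exI[of _ "\<lambda>p. h p * h' p"]) (auto intro: holomorphic2_on_mult)
qed

lemma quot_on_add:
  assumes "quot_on F U" "quot_on G U" "open U" "connected U"
  shows "quot_on (\<lambda>p. F p + G p) U"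
proof -
  obtain g h where 1: "holomorphic2_on g U" "holomorphic2_on h U" "\<exists>q\<in>U. h q \<noteq> 0" "\<forall>q\<in>U. h q \<noteq> 0 \<longrightarrow> F q = g q / h q"
    using assms(1) unfolding quot_on_def by blast
  obtain g' h' where 2: "holomorphic2_on g' U" "holomorphic2_on h' U" "\<exists>q\<in>U. h' q \<noteq> 0" "\<forall>q\<in>U. h' q \<noteq> 0 \<longrightarrow> G q = g' q / h' q"
    using assms(2) unfolding quot_on_def by blast
  have "\<exists>q\<in>U. h q * h' q \<noteq> 0"
    using holomorphic2_prod_nonzero[OF 1(2) 2(2) assms(3,4)] 1(3) 2(3) by blast
  then show ?thesis
    unfolding quot_on_def using 1 2
    by (intro exI[of _ "\<lambda>p. g p * h' p + g' p * h p"] exI[of _ "\<lambda>p. h p * h' p"])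
       (auto intro!: holomorphic2_on_mult holomorphic2_on_add simp: add_frac_eq)
qed

lemma quot_on_sum:
  assumes "\<And>k. k \<in> A \<Longrightarrow> quot_on (F k) U" "open U" "connected U" "U \<noteq> {}"
  shows "quot_on (\<lambda>p. \<Sum>k\<in>A. F k p) U"
proof (cases "finite A")
  case True
  then show ?thesis using assms(1)
  proof (induction A)
    case (insert x A)
    then have "quot_on (\<lambda>p. F x p + (\<Sum>k\<in>A. F k p)) U"
      by (intro quot_on_add assms(2,3) insert.prems insert.IH) auto
    then show ?case using insert by simp
  qed (auto intro!: quot_on_holomorphic assms)
qed (auto intro!: quot_on_holomorphic assms)

text \<open>If the denominator vanished on \<open>U\<close> after composition, it would vanish on
  the whole space by the identity theorem; but a nonconstant affine form is surjective and reaches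
  \<open>z0\<close>.\<close>

lemma quot_on_compose_linear:
  assumes hol: "g holomorphic_on UNIV" "h holomorphic_on UNIV" and nz: "h z0 \<noteq> 0"
    and eq: "\<And>z. h z \<noteq> 0 \<Longrightarrow> \<phi> z = g z / h z"
    and U: "open U" "U \<noteq> {}" and ab: "a \<noteq> 0 \<or> b \<noteq> 0"
  shows "quot_on (\<lambda>p. \<phi> (a * fst p + b * snd p + c)) U"
proof -
  define l where "l p = a * fst p + b * snd p + c" for p :: "complex \<times> complex"
  have hh: "holomorphic2_on (\<lambda>p. h (l p)) V" "holomorphic2_on (\<lambda>p. g (l p)) V" for V
    unfolding l_def using hol by (auto intro!: holomorphic2_on_compose_linear)
  have "\<exists>q\<in>U. h (l q) \<noteq> 0"
  proof (rule ccontr)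
    assume "\<not> (\<exists>q\<in>U. h (l q) \<noteq> 0)"
    then have 0: "h (l q) = 0" if "q \<in> U" for q using that by blast
    have "h (l p) = 0" for p
      by (rule holomorphic2_eq_0_on_connected[OF hh(1) open_UNIV connected_UNIV U(1)]) (use U 0 in auto)
    moreover have "\<exists>p. l p = z0"
    proof (cases "a = 0")
      case True
      then show ?thesis using ab by (intro exI[of _ "(0, (z0 - c) / b)"]) (simp add: l_def)
    next
      case False
      then show ?thesis by (intro exI[of _ "((z0 - c) / a, 0)"]) (simp add: l_def)
    qed
    ultimately show False using nz by metis
  qed
  then show ?thesis
    unfolding quot_on_def l_def[symmetric]
    by (intro exI[of _ "\<lambda>p. g (l p)"] exI[of _ "\<lambda>p. h (l p)"]) (use hh eq in auto)
qed

lemma xi_2: "xi 2 \<noteq> 0"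
  using riemann_zeta_nonzero[of 2] xi_eq_0_iff[of 2] by simp

text \<open>Gamma = 1/\<open>rGamma\<close>, \<open>M\<close> = \<open>M_num\<close>/((s - 1)
  \<open>xi\<close>) and zeta = \<open>xi\<close>/(s - 1) are quotients of entire functions,
  composed here with affine forms; the other factors are holomorphic on the domain.\<close>

lemma quot_on_cont_expr: "quot_on (cont_expr n) (rem_dom n)"
proof -
  let ?U = "rem_dom n"
  have "(1/2, 1) \<in> ?U" by (simp add: rem_dom_def)
  then have U: "open ?U" "connected ?U" "?U \<noteq> {}"
    using open_rem_dom convex_connected[OF convex_rem_dom] by blast+
  have G: "quot_on (\<lambda>p. Gamma (a * fst p + b * snd p + c)) ?U" if "a \<noteq> 0 \<or> b \<noteq> 0" for a b c
    by (rule quot_on_compose_linear[of "\<lambda>_. 1" rGamma 1])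
       (use U that in \<open>auto intro!: holomorphic_intros simp: rGamma_inverse_Gamma divide_inverse\<close>)
  have Mq: "quot_on (\<lambda>p. M (a * fst p + b * snd p + c)) ?U" if "a \<noteq> 0 \<or> b \<noteq> 0" for a b c
    by (rule quot_on_compose_linear[of M_num "\<lambda>s. (s - 1) * xi s" 2])
       (use U that xi_2 in \<open>auto intro!: holomorphic_intros M_num_holomorphic xi_holomorphic M_eq_quotient\<close>)
  have Z: "quot_on (\<lambda>p. riemann_zeta (a * fst p + b * snd p + c)) ?U" if "a \<noteq> 0 \<or> b \<noteq> 0" for a b c
    by (rule quot_on_compose_linear[of xi "\<lambda>s. s - 1" 2])
       (use U that in \<open>auto intro!: holomorphic_intros xi_holomorphic riemann_zeta_xi\<close>)
  have rG: "quot_on (\<lambda>p. rGamma (snd p)) ?U"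
    using U by (intro quot_on_holomorphic holomorphic2_snd_compose[of rGamma UNIV]) (auto intro: holomorphic_intros)
  have P: "quot_on (\<lambda>p. pochhammer (snd p) k) ?U" for k
    using U unfolding pochhammer_prod
    by (intro quot_on_holomorphic holomorphic2_snd_compose[of "\<lambda>z. \<Prod>i<k. z + of_nat i" UNIV, unfolded lessThan_atLeast0]) (auto intro!: holomorphic_intros)
  have R: "quot_on (rem_int n) ?U"
    by (rule quot_on_holomorphic[OF rem_int_holomorphic U(3)])
  have C: "quot_on (\<lambda>p. c) ?U" for c by (rule quot_on_holomorphic[OF holomorphic2_on_const U(3)])
  have G1: "quot_on (\<lambda>p. Gamma (1 - fst p)) ?U" using G[of "-1" 0 1] by simp
  have G2: "quot_on (\<lambda>p. Gamma (fst p + snd p - 1)) ?U" using G[of 1 1 "-1"] by simp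
  have M1: "quot_on (\<lambda>p. M (fst p + snd p - 1)) ?U" using Mq[of 1 1 "-1"] by simp
  have M2: "quot_on (\<lambda>p. M (snd p + of_nat k)) ?U" for k using Mq[of 0 1 "of_nat k"] by simp
  have Z1: "quot_on (\<lambda>p. riemann_zeta (fst p - of_nat k)) ?U" for k using Z[of 1 0 "- of_nat k"] by simp
  show ?thesis
    unfolding cont_expr_def[abs_def]
    by (intro quot_on_add quot_on_mult quot_on_sum U G1 G2 M1 M2 Z1 rG P R C)
qed

text \<open>Intersections of convex sets are connected and all contain \<open>V\<close>, so any two
  quotients agree on the overlap of their domains and no monodromy arises. At each point some pair
  with nonzero denominator is chosen; where there is none the value is arbitrary, as
  \<open>meromorphic2\<close> allows.\<close>

lemma glue_meromorphic2:
  fixes \<Omega> :: "'i \<Rightarrow> (complex \<times> complex) set"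
  assumes \<Omega>: "\<And>i. open (\<Omega> i)" "\<And>i. convex (\<Omega> i)" "(\<Union>i. \<Omega> i) = UNIV"
    and hol: "\<And>i. holomorphic2_on (g i) (\<Omega> i)" "\<And>i. holomorphic2_on (h i) (\<Omega> i)"
    and nz: "\<And>i. \<exists>q\<in>\<Omega> i. h i q \<noteq> 0"
    and V: "open V" "V \<noteq> {}" "\<And>i. V \<subseteq> \<Omega> i"
    and eq: "\<And>i q. q \<in> V \<Longrightarrow> h i q \<noteq> 0 \<Longrightarrow> g i q / h i q = f q"
  obtains F where "meromorphic2 F" "\<And>i q. q \<in> \<Omega> i \<Longrightarrow> h i q \<noteq> 0 \<Longrightarrow> F q = g i q / h i q"
proof -
  have con: "connected (\<Omega> i)" for i using \<Omega>(2) by (rule convex_connected)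
  have eq': "g i q * h j q = g j q * h i q" if q: "q \<in> \<Omega> i" "q \<in> \<Omega> j" for i j q
  proof -
    obtain q1 where q1: "q1 \<in> \<Omega> i" "h i q1 \<noteq> 0" using nz by blast
    obtain q2 where q2: "q2 \<in> \<Omega> j" "h j q2 \<noteq> 0" using nz by blast
    obtain W where W: "open W" "W \<noteq> {}" "W \<subseteq> V" "\<And>w. w \<in> W \<Longrightarrow> h i w \<noteq> 0"
      using holomorphic2_nonzero_dense[OF hol(2) \<Omega>(1) con q1 V(1) V(3) V(2)] by blast
    have "W \<subseteq> \<Omega> j" using W(3) V(3) by blast
    then obtain W' where W': "open W'" "W' \<noteq> {}" "W' \<subseteq> W" "\<And>w. w \<in> W' \<Longrightarrow> h j w \<noteq> 0"
      using holomorphic2_nonzero_dense[OF hol(2) \<Omega>(1) con q2 W(1) _ W(2)] by blast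
    have "g i q * h j q - g j q * h i q = 0"
    proof (rule holomorphic2_eq_0_on_connected[of "\<lambda>q. g i q * h j q - g j q * h i q" "\<Omega> i \<inter> \<Omega> j" W'])
      show "holomorphic2_on (\<lambda>q. g i q * h j q - g j q * h i q) (\<Omega> i \<inter> \<Omega> j)"
        using hol by (intro holomorphic2_on_diff holomorphic2_on_mult) (auto intro: holomorphic2_on_subset)
      show "open (\<Omega> i \<inter> \<Omega> j)" "connected (\<Omega> i \<inter> \<Omega> j)"
        using \<Omega> by (auto intro: open_Int convex_connected convex_Int)
      have "W' \<subseteq> \<Omega> i \<inter> \<Omega> j" using W'(3) W(3) V(3) by blast
      then show "W' \<inter> (\<Omega> i \<inter> \<Omega> j) \<noteq> {}" using W'(2) by blast
      fix w assume "w \<in> W' \<inter> (\<Omega> i \<inter> \<Omega> j)"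
      then have w: "w \<in> V" "h i w \<noteq> 0" "h j w \<noteq> 0" using W(3) W(4)[of w] W'(3) W'(4)[of w] by blast+
      then have "g i w / h i w = g j w / h j w" using eq by metis
      then show "g i w * h j w - g j w * h i w = 0" using w by (simp add: frac_eq_eq)
    qed (use W' q in auto)
    then show ?thesis by simp
  qed
  define F where "F q = (let i = (SOME i. q \<in> \<Omega> i \<and> h i q \<noteq> 0) in g i q / h i q)" for q
  have F: "F q = g i q / h i q" if "q \<in> \<Omega> i" "h i q \<noteq> 0" for i q
  proof -
    define j where "j = (SOME i. q \<in> \<Omega> i \<and> h i q \<noteq> 0)"
    have "q \<in> \<Omega> j \<and> h j q \<noteq> 0" unfolding j_def by (rule someI[of _ i]) (use that in auto)
    then show ?thesis using eq'[of q i j] that unfolding F_def Let_def j_def[symmetric]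
      by (simp add: frac_eq_eq)
  qed
  moreover have "meromorphic2 F"
    unfolding meromorphic2_def
  proof
    fix p
    obtain i where "p \<in> \<Omega> i" using \<Omega>(3) by blast
    then show "\<exists>U g h. open U \<and> connected U \<and> p \<in> U \<and> holomorphic2_on g U \<and> holomorphic2_on h U \<and>
        (\<exists>q\<in>U. h q \<noteq> 0) \<and> (\<forall>q\<in>U. h q \<noteq> 0 \<longrightarrow> F q = g q / h q)"
      using \<Omega>(1) con hol nz F by (intro exI[of _ "\<Omega> i"] exI[of _ "g i"] exI[of _ "h i"]) blast
  qed
  ultimately show ?thesis using that by blast
qed

lemma base_dom: "open base_dom" "base_dom \<noteq> {}" "base_dom \<subseteq> rem_dom n" "base_dom \<subseteq> conv_dom"
proof -
  have eq: "base_dom = ({s. Re s > 0} \<inter> {s. Re s < 1}) \<times> {s. Re s > 2}" by (auto simp: base_dom_def)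
  show "open base_dom"
    unfolding eq by (intro open_Times open_Int open_halfspace_Re_gt open_halfspace_Re_lt)
  have "(1/2, 3) \<in> base_dom" by (simp add: base_dom_def)
  then show "base_dom \<noteq> {}" by blast
qed (auto simp: base_dom_def rem_dom_def conv_dom_def)

lemma UN_rem_dom: "(\<Union>n. rem_dom n) = UNIV"
proof (intro set_eqI iffI UNIV_I)
  fix p :: "complex \<times> complex"
  obtain n where "max (\<bar>Re (fst p)\<bar>) (\<bar>Re (snd p)\<bar>) < real n" using reals_Archimedean2 by blast
  then have "p \<in> rem_dom n" by (auto simp: rem_dom_def)
  then show "p \<in> (\<Union>n. rem_dom n)" by blast
qed

text \<open>The sets \<open>rem_dom n\<close> are joined by \<open>conv_dom\<close>, under the index
  \<open>None\<close>, with denominator 1. This makes \<open>F\<close> equal to the series at every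
  point of convergence, as the definition of \<open>Phi2\<close> demands, and not merely off some
  denominators.\<close>

lemma continuation_exists:
  obtains F where "meromorphic2 F" "\<And>p. p \<in> conv_dom \<Longrightarrow> F p = pair_sum p"
    "\<And>n u v. (u, v) \<in> rem_dom n \<Longrightarrow> \<forall>\<^sub>F y in at v. \<forall>\<^sub>F x in at u. F (x, y) = cont_expr n (x, y)"
proof -
  have "\<forall>n. \<exists>g h. holomorphic2_on g (rem_dom n) \<and> holomorphic2_on h (rem_dom n) \<and>
     (\<exists>q\<in>rem_dom n. h q \<noteq> 0) \<and> (\<forall>q\<in>rem_dom n. h q \<noteq> 0 \<longrightarrow> cont_expr n q = g q / h q)"
    using quot_on_cont_expr unfolding quot_on_def by blast
  then obtain g h where gh: "\<And>n. holomorphic2_on (g n) (rem_dom n)" "\<And>n. holomorphic2_on (h n) (rem_dom n)"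
     "\<And>n. \<exists>q\<in>rem_dom n. h n q \<noteq> 0" "\<And>n q. q \<in> rem_dom n \<Longrightarrow> h n q \<noteq> 0 \<Longrightarrow> cont_expr n q = g n q / h n q"
    by metis
  define \<Omega> where "\<Omega> = case_option conv_dom rem_dom"
  define g' where "g' = case_option pair_sum g"
  define h' where "h' = case_option (\<lambda>_. 1) h"
  obtain F where F: "meromorphic2 F" "\<And>i q. q \<in> \<Omega> i \<Longrightarrow> h' i q \<noteq> 0 \<Longrightarrow> F q = g' i q / h' i q"
  proof (rule glue_meromorphic2[of \<Omega> g' h' base_dom pair_sum])
    show "open (\<Omega> i)" "convex (\<Omega> i)" for i
      by (cases i; simp add: \<Omega>_def open_conv_dom convex_conv_dom open_rem_dom convex_rem_dom)+
    show "(\<Union>i. \<Omega> i) = UNIV"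
      using UN_rem_dom by (auto simp: \<Omega>_def split: option.splits intro!: exI[of _ "Some _"])
    show "holomorphic2_on (g' i) (\<Omega> i)" "holomorphic2_on (h' i) (\<Omega> i)" for i
      by (cases i; simp add: \<Omega>_def g'_def h'_def gh pair_sum_holomorphic)+
    show "\<exists>q\<in>\<Omega> i. h' i q \<noteq> 0" for i
      using base_dom by (cases i) (auto simp: \<Omega>_def h'_def gh(3))
    show "open base_dom" "base_dom \<noteq> {}" by (rule base_dom)+
    show "base_dom \<subseteq> \<Omega> i" for i using base_dom by (cases i) (auto simp: \<Omega>_def)
    show "g' i q / h' i q = pair_sum q" if "q \<in> base_dom" "h' i q \<noteq> 0" for i q
    proof (cases i)
      case (Some n)
      then show ?thesis using that gh(4)[of q n] pair_sum_eq_cont_expr[of q n] base_dom(3)[of n]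
        by (auto simp: g'_def h'_def)
    qed (simp add: g'_def h'_def)
    fix F assume "meromorphic2 F" "\<And>i q. q \<in> \<Omega> i \<Longrightarrow> h' i q \<noteq> 0 \<Longrightarrow> F q = g' i q / h' i q"
    then show thesis by (rule that)
  qed
  show ?thesis
  proof (rule that[OF F(1)])
    show "F p = pair_sum p" if "p \<in> conv_dom" for p
      using F(2)[of p None] that by (simp add: \<Omega>_def g'_def h'_def)
    fix n u v assume uv: "(u, v) \<in> rem_dom n"
    obtain q where q: "q \<in> rem_dom n" "h n q \<noteq> 0" using gh(3) by blast
    have "\<forall>\<^sub>F y in at v. \<forall>\<^sub>F x in at u. (x, y) \<in> rem_dom n \<and> h n (x, y) \<noteq> 0"
      by (rule holomorphic2_eventually_nonzero[OF gh(2) open_rem_dom convex_connected[OF convex_rem_dom] q uv])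
    then show "\<forall>\<^sub>F y in at v. \<forall>\<^sub>F x in at u. F (x, y) = cont_expr n (x, y)"
    proof eventually_elim
      case (elim y)
      then show ?case
      proof eventually_elim
        case (elim x)
        then show ?case using F(2)[of "(x, y)" "Some n"] gh(4)[of "(x, y)" n]
          by (simp add: \<Omega>_def g'_def h'_def)
      qed
    qed
  qed
qed

lemma pair_sum_infsum:
  assumes "(s1, s2) \<in> conv_dom"
  shows "pair_sum (s1, s2) = (\<Sum>\<^sub>\<infinity>(m1, m2)\<in>{1::nat..} \<times> {1::nat..}. mangoldt m2 / (of_nat m1 powr s1 * of_nat (m1 + m2) powr s2))"
proof -
  have "pair_term (s1, s2) = (\<lambda>(m1, m2). mangoldt m2 / (of_nat m1 powr s1 * of_nat (m1 + m2) powr s2))"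
    by (auto simp: pair_term_def powr_minus divide_inverse)
  then show ?thesis
    using infsetsum_infsum[OF abs_summable_pair_term[OF assms]] by (simp add: pair_sum_def)
qed

text \<open>Existence gives the function picked by \<open>SOME\<close> its properties, and
  uniqueness from \<open>base_dom\<close> identifies it with the glued continuation, up to the
  points that an iterated limit cannot see.\<close>

lemma Phi2_eventually_eq:
  assumes uv: "(u, v) \<in> rem_dom n"
  shows "\<forall>\<^sub>F y in at v. \<forall>\<^sub>F x in at u. Phi2 (x, y) = cont_expr n (x, y)"
proof -
  obtain F where F: "meromorphic2 F" "\<And>p. p \<in> conv_dom \<Longrightarrow> F p = pair_sum p"
    "\<And>n u v. (u, v) \<in> rem_dom n \<Longrightarrow> \<forall>\<^sub>F y in at v. \<forall>\<^sub>F x in at u. F (x, y) = cont_expr n (x, y)"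
    using continuation_exists by blast
  have "\<exists>F. meromorphic2 F \<and> (\<forall>s1 s2. Re s2 > 1 \<longrightarrow> Re (s1 + s2) > 2 \<longrightarrow>
        F (s1, s2) = (\<Sum>\<^sub>\<infinity>(m1, m2)\<in>{1::nat..} \<times> {1::nat..}. mangoldt m2 / (of_nat m1 powr s1 * of_nat (m1 + m2) powr s2)))"
    using F(1,2) pair_sum_infsum by (intro exI[of _ F]) (simp add: conv_dom_def)
  from someI_ex[OF this] have Phi: "meromorphic2 Phi2" and
    "\<And>s1 s2. Re s2 > 1 \<Longrightarrow> Re (s1 + s2) > 2 \<Longrightarrow>
        Phi2 (s1, s2) = (\<Sum>\<^sub>\<infinity>(m1, m2)\<in>{1::nat..} \<times> {1::nat..}. mangoldt m2 / (of_nat m1 powr s1 * of_nat (m1 + m2) powr s2))"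
    unfolding Phi2_def by blast+
  then have "Phi2 q = F q" if "q \<in> conv_dom" for q
    using that F(2)[OF that] pair_sum_infsum[of "fst q" "snd q"] by (cases q) (simp add: conv_dom_def)
  then have "\<forall>\<^sub>F y in at v. \<forall>\<^sub>F x in at u. Phi2 (x, y) = F (x, y)"
    using base_dom(1,2,4) by (intro meromorphic2_eventually_eq[OF Phi F(1), of base_dom]) auto
  with F(3)[OF uv] show ?thesis
  proof eventually_elim
    case (elim y)
    then show ?case by eventually_elim simp
  qed
qed

section \<open>The reverse value\<close>

text \<open>Ensures that \<open>M\<close> has no poles at odd negative integers, where both the odd
  sum and the last term of the statement evaluate it.\<close>

lemma riemann_zeta_neg_neq_0:
  assumes "odd k"
  shows "riemann_zeta (- of_nat k) \<noteq> 0"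
  using bernoulli_even_neq_0[of "k + 1"] assms odd_pos[OF assms]
  unfolding riemann_zeta_neg by (simp del: of_nat_Suc of_nat_add)

lemma riemann_zeta_neg_even_eq_0:
  assumes "even k" "k > 0"
  shows "riemann_zeta (- of_nat k) = 0"
  using bernoulli_odd_eq_0[of "k + 1"] assms unfolding riemann_zeta_neg by simp

lemma riemann_zeta_0_neq_0: "riemann_zeta 0 \<noteq> 0"
  using M_0 pi_gt3 by (auto simp: M_def)

lemma neg_of_nat_neq_1: "- of_nat k \<noteq> (1::complex)"
proof
  assume "- of_nat k = (1::complex)"
  then have "Re (- of_nat k) = 1" by simp
  then show False by simp
qed

lemma isCont_riemann_zeta: "s \<noteq> 1 \<Longrightarrow> isCont riemann_zeta s"
  using holomorphic_on_imp_continuous_on[OF riemann_zeta_props(1)]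
  by (simp add: continuous_on_eq_continuous_at open_Compl)

lemma isCont_rem_int:
  assumes "(u, v) \<in> rem_dom n"
  shows "isCont (rem_int n) (u, v)"
  using holomorphic2_on_imp_continuous_on[OF rem_int_holomorphic] assms
  by (simp add: continuous_on_eq_continuous_at open_rem_dom)

text \<open>Keeps \<open>s2\<close> away from the values at which Gamma(s1 + s2 - 1) has a pole for
  \<open>s1 = - of_nat m\<close>.\<close>

lemma eventually_not_Ints: "\<forall>\<^sub>F s in at (- of_nat n). s \<notin> (\<int> :: complex set)"
proof -
  have "\<forall>\<^sub>F s in at (- of_nat n :: complex). s \<in> ball (- of_nat n) 1 - {- of_nat n}"
    by (intro eventually_at_in_open) auto
  then show ?thesis
  proof (rule eventually_mono)
    fix s :: complex assume s: "s \<in> ball (- of_nat n) 1 - {- of_nat n}"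
    show "s \<notin> \<int>"
    proof
      assume "s \<in> \<int>"
      then obtain j where j: "s = of_int j" by (auto elim: Ints_cases)
      have "dist (- of_nat n) s = norm (complex_of_int (- int n - j))" by (simp add: dist_norm j)
      also have "\<dots> = \<bar>real_of_int (- int n - j)\<bar>" by (rule norm_of_int)
      finally have "dist (- of_nat n) s = real_of_int \<bar>- int n - j\<bar>" by (simp only: of_int_abs)
      moreover have "dist (- of_nat n) s < 1" using s by (simp only: Diff_iff mem_ball)
      ultimately have "\<bar>- int n - j\<bar> < 1" by (simp only: of_int_less_1_iff)
      then have "j = - int n" by linarith
      then show False using s j by simp
    qed
  qed
qed

section \<open>Limits of the individual terms\<close>

lemma pochhammer_neg_div_fact:
  "complex_of_real ((-1) ^ k / fact k) * pochhammer (- of_nat n) k = of_nat (n choose k)"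
  using gbinomial_pochhammer[of "of_nat n :: complex" k] by (simp add: binomial_gbinomial)

definition cont_term :: "nat \<Rightarrow> complex \<Rightarrow> complex \<Rightarrow> complex" where
  "cont_term k s1 s2 = of_real ((-1) ^ k / fact k) * pochhammer s2 k * riemann_zeta (s1 - of_nat k) * M (s2 + of_nat k)"

text \<open>In the inner limit only the zeta factor varies, and its argument tends to a non-positive
  integer, hence not to the pole.\<close>

lemma cont_term_0_tendsto: "((\<lambda>s1. cont_term k s1 s2) \<longlongrightarrow> cont_term k (- of_nat m) s2) (at (- of_nat m))"
proof -
  have "- of_nat m - of_nat k \<noteq> (1::complex)" using neg_of_nat_neq_1[of "m + k"] by simp
  then have "isCont (\<lambda>s1. riemann_zeta (s1 - of_nat k)) (- of_nat m)"
    by (intro isCont_o2[OF _ isCont_riemann_zeta] continuous_intros)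
  then show ?thesis unfolding cont_term_def isCont_def by (intro tendsto_intros)
qed

lemma neg_add: "- of_nat m - of_nat k = - (of_nat (m + k) :: complex)" by simp

lemma isCont_pochhammer: "isCont (\<lambda>s :: complex. pochhammer (s + c) k) z"
  unfolding pochhammer_prod by (intro continuous_intros)

lemma cont_term_limit_regular:
  assumes "of_nat k - of_nat n \<noteq> (1 :: complex)" "riemann_zeta (of_nat k - of_nat n) \<noteq> 0"
  shows "((\<lambda>s2. cont_term k (- of_nat m) s2) \<longlongrightarrow> cont_term k (- of_nat m) (- of_nat n)) (at (- of_nat n))"
proof -
  have "isCont (\<lambda>s2. M (s2 + of_nat k)) (- of_nat n)"
    using assms by (intro isCont_o2[OF _ isCont_M] continuous_intros) auto
  moreover have "isCont (\<lambda>s2 :: complex. pochhammer s2 k) (- of_nat n)"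
    using isCont_pochhammer[where c=0] by simp
  ultimately show ?thesis unfolding cont_term_def isCont_def by (intro tendsto_intros)
qed

text \<open>The Pochhammer symbol vanishes at -n because k > n, and \<open>M\<close> is regular at k
  - n >= 2.\<close>

lemma cont_term_limit_gt:
  assumes "k > n + 1"
  shows "((\<lambda>s2. cont_term k (- of_nat m) s2) \<longlongrightarrow> 0) (at (- of_nat n))"
proof -
  have eq: "of_nat k - of_nat n = (of_nat (k - n) :: complex)" using assms by (simp add: of_nat_diff)
  have "k - n \<noteq> 1" "real (k - n) > 1" using assms by auto
  then have "of_nat k - of_nat n \<noteq> (1 :: complex)" "riemann_zeta (of_nat k - of_nat n) \<noteq> 0"
    unfolding eq by (metis of_nat_1 of_nat_eq_iff, intro riemann_zeta_nonzero, simp)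
  from cont_term_limit_regular[OF this]
  have "((\<lambda>s2. cont_term k (- of_nat m) s2) \<longlongrightarrow> cont_term k (- of_nat m) (- of_nat n)) (at (- of_nat n))" .
  moreover have "pochhammer (- of_nat n :: complex) k = 0"
    using assms by (intro pochhammer_of_nat_eq_0_lemma) simp
  then have "cont_term k (- of_nat m) (- of_nat n) = 0" by (simp add: cont_term_def)
  ultimately show ?thesis by simp
qed

text \<open>The last factor s + n of the Pochhammer symbol vanishes in the limit and equals (s + n +
  1) - 1, which is just what compensates the simple pole of \<open>M\<close> at 1.\<close>

lemma cont_term_limit_Suc:
  "((\<lambda>s2. cont_term (Suc n) (- of_nat m) s2) \<longlongrightarrow>
     of_real (bernoulli (m + n + 2)) / (of_nat (n + 1) * of_nat (m + n + 2))) (at (- of_nat n))"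
proof -
  define c where "c = complex_of_real ((-1) ^ Suc n / fact (Suc n)) * riemann_zeta (- of_nat m - of_nat (Suc n))"
  have "filterlim (\<lambda>s. s + of_nat (Suc n)) (at 1) (at (- of_nat n :: complex))"
  proof (rule filterlim_atI)
    have "((\<lambda>s. s + of_nat (Suc n)) \<longlongrightarrow> - of_nat n + of_nat (Suc n)) (at (- of_nat n :: complex))"
      by (intro tendsto_intros)
    then show "((\<lambda>s. s + of_nat (Suc n)) \<longlongrightarrow> 1) (at (- of_nat n :: complex))" by simp
    have "\<forall>\<^sub>F s in at (- of_nat n :: complex). s \<noteq> - of_nat n" by (simp add: eventually_at_filter)
    then show "\<forall>\<^sub>F s in at (- of_nat n :: complex). s + of_nat (Suc n) \<noteq> 1"
      by eventually_elim (auto simp: add_eq_0_iff algebra_simps)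
  qed
  from filterlim_compose[OF tendsto_M_at_1 this]
  have "((\<lambda>s. (s + of_nat (Suc n) - 1) * M (s + of_nat (Suc n))) \<longlongrightarrow> 1) (at (- of_nat n))" .
  moreover have "((\<lambda>s::complex. pochhammer s n) \<longlongrightarrow> pochhammer (- of_nat n) n) (at (- of_nat n))"
    using isCont_pochhammer[where c=0 and k=n and z="- of_nat n"] by (simp add: isCont_def)
  ultimately have "((\<lambda>s. c * (pochhammer s n * ((s + of_nat (Suc n) - 1) * M (s + of_nat (Suc n))))) \<longlongrightarrow>
      c * (pochhammer (- of_nat n) n * 1)) (at (- of_nat n))"
    by (intro tendsto_intros)
  moreover have "c * (pochhammer s n * ((s + of_nat (Suc n) - 1) * M (s + of_nat (Suc n)))) = cont_term (Suc n) (- of_nat m) s" for s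
  proof -
    have "s + of_nat (Suc n) - 1 = s + of_nat n" by simp
    then show ?thesis by (simp only: c_def cont_term_def pochhammer_rec' mult_ac)
  qed
  moreover have "c * (pochhammer (- of_nat n) n * 1) = of_real (bernoulli (m + n + 2)) / (of_nat (n + 1) * of_nat (m + n + 2))"
  proof -
    have z: "riemann_zeta (- of_nat m - of_nat (Suc n)) = - of_real (bernoulli (m + n + 2)) / of_nat (m + n + 2)"
      using riemann_zeta_neg[of "m + Suc n"] unfolding neg_add by simp
    have "complex_of_real ((-1) ^ Suc n / fact (Suc n)) * ((-1) ^ n * fact n) = - 1 / of_nat (n + 1)"
      by (simp del: of_nat_Suc)
    then have "complex_of_real ((-1) ^ Suc n / fact (Suc n)) * ((-1) ^ n * fact n) * (- of_real (bernoulli (m + n + 2)) / of_nat (m + n + 2)) =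
       of_real (bernoulli (m + n + 2)) / (of_nat (n + 1) * of_nat (m + n + 2))"
      by (simp del: of_nat_add of_nat_Suc)
    then show ?thesis unfolding c_def z pochhammer_same mult_1_right by (simp only: mult_ac)
  qed
  ultimately show ?thesis by simp
qed

text \<open>Indexed by j = n - k, the summation index of the statement, so that \<open>M\<close> is
  evaluated at -j.\<close>

definition limit_term :: "nat \<Rightarrow> nat \<Rightarrow> nat \<Rightarrow> complex" where
  "limit_term m n j = (if even j \<and> j > 0 then 0 else
     of_nat (n choose j) * riemann_zeta (- of_nat (m + n - j)) * M (- of_nat j))"

lemma cont_term_limit_le:
  assumes par: "even (m + n)" "n \<ge> 2 \<Longrightarrow> m \<ge> 1" and j: "j \<le> n"
  shows "((\<lambda>s2. cont_term (n - j) (- of_nat m) s2) \<longlongrightarrow> limit_term m n j) (at (- of_nat n))"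
proof -
  have nj: "of_nat (n - j) - of_nat n = (- of_nat j :: complex)" using j by (simp add: of_nat_diff)
  have z: "- of_nat m - of_nat (n - j) = (- of_nat (m + n - j) :: complex)"
    unfolding neg_add using j by simp
  show ?thesis
  proof (cases "even j \<and> j > 0")
    case True
    have "even (m + n - j)" using par(1) True j by simp
    \<comment> \<open>The assumption linking \<open>m\<close> and \<open>n\<close> enters here: an
      even \<open>j\<close> with 0 < j <= n forces n >= 2, hence m >= 1. For m = 0 and j = n the
      zeta factor would be zeta(0), which is not 0.\<close>
    moreover have "m + n - j > 0"
      using par(2) True j by (cases "n \<ge> 2") (auto elim!: evenE)
    ultimately have "riemann_zeta (- of_nat m - of_nat (n - j)) = 0"
      unfolding z by (rule riemann_zeta_neg_even_eq_0)
    then show ?thesis using True by (simp add: cont_term_def limit_term_def)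
  next
    case False
    have "riemann_zeta (- of_nat j) \<noteq> 0"
      using False riemann_zeta_neg_neq_0[of j] riemann_zeta_0_neq_0 by (cases "j = 0") auto
    then have "((\<lambda>s2. cont_term (n - j) (- of_nat m) s2) \<longlongrightarrow> cont_term (n - j) (- of_nat m) (- of_nat n)) (at (- of_nat n))"
      by (intro cont_term_limit_regular) (simp_all only: nj neg_of_nat_neq_1 not_False_eq_True)
    also have "cont_term (n - j) (- of_nat m) (- of_nat n) = limit_term m n j"
    proof -
      have "- of_nat n + of_nat (n - j) = (- of_nat j :: complex)" using j by (simp add: of_nat_diff)
      moreover have "n choose (n - j) = n choose j" using j by (rule binomial_symmetric[symmetric])
      ultimately show ?thesis
        unfolding cont_term_def limit_term_def z using False pochhammer_neg_div_fact[of "n - j" n]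
        by auto
    qed
    finally show ?thesis .
  qed
qed

lemma limit_term_0: "limit_term m n 0 = of_real (ln (2 * pi)) * (of_real (bernoulli (m + n + 1)) / of_nat (m + n + 1))"
proof -
  have "limit_term m n 0 = riemann_zeta (- of_nat (m + n)) * M 0" by (simp add: limit_term_def)
  then show ?thesis unfolding riemann_zeta_neg M_0 by (simp add: mult.commute)
qed

lemma limit_term_odd:
  assumes "odd k" "k \<le> n"
  shows "limit_term m n k = - (of_nat (n choose k) * (of_nat (k + 1) / of_real (bernoulli (k + 1))) *
     deriv riemann_zeta (- of_nat k) * (of_real (bernoulli (m + n - k + 1)) / of_nat (m + n - k + 1)))"
proof -
  have "M (- of_nat k) = deriv riemann_zeta (- of_nat k) * (of_nat (k + 1) / of_real (bernoulli (k + 1)))"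
    unfolding M_def riemann_zeta_neg by (simp del: of_nat_Suc of_nat_add)
  then show ?thesis
    unfolding limit_term_def riemann_zeta_neg using assms by (simp add: mult_ac del: of_nat_Suc of_nat_add)
qed

definition main_term :: "complex \<Rightarrow> complex \<Rightarrow> complex" where
  "main_term s1 s2 = Gamma (1 - s1) * Gamma (s1 + s2 - 1) * rGamma s2 * M (s1 + s2 - 1)"

lemma main_term_arg: "- of_nat m + s - 1 = s - (of_nat (m + 1) :: complex)"
  by simp

text \<open>For \<open>s2\<close> off the integers Gamma(s1 + s2 - 1) stays clear of its poles, and
  the condition on zeta keeps \<open>M\<close> regular.\<close>

lemma main_term_fst_tendsto:
  assumes "s2 \<notin> \<int>" "riemann_zeta (- of_nat m + s2 - 1) \<noteq> 0"
  shows "((\<lambda>s1. main_term s1 s2) \<longlongrightarrow> main_term (- of_nat m) s2) (at (- of_nat m))"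
proof -
  have nI: "- of_nat m + s2 - 1 \<notin> \<int>"
  proof
    assume "- of_nat m + s2 - 1 \<in> \<int>"
    then have "(- of_nat m + s2 - 1) + of_nat (m + 1) \<in> \<int>" by (intro Ints_add Ints_of_nat)
    then show False using assms(1) by simp
  qed
  then have "- of_nat m + s2 - 1 \<notin> \<int>\<^sub>\<le>\<^sub>0" using nonpos_Ints_Int by blast
  moreover have "- of_nat m + s2 - 1 \<noteq> 1" using nI by (metis Ints_1)
  moreover have "1 - - of_nat m \<notin> (\<int>\<^sub>\<le>\<^sub>0 :: complex set)" by (intro not_nonpos_Int_Re) simp
  ultimately have "isCont (\<lambda>s1. Gamma (1 - s1)) (- of_nat m :: complex)"
    "isCont (\<lambda>s1. Gamma (s1 + s2 - 1)) (- of_nat m)" "isCont (\<lambda>s1. M (s1 + s2 - 1)) (- of_nat m)"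
    using assms(2) by (auto intro!: isCont_o2[OF _ isCont_M] continuous_intros)
  then show ?thesis unfolding main_term_def isCont_def by (intro tendsto_mult tendsto_const)
qed

text \<open>At s1 = -m the pole of Gamma at -(m + n + 1) meets the zero of 1/Gamma at -n: the
  product Gamma(s - (m + 1))/Gamma(s) is the reciprocal of a Pochhammer symbol that is nonzero in
  the limit. As m + n is even, \<open>M\<close> is evaluated at an odd negative integer and is
  continuous there.\<close>

lemma main_term_limit:
  assumes par: "even (m + n)"
  shows "((\<lambda>s2. main_term (- of_nat m) s2) \<longlongrightarrow>
     - ((- 1) ^ m * fact m * fact n / fact (m + n + 1) * M (- of_nat (m + n + 1)))) (at (- of_nat n))"
proof -
  define c where "c = (of_nat (m + 1) :: complex)"
  have arg: "- of_nat n - c = - of_nat (m + n + 1)" by (simp add: c_def)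
  have poch: "pochhammer (- of_nat (m + n + 1) :: complex) (m + 1) = (-1) ^ (m + 1) * (fact (m + n + 1) / fact n)"
  proof -
    have "pochhammer (- of_nat (m + n + 1) :: complex) (m + 1) = (-1) ^ (m + 1) * pochhammer (of_nat (n + 1)) (m + 1)"
    proof -
      have "of_nat (m + n + 1) - of_nat (m + 1) + 1 = (of_nat (n + 1) :: complex)" by simp
      then show ?thesis by (simp only: pochhammer_minus)
    qed
    also have "pochhammer (of_nat (n + 1) :: complex) (m + 1) = fact (m + n + 1) / fact n"
    proof -
      have "fact (n + (m + 1)) = fact n * pochhammer (of_nat (n + 1) :: complex) (m + 1)"
        unfolding pochhammer_fact pochhammer_product'[of 1 n "m + 1"] of_nat_add of_nat_1 by (simp only: add.commute)
      then show ?thesis by (simp add: field_simps add_ac del: fact_Suc of_nat_Suc)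
    qed
    finally show ?thesis .
  qed
  have poch0: "pochhammer (- of_nat (m + n + 1) :: complex) (m + 1) \<noteq> 0"
    unfolding poch by (simp del: fact_Suc)
  have "isCont (\<lambda>s. M (s - c)) (- of_nat n)"
    using neg_of_nat_neq_1[of "m + n + 1"] riemann_zeta_neg_neq_0[of "m + n + 1"] par
    by (intro isCont_o2[OF _ isCont_M] continuous_intros) (simp_all only: arg, simp_all)
  then have 1: "((\<lambda>s. M (s - c)) \<longlongrightarrow> M (- of_nat (m + n + 1))) (at (- of_nat n))"
    unfolding isCont_def arg .
  have 2: "((\<lambda>s. pochhammer (s - c) (m + 1)) \<longlongrightarrow> pochhammer (- of_nat (m + n + 1)) (m + 1)) (at (- of_nat n))"
    using isCont_pochhammer[where c="- c" and k="m + 1" and z="- of_nat n"] unfolding isCont_def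
    by (simp only: add_uminus_conv_diff arg)
  have "((\<lambda>s. fact m * (1 / pochhammer (s - c) (m + 1)) * M (s - c)) \<longlongrightarrow>
      fact m * (1 / pochhammer (- of_nat (m + n + 1)) (m + 1)) * M (- of_nat (m + n + 1))) (at (- of_nat n))"
    using 1 2 poch0 by (intro tendsto_intros)
  moreover have "\<forall>\<^sub>F s in at (- of_nat n). fact m * (1 / pochhammer (s - c) (m + 1)) * M (s - c) = main_term (- of_nat m) s"
    using eventually_not_Ints[of n]
  proof eventually_elim
    case (elim s)
    have nI: "s - c \<notin> \<int>"
    proof
      assume "s - c \<in> \<int>"
      then have "(s - c) + of_nat (m + 1) \<in> \<int>" by (intro Ints_add Ints_of_nat)
      then show False using elim by (simp add: c_def)
    qed
    then have "s - c \<notin> \<int>\<^sub>\<le>\<^sub>0" using nonpos_Ints_Int by blast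
    then have "rGamma (s - c) \<noteq> 0" by (simp add: rGamma_eq_zero_iff)
    moreover have "rGamma (s - c) = pochhammer (s - c) (m + 1) * rGamma s"
      using pochhammer_rGamma[of "s - c" "m + 1"] by (simp add: c_def)
    ultimately have "Gamma (s - c) * rGamma s = 1 / pochhammer (s - c) (m + 1)"
      unfolding Gamma_def by (simp add: field_simps)
    moreover have "Gamma (1 - - of_nat m) = (fact m :: complex)"
      using Gamma_fact[of m, where 'a=complex] by (simp add: add.commute)
    ultimately show ?case
      unfolding main_term_def main_term_arg c_def[symmetric] by (simp only: mult.assoc)
  qed
  ultimately have "((\<lambda>s. main_term (- of_nat m) s) \<longlongrightarrow>
     fact m * (1 / pochhammer (- of_nat (m + n + 1)) (m + 1)) * M (- of_nat (m + n + 1))) (at (- of_nat n))"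
    by (rule Lim_transform_eventually)
  also have "fact m * (1 / pochhammer (- of_nat (m + n + 1)) (m + 1)) * M (- of_nat (m + n + 1)) =
     - ((- 1) ^ m * fact m * fact n / fact (m + n + 1) * M (- of_nat (m + n + 1)))"
  proof -
    have "1 / ((-1) ^ (m + 1) * (F / N)) = - ((-1) ^ m * N / F)" for F N :: complex
      by (cases "even m") auto
    then show ?thesis unfolding poch by simp
  qed
  finally show ?thesis .
qed

theorem proposition5p1:
  fixes m n :: nat
  assumes "even (m + n)" and "n \<ge> 2 \<Longrightarrow> m \<ge> 1"
  shows "has_reverse_value Phi2 (- of_nat m) (- of_nat n)
    (of_real (bernoulli (m + n + 2)) / (of_nat (n + 1) * of_nat (m + n + 2))
     + of_real (ln (2 * pi)) * (of_real (bernoulli (m + n + 1)) / of_nat (m + n + 1))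
     - (\<Sum>k\<in>{k\<in>{1..n}. odd k}. of_nat (n choose k) *
          (of_nat (k + 1) / of_real (bernoulli (k + 1))) * deriv riemann_zeta (- of_nat k) *
          (of_real (bernoulli (m + n - k + 1)) / of_nat (m + n - k + 1)))
     + (\<Sum>k\<in>{k\<in>{1..n}. even k}. of_nat (n choose k) *
          (of_real (bernoulli (m + n - k + 1)) / of_nat (m + n - k + 1)) *
          (- a_coeff k + fact k * b_coeff k))
     - (- 1) ^ m * fact m * fact n / fact (m + n + 1) * M (- of_nat (m + n + 1)))"
    (is "has_reverse_value _ _ _ (?B + ?L - ?O + ?E - ?R)")
proof -
  \<comment> \<open>Large enough for the point to lie in \<open>rem_dom K\<close> and for k = n + 1
    to occur in the sum.\<close>
  define K where "K = m + n + 2"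
  define u where "u = (- of_nat m :: complex)"
  define v where "v = (- of_nat n :: complex)"
  have cont: "cont_expr K (x, y) = main_term x y + (\<Sum>k<Suc K. cont_term k x y) + rGamma y * rem_int K (x, y)" for x y
    by (simp add: cont_expr_def main_term_def cont_term_def)
  have uv: "(u, v) \<in> rem_dom K" by (simp add: rem_dom_def u_def v_def K_def)
  have "((\<lambda>s2. riemann_zeta (u + s2 - 1)) \<longlongrightarrow> riemann_zeta (- of_nat (m + n + 1))) (at v)"
  proof -
    have arg: "u + v - 1 = - of_nat (m + n + 1)" by (simp add: u_def v_def)
    have "isCont (\<lambda>s2. riemann_zeta (u + s2 - 1)) v"
      using neg_of_nat_neq_1[of "m + n + 1"]
      by (intro isCont_o2[OF _ isCont_riemann_zeta] continuous_intros) (simp only: arg not_False_eq_True)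
    then show ?thesis unfolding isCont_def arg .
  qed
  \<comment> \<open>The limit is zeta at an odd negative integer, hence nonzero, and this persists
    for \<open>s2\<close> close to \<open>v\<close>; it is what the inner limit of the main term
    requires.\<close>
  then have nz: "\<forall>\<^sub>F s2 in at v. riemann_zeta (u + s2 - 1) \<noteq> 0"
    using riemann_zeta_neg_neq_0[of "m + n + 1"] assms(1) by (intro tendsto_imp_eventually_ne) auto
  have dom: "\<forall>\<^sub>F s2 in at v. (u, s2) \<in> rem_dom K"
  proof -
    have "\<forall>\<^sub>F s2 in at v. s2 \<in> {s. Re s > - real K}"
      using uv by (intro eventually_at_in_open' open_halfspace_Re_gt) (simp add: rem_dom_def)
    then show ?thesis by (rule eventually_mono) (use uv in \<open>simp add: rem_dom_def\<close>)
  qed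
  \<comment> \<open>For generic \<open>s2\<close> the explicit expression replaces
    \<open>Phi2\<close> and is continuous in \<open>s1\<close> at \<open>u\<close>; its value there
    is the witness for the inner limit function.\<close>
  have inner: "\<forall>\<^sub>F s2 in at v. ((\<lambda>s1. Phi2 (s1, s2)) \<longlongrightarrow> cont_expr K (u, s2)) (at u)"
    using Phi2_eventually_eq[OF uv] nz dom eventually_not_Ints[of n, folded v_def]
  proof eventually_elim
    case (elim s2)
    have "isCont (\<lambda>s1. rem_int K (s1, s2)) u"
      by (rule isCont_o2[where f="\<lambda>s1. (s1, s2)" and g="rem_int K", OF _ isCont_rem_int[OF elim(3)]])
         (intro continuous_intros)
    then have "((\<lambda>s1. rem_int K (s1, s2)) \<longlongrightarrow> rem_int K (u, s2)) (at u)" by (simp add: isCont_def)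
    then have "((\<lambda>s1. cont_expr K (s1, s2)) \<longlongrightarrow> cont_expr K (u, s2)) (at u)"
      using main_term_fst_tendsto[OF elim(4), of m] elim(2) cont_term_0_tendsto[of _ s2 m] unfolding cont u_def
      by (intro tendsto_intros) auto
    moreover have "\<forall>\<^sub>F s1 in at u. cont_expr K (s1, s2) = Phi2 (s1, s2)"
      using elim(1) by eventually_elim simp
    ultimately show ?case by (rule Lim_transform_eventually)
  qed
  define lt where "lt k = (if k \<le> n then limit_term m n (n - k) else if k = Suc n then ?B else 0)" for k
  have ct: "((\<lambda>s2. cont_term k u s2) \<longlongrightarrow> lt k) (at v)" for k
  proof -
    consider "k \<le> n" | "k = Suc n" | "k > n + 1" by linarith
    then show ?thesis
    proof cases
      case 1
      then show ?thesis using cont_term_limit_le[OF assms, of "n - k"] by (simp add: lt_def u_def v_def)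
    next
      case 2
      then show ?thesis using cont_term_limit_Suc[of n m] by (simp add: lt_def u_def v_def del: of_nat_add)
    next
      case 3
      then show ?thesis using cont_term_limit_gt[OF 3, of m] by (simp add: lt_def u_def v_def)
    qed
  qed
  have "isCont (\<lambda>s2. rem_int K (u, s2)) v"
    by (rule isCont_o2[where f="\<lambda>s2. (u, s2)" and g="rem_int K", OF _ isCont_rem_int[OF uv]])
       (intro continuous_intros)
  then have "isCont (\<lambda>s2. rGamma s2 * rem_int K (u, s2)) v" by (intro continuous_intros)
  moreover have "rGamma v = 0" by (simp add: v_def rGamma_eq_zero_iff)
  ultimately have rem: "((\<lambda>s2. rGamma s2 * rem_int K (u, s2)) \<longlongrightarrow> 0) (at v)" by (simp add: isCont_def)
  have outer: "((\<lambda>s2. cont_expr K (u, s2)) \<longlongrightarrow> - ?R + (\<Sum>k<Suc K. lt k) + 0) (at v)"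
    unfolding cont
    by (intro tendsto_add tendsto_sum ct rem) (use main_term_limit[OF assms(1)] in \<open>simp only: u_def v_def\<close>)
  have "(\<Sum>k<Suc K. lt k) = (\<Sum>k\<in>{..n} \<union> {Suc n}. lt k)"
    by (rule sum.mono_neutral_right) (auto simp: lt_def K_def)
  also have "\<dots> = (\<Sum>k\<le>n. limit_term m n (n - k)) + ?B"
    by (subst sum.union_disjoint) (auto simp: lt_def)
  also have "(\<Sum>k\<le>n. limit_term m n (n - k)) = (\<Sum>k\<le>n. limit_term m n k)"
    by (rule sum.reindex_bij_witness[of _ "\<lambda>k. n - k" "\<lambda>k. n - k"]) auto
  also have "{..n} = insert 0 ({k\<in>{1..n}. odd k} \<union> {k\<in>{1..n}. even k})" by auto
  also have "(\<Sum>k\<in>\<dots>. limit_term m n k) = limit_term m n 0 +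
      ((\<Sum>k\<in>{k\<in>{1..n}. odd k}. limit_term m n k) + (\<Sum>k\<in>{k\<in>{1..n}. even k}. limit_term m n k))"
    by (subst sum.insert; (subst sum.union_disjoint)?) auto
  also have "limit_term m n 0 = ?L" by (rule limit_term_0)
  also have "(\<Sum>k\<in>{k\<in>{1..n}. odd k}. limit_term m n k) = - ?O"
    unfolding sum_negf[symmetric] by (intro sum.cong refl limit_term_odd) auto
  also have "(\<Sum>k\<in>{k\<in>{1..n}. even k}. limit_term m n k) = 0"
    by (intro sum.neutral) (auto simp: limit_term_def)
  finally have S: "(\<Sum>k<Suc K. lt k) = ?L + (- ?O + 0) + ?B" .
  \<comment> \<open>An even \<open>k\<close> in the range forces n >= 2 and so m >= 1, which keeps
    the odd index m + n - k + 1 away from 1, where the Bernoulli number is 1/2.\<close>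
  have "?E = 0"
  proof (intro sum.neutral ballI)
    fix k assume k: "k \<in> {k\<in>{1..n}. even k}"
    then have "n \<ge> 2" by (cases "n = 1") auto
    then have "m \<ge> 1" by (rule assms(2))
    then have "odd (m + n - k + 1)" "m + n - k + 1 \<ge> 2" using k assms(1) by auto
    then have "bernoulli (m + n - k + 1) = 0" by (rule bernoulli_odd_eq_0)
    then show "of_nat (n choose k) * (of_real (bernoulli (m + n - k + 1)) / of_nat (m + n - k + 1)) *
          (- a_coeff k + fact k * b_coeff k) = 0"
      by (simp only: of_real_0 div_0 mult_zero_left mult_zero_right)
  qed
  then have "- ?R + (\<Sum>k<Suc K. lt k) + 0 = ?B + ?L - ?O + ?E - ?R"
    unfolding S by (simp only:) simp
  with outer inner show ?thesis
    unfolding has_reverse_value_def u_def[symmetric] v_def[symmetric]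
    by (intro exI[of _ "\<lambda>s2. cont_expr K (u, s2)"]) (simp only: simp_thms)
qed

end
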